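(* Let $V\subset\mathbb{C}^n$ be an irreducible complex variety of dimension $d\in\{1,\ldots,n-1\}$. Let $\Sigma_0(V)\subset\mathbb{C}^n\times V$ be the set of all pairs $(\mathbf{x},\mathbf{y})\in\mathbb{C}^n\times(V\setminus\mathrm{Sing}\,V)$ with $\mathbf{x}\in\mathbf{y}+\mathrm{range}\,D(V)(\mathbf{y})$, let $\Sigma(V)$ be the Zariski closure of $\Sigma_0(V)$ in $\mathbb{C}^{2n}$, and let $\Sigma_1(V)\subset\mathbb{C}^n\times V\subset\mathbb{C}^{2n}$ be the variety of all pairs $(\mathbf{x},\mathbf{y})$ with $\mathbf{x}\in\mathbb{C}^n$ and $\mathbf{y}\in V$ such that all minors of order $n-d+1$ of the matrix $[D(V)(\mathbf{y}),\mathbf{x}-\mathbf{y}]$ are zero. Then $\Sigma_0(V)$ is a quasi-algebraic subset of $\Sigma(V)$, and $\Sigma(V)\subset\mathbb{C}^n\times V$ is an irreducible variety of dimension $n$ which is an irreducible component of $\Sigma_1(V)$. Each point in $\Sigma_0(V)$ is a smooth point of $\Sigma(V)$. If $V$ is singular, then all other irreducible components of $\Sigma_1(V)$ are the irreducible components of $\mathbb{C}^n\times\mathrm{Sing}\,V$.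
   Context: A variety $V\subset\mathbb{C}^n$ is a common zero set $V=\bigcap_{i=1}^m Z(p_i)$ of finitely many polynomials; here $p_1,\ldots,p_m$ are chosen to generate the ideal of polynomials vanishing on $V$. $V$ is irreducible if it is not the union of two strict subvarieties. For $\mathbf{y}\in V$, $D(V)(\mathbf{y})=\big([\partial p_i/\partial x_j(\mathbf{y})]_{i,j=1}^{m,n}\big)^\top\in\mathbb{C}^{n\times m}$, $\mathrm{range}\,D(V)(\mathbf{y})\subset\mathbb{C}^n$ is its column space, and with $d=\dim V$, $\mathrm{Sing}\,V:=\{\mathbf{y}\in V:\mathrm{rank}\,D(V)(\mathbf{y})<n-d\}$, a strict subvariety of $V$; off $\mathrm{Sing}\,V$ the rank equals $n-d$. $V$ is smooth if $\mathrm{Sing}\,V=\emptyset$, otherwise singular. A quasi-algebraic set is a set of the form $A\setminus B$ with $A,B$ algebraic. *)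

theory Defs
  imports
    Complex_Main
    "HOL-Library.Poly_Mapping"
    "HOL-Library.Extended_Nat"
    "Jordan_Normal_Form.DL_Rank"
    "Jordan_Normal_Form.DL_Submatrix"
begin

section \<open>Complex polynomials in the variables \<open>x\<^sub>0, \<dots>, x\<^bsub>n-1\<^esub>\<close>\<close>

text \<open>A polynomial maps exponent vectors (finitely supported functions from variable indices to
  exponents) to coefficients; its ring structure is the convolution product of \<^type>\<open>poly_mapping\<close>.\<close>

type_synonym cpoly = "(nat \<Rightarrow>\<^sub>0 nat) \<Rightarrow>\<^sub>0 complex"

definition polys :: "nat \<Rightarrow> cpoly set" where
  "polys n = {p. \<forall>m \<in> Poly_Mapping.keys p. Poly_Mapping.keys m \<subseteq> {..<n}}"

definition poly_eval :: "cpoly \<Rightarrow> complex vec \<Rightarrow> complex" where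
  "poly_eval p y =
    (\<Sum>m \<in> Poly_Mapping.keys p. Poly_Mapping.lookup p m *
       (\<Prod>i \<in> Poly_Mapping.keys m. y $ i ^ Poly_Mapping.lookup m i))"

text \<open>Formal partial derivative. Subtraction of exponent vectors is truncated, which only affects
  monomials not containing \<open>x\<^sub>j\<close>; their coefficient is multiplied by \<open>0\<close>.\<close>

definition partial_deriv :: "nat \<Rightarrow> cpoly \<Rightarrow> cpoly" where
  "partial_deriv j p =
    (\<Sum>m \<in> Poly_Mapping.keys p. Poly_Mapping.single (m - Poly_Mapping.single j 1)
       (of_nat (Poly_Mapping.lookup m j) * Poly_Mapping.lookup p m))"

section \<open>Affine varieties\<close>

definition zero_set :: "nat \<Rightarrow> cpoly set \<Rightarrow> complex vec set" where
  "zero_set n P = {y \<in> carrier_vec n. \<forall>p \<in> P. poly_eval p y = 0}"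

definition variety :: "nat \<Rightarrow> complex vec set \<Rightarrow> bool" where
  "variety n V \<longleftrightarrow> (\<exists>P. finite P \<and> P \<subseteq> polys n \<and> V = zero_set n P)"

definition quasi_algebraic :: "nat \<Rightarrow> complex vec set \<Rightarrow> bool" where
  "quasi_algebraic n S \<longleftrightarrow> (\<exists>A B. variety n A \<and> variety n B \<and> S = A - B)"

definition zariski_closure :: "nat \<Rightarrow> complex vec set \<Rightarrow> complex vec set" where
  "zariski_closure n S = \<Inter> {W. variety n W \<and> S \<subseteq> W}"

text \<open>The empty variety is not counted as irreducible.\<close>

definition irreducible_variety :: "nat \<Rightarrow> complex vec set \<Rightarrow> bool" where
  "irreducible_variety n V \<longleftrightarrow> variety n V \<and> V \<noteq> {} \<and>
    \<not> (\<exists>A B. variety n A \<and> variety n B \<and> A \<subset> V \<and> B \<subset> V \<and> V = A \<union> B)"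

definition irreducible_components :: "nat \<Rightarrow> complex vec set \<Rightarrow> complex vec set set" where
  "irreducible_components n V =
    {W. irreducible_variety n W \<and> W \<subseteq> V \<and>
        (\<forall>W'. irreducible_variety n W' \<and> W \<subseteq> W' \<and> W' \<subseteq> V \<longrightarrow> W' = W)}"

text \<open>Krull dimension.\<close>

definition variety_dim :: "nat \<Rightarrow> complex vec set \<Rightarrow> enat" where
  "variety_dim n V =
    Sup {enat k | k. \<exists>Z. (\<forall>i\<le>k. irreducible_variety n (Z i) \<and> Z i \<subseteq> V) \<and>
                        (\<forall>i<k. Z i \<subset> Z (Suc i))}"

section \<open>Generators of the vanishing ideal and the singular locus\<close>

definition vanishing_ideal :: "nat \<Rightarrow> complex vec set \<Rightarrow> cpoly set" where
  "vanishing_ideal n V = {p \<in> polys n. \<forall>y \<in> V. poly_eval p y = 0}"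

definition generated_ideal :: "nat \<Rightarrow> cpoly list \<Rightarrow> cpoly set" where
  "generated_ideal n ps =
    {\<Sum>i<length ps. q i * ps ! i | q. \<forall>i<length ps. q i \<in> polys n}"

definition ideal_generators :: "nat \<Rightarrow> complex vec set \<Rightarrow> cpoly list \<Rightarrow> bool" where
  "ideal_generators n V ps \<longleftrightarrow>
    set ps \<subseteq> polys n \<and> generated_ideal n ps = vanishing_ideal n V"

text \<open>The \<open>n \<times> m\<close> matrix \<open>D(V)(y)\<close> (the transposed Jacobian). It depends on the chosen list \<open>ps\<close> of
  generators of the vanishing ideal of \<open>V\<close>, which is therefore an explicit argument here and in
  the notions below.\<close>

definition Dmat :: "nat \<Rightarrow> cpoly list \<Rightarrow> complex vec \<Rightarrow> complex mat" where
  "Dmat n ps y = mat n (length ps) (\<lambda>(j, i). poly_eval (partial_deriv j (ps ! i)) y)"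

definition Sing :: "nat \<Rightarrow> complex vec set \<Rightarrow> cpoly list \<Rightarrow> complex vec set" where
  "Sing n V ps =
    {y \<in> V. vec_space.rank n (Dmat n ps y) < n - the_enat (variety_dim n V)}"

section \<open>The correspondences \<open>\<Sigma>\<^sub>0(V)\<close>, \<open>\<Sigma>(V)\<close> and \<open>\<Sigma>\<^sub>1(V)\<close>\<close>

text \<open>A pair \<open>(x, y)\<close> of points of \<open>\<complex>\<^sup>n\<close> is represented by the concatenated vector
  \<open>x @\<^sub>v y\<close> in \<open>\<complex>\<^bsup>2n\<^esup>\<close>.\<close>

definition vec_prod :: "complex vec set \<Rightarrow> complex vec set \<Rightarrow> complex vec set" where
  "vec_prod A B = {x @\<^sub>v y | x y. x \<in> A \<and> y \<in> B}"

definition Sigma0 :: "nat \<Rightarrow> complex vec set \<Rightarrow> cpoly list \<Rightarrow> complex vec set" where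
  "Sigma0 n V ps =
    {x @\<^sub>v y | x y. x \<in> carrier_vec n \<and> y \<in> V - Sing n V ps \<and>
       (\<exists>r \<in> vec_space.col_space n (Dmat n ps y). x = y + r)}"

definition SigmaV :: "nat \<Rightarrow> complex vec set \<Rightarrow> cpoly list \<Rightarrow> complex vec set" where
  "SigmaV n V ps = zariski_closure (2 * n) (Sigma0 n V ps)"

definition minors_vanish :: "nat \<Rightarrow> complex mat \<Rightarrow> bool" where
  "minors_vanish k A \<longleftrightarrow>
    (\<forall>I J. I \<subseteq> {..<dim_row A} \<and> J \<subseteq> {..<dim_col A} \<and> card I = k \<and> card J = k \<longrightarrow>
       det (submatrix A I J) = 0)"

definition Sigma1 :: "nat \<Rightarrow> complex vec set \<Rightarrow> cpoly list \<Rightarrow> complex vec set" where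
  "Sigma1 n V ps =
    {x @\<^sub>v y | x y. x \<in> carrier_vec n \<and> y \<in> V \<and>
       minors_vanish (n - the_enat (variety_dim n V) + 1)
         (mat_of_cols n (cols (Dmat n ps y) @ [x - y]))}"

end

theory Submission
  imports
    Defs
    "HOL-Computational_Algebra.Fundamental_Theorem_Algebra"
    "Jordan_Normal_Form.DL_Rank_Submatrix"
begin

text \<open>
  The dimension of an irreducible variety \<open>V\<close> is computed as the largest number of coordinates that
  are algebraically independent on \<open>V\<close>. Fix such a set \<open>S\<close> of coordinates and adjoin the remaining
  ones successively; each satisfies a relation of minimal degree over the preceding ones. Pseudo-division
  by these relations shows that every polynomial not vanishing on \<open>V\<close> divides, modulo the ideal of \<open>V\<close>,
  a nonzero polynomial in the coordinates \<open>S\<close>, so that proper irreducible subvarieties have smaller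
  dimension. It also shows that generic values of the coordinates \<open>S\<close> lift to points of \<open>V\<close>, so that
  fixing one coordinate lowers the dimension by exactly one; hence this dimension is the Krull dimension.
  Finally the gradients of the relations generically span all gradients of polynomials in the ideal,
  and they are independent where the separants do not vanish: the Jacobian matrix has rank at most
  \<open>n - d\<close> everywhere on \<open>V\<close>, with equality generically.

  The set \<open>\<Sigma>\<^sub>0\<close> is the image of \<open>(t, y) \<mapsto> (y + D(y) t, y)\<close>, so \<open>\<Sigma>\<close> is irreducible. The coordinates
  \<open>S\<close> of \<open>y\<close> together with \<open>n - d\<close> coordinates of \<open>x\<close> are independent on \<open>\<Sigma>\<close>, hence \<open>dim \<Sigma> \<ge> n\<close>. At a
  point of \<open>\<Sigma>\<^sub>0\<close> the generators of the ideal of \<open>V\<close> and the bordered minors have \<open>n\<close> independent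
  gradients, which gives both \<open>dim \<Sigma> \<le> n\<close> and smoothness. Since \<open>\<Sigma>\<^sub>1 = \<Sigma> \<union> (\<complex>\<^sup>n \<times> Sing V)\<close> and a component
  of \<open>\<complex>\<^sup>n \<times> Sing V\<close> is translation invariant in \<open>x\<close>, hence of dimension at least \<open>n\<close>, no such component
  lies in \<open>\<Sigma>\<close>.
\<close>

section \<open>Evaluation\<close>

text \<open>Fraction fields, localisation and fibre dimension are all avoided. Pseudo-division
  clears denominators: it leaves powers of leading coefficients as factors, and these are handled by
  restricting to points where they do not vanish. A generic point is always a common point of
  non-vanishing of finitely many polynomials outside a prime ideal. The ideal of \<Sigma> is never
  determined. A vector orthogonal to the gradients of a generating list is orthogonal to the
  gradient of every member of the ideal, so exhibiting suitable members is enough. The upper bound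
  for dim \<Sigma> is then the Jacobian rank bound, applied to \<Sigma> in 2n-space at a single
  point of \<open>Sigma0\<close>; that bound holds at every point because a minor that is nonzero
  somewhere on an irreducible variety is nonzero generically. The last comparison requires neither
  the dimension of Sing V nor a product formula: a component of the cylinder over Sing V inside
  \<Sigma> would be a proper irreducible subvariety, hence of dimension below n.\<close>

text \<open>The variable set is arbitrary because coordinates are adjoined one by one to a set
  \<open>S\<close> that need not be an initial segment.\<close>

definition polys_in :: "nat set \<Rightarrow> cpoly set" where
  "polys_in T = {p. \<forall>m \<in> Poly_Mapping.keys p. Poly_Mapping.keys m \<subseteq> T}"

definition Const :: "complex \<Rightarrow> cpoly" where
  "Const c = Poly_Mapping.single 0 c"

definition Var :: "nat \<Rightarrow> cpoly" where
  "Var i = Poly_Mapping.single (Poly_Mapping.single i 1) 1"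

definition eval_monom :: "complex vec \<Rightarrow> (nat \<Rightarrow>\<^sub>0 nat) \<Rightarrow> complex" where
  "eval_monom y m = (\<Prod>i \<in> Poly_Mapping.keys m. y $ i ^ Poly_Mapping.lookup m i)"

lemma polys_eq: "polys n = polys_in {..<n}"
  by (simp add: polys_def polys_in_def)

lemma eval_monom_superset:
  assumes "finite K" "Poly_Mapping.keys m \<subseteq> K"
  shows "eval_monom y m = (\<Prod>i \<in> K. y $ i ^ Poly_Mapping.lookup m i)"
  unfolding eval_monom_def
  by (rule prod.mono_neutral_left) (use assms in \<open>auto simp: in_keys_iff\<close>)

lemma eval_monom_add: "eval_monom y (m + m') = eval_monom y m * eval_monom y m'"
proof -
  let ?K = "Poly_Mapping.keys m \<union> Poly_Mapping.keys m'"
  have k: "Poly_Mapping.keys (m + m') \<subseteq> ?K" by (rule keys_add)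
  show ?thesis
    by (subst (1 2 3) eval_monom_superset[of ?K])
       (use k in \<open>auto simp: lookup_add power_add prod.distrib\<close>)
qed

lemma poly_eval_superset:
  assumes "finite K" "Poly_Mapping.keys p \<subseteq> K"
  shows "poly_eval p y = (\<Sum>m \<in> K. Poly_Mapping.lookup p m * eval_monom y m)"
  unfolding poly_eval_def eval_monom_def
  by (rule sum.mono_neutral_left) (use assms in \<open>auto simp: in_keys_iff\<close>)

lemma poly_eval_0 [simp]: "poly_eval 0 y = 0"
  by (simp add: poly_eval_def)

lemma poly_eval_add [simp]: "poly_eval (p + q) y = poly_eval p y + poly_eval q y"
proof -
  let ?K = "Poly_Mapping.keys p \<union> Poly_Mapping.keys q"
  have k: "Poly_Mapping.keys (p + q) \<subseteq> ?K" by (rule keys_add)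
  show ?thesis
    by (subst (1 2 3) poly_eval_superset[of ?K])
       (use k in \<open>auto simp: lookup_add ring_distribs sum.distrib\<close>)
qed

lemma poly_eval_sum [simp]: "poly_eval (sum f A) y = (\<Sum>a\<in>A. poly_eval (f a) y)"
  by (induction A rule: infinite_finite_induct) auto

lemma poly_eval_single: "poly_eval (Poly_Mapping.single m c) y = c * eval_monom y m"
  by (subst poly_eval_superset[of "{m}"]) auto

lemma sum_single_keys:
  "(p :: 'a \<Rightarrow>\<^sub>0 'b::comm_monoid_add) =
    (\<Sum>m\<in>Poly_Mapping.keys p. Poly_Mapping.single m (Poly_Mapping.lookup p m))"
proof (rule poly_mapping_eqI)
  fix k
  have "(\<Sum>m\<in>Poly_Mapping.keys p. Poly_Mapping.lookup (Poly_Mapping.single m (Poly_Mapping.lookup p m)) k)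
     = (\<Sum>m\<in>Poly_Mapping.keys p. if m = k then Poly_Mapping.lookup p k else 0)"
    by (intro sum.cong) (auto simp: lookup_single when_def)
  also have "\<dots> = Poly_Mapping.lookup p k"
    by (simp add: in_keys_iff)
  finally show "Poly_Mapping.lookup p k = Poly_Mapping.lookup
      (\<Sum>m\<in>Poly_Mapping.keys p. Poly_Mapping.single m (Poly_Mapping.lookup p m)) k"
    by (simp add: lookup_sum)
qed

lemma poly_eval_mult [simp]: "poly_eval (p * q) y = poly_eval p y * poly_eval q y"
proof -
  let ?P = "\<lambda>m. Poly_Mapping.single m (Poly_Mapping.lookup p m)"
  let ?Q = "\<lambda>m. Poly_Mapping.single m (Poly_Mapping.lookup q m)"
  have "poly_eval (p * q) y =
      poly_eval ((\<Sum>m\<in>Poly_Mapping.keys p. ?P m) * (\<Sum>m\<in>Poly_Mapping.keys q. ?Q m)) y"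
    by (simp add: sum_single_keys[symmetric])
  also have "\<dots> = (\<Sum>m\<in>Poly_Mapping.keys p. \<Sum>m'\<in>Poly_Mapping.keys q.
      poly_eval (?P m) y * poly_eval (?Q m') y)"
    by (simp add: sum_product mult_single poly_eval_single eval_monom_add algebra_simps)
  also have "\<dots> = poly_eval (\<Sum>m\<in>Poly_Mapping.keys p. ?P m) y *
      poly_eval (\<Sum>m\<in>Poly_Mapping.keys q. ?Q m) y"
    by (simp add: sum_product)
  also have "\<dots> = poly_eval p y * poly_eval q y"
    by (simp only: sum_single_keys[symmetric])
  finally show ?thesis .
qed

lemma poly_eval_Const [simp]: "poly_eval (Const c) y = c"
  by (simp add: Const_def poly_eval_single eval_monom_def)

lemma poly_eval_Var [simp]: "poly_eval (Var i) y = y $ i"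
  by (simp add: Var_def poly_eval_single eval_monom_def)

lemma Const_0 [simp]: "Const 0 = 0" and Const_1 [simp]: "Const 1 = 1"
  by (simp_all add: Const_def)

lemma poly_eval_1 [simp]: "poly_eval 1 y = 1"
  using poly_eval_Const[of 1 y] by (simp del: poly_eval_Const)

lemma Const_mult: "Const (a * b) = Const a * Const b"
  by (simp add: Const_def mult_single)

lemma poly_eval_uminus [simp]: "poly_eval (- p) y = - poly_eval p y"
  using poly_eval_add[of p "- p" y] by (simp del: poly_eval_add add: eq_neg_iff_add_eq_0 add.commute)

lemma poly_eval_diff [simp]: "poly_eval (p - q) y = poly_eval p y - poly_eval q y"
  using poly_eval_add[of p "- q" y] by (simp del: poly_eval_add)

lemma poly_eval_power [simp]: "poly_eval (p ^ k) y = poly_eval p y ^ k"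
  by (induction k) auto

lemma poly_eval_prod [simp]: "poly_eval (prod f A) y = (\<Prod>a\<in>A. poly_eval (f a) y)"
  by (induction A rule: infinite_finite_induct) auto

section \<open>Polynomials in a given set of variables\<close>

lemma polys_in_0 [simp]: "0 \<in> polys_in T"
  and polys_in_Const [simp]: "Const c \<in> polys_in T"
  and polys_in_1 [simp]: "1 \<in> polys_in T"
  by (auto simp: polys_in_def Const_def split: if_splits)

lemma polys_in_Var [simp]: "Var i \<in> polys_in T \<longleftrightarrow> i \<in> T"
  by (auto simp: polys_in_def Var_def)

lemma polys_in_add: "p \<in> polys_in T \<Longrightarrow> q \<in> polys_in T \<Longrightarrow> p + q \<in> polys_in T"
  using keys_add[of p q] by (auto simp: polys_in_def)

lemma polys_in_mult:
  assumes "p \<in> polys_in T" "q \<in> polys_in T"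
  shows "p * q \<in> polys_in T"
proof -
  have "Poly_Mapping.keys m \<subseteq> T" if m: "m \<in> Poly_Mapping.keys (p * q)" for m
  proof -
    obtain a b where "m = a + b" "a \<in> Poly_Mapping.keys p" "b \<in> Poly_Mapping.keys q"
      using m keys_mult[of p q] by blast
    then show ?thesis
      using keys_add[of a b] assms unfolding polys_in_def by fastforce
  qed
  then show ?thesis by (simp add: polys_in_def)
qed

lemma polys_in_uminus: "p \<in> polys_in T \<Longrightarrow> - p \<in> polys_in T"
  by (simp add: polys_in_def)

lemma polys_in_diff: "p \<in> polys_in T \<Longrightarrow> q \<in> polys_in T \<Longrightarrow> p - q \<in> polys_in T"
  using polys_in_add[of p T "- q"] polys_in_uminus by simp

lemma polys_in_sum: "(\<And>a. a \<in> A \<Longrightarrow> f a \<in> polys_in T) \<Longrightarrow> sum f A \<in> polys_in T"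
  by (induction A rule: infinite_finite_induct) (auto intro: polys_in_add)

lemma polys_in_prod: "(\<And>a. a \<in> A \<Longrightarrow> f a \<in> polys_in T) \<Longrightarrow> prod f A \<in> polys_in T"
  by (induction A rule: infinite_finite_induct) (auto intro: polys_in_mult)

lemma polys_in_power: "p \<in> polys_in T \<Longrightarrow> p ^ k \<in> polys_in T"
  by (induction k) (auto intro: polys_in_mult)

lemma polys_in_mono: "S \<subseteq> T \<Longrightarrow> polys_in S \<subseteq> polys_in T"
  by (auto simp: polys_in_def)

lemma single_single_eq_Var_power:
  "Poly_Mapping.single (Poly_Mapping.single i k) (1::complex) = Var i ^ k"
proof (induction k)
  case (Suc k)
  have "Poly_Mapping.single (Poly_Mapping.single i (Suc k)) (1::complex) =
      Poly_Mapping.single (Poly_Mapping.single i 1 + Poly_Mapping.single i k) (1 * 1)"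
    by (simp add: single_add[symmetric])
  also have "\<dots> = Var i ^ Suc k"
    by (simp only: mult_single[symmetric] Suc) (simp add: Var_def)
  finally show ?case .
qed simp

lemma single_sum_eq_prod:
  "finite K \<Longrightarrow> Poly_Mapping.single (\<Sum>i\<in>K. f i) (1::complex) = (\<Prod>i\<in>K. Poly_Mapping.single (f i) 1)"
proof (induction K rule: finite_induct)
  case (insert x F)
  then show ?case
    by (simp add: mult_single insert.IH[symmetric])
qed simp

lemma single_eq_prod_Var:
  "Poly_Mapping.single m c = Const c * (\<Prod>i\<in>Poly_Mapping.keys m. Var i ^ Poly_Mapping.lookup m i)"
proof -
  have "Poly_Mapping.single m c = Const c * Poly_Mapping.single m 1"
    by (simp add: Const_def mult_single)
  also have "Poly_Mapping.single m (1::complex) = Poly_Mapping.single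
      (\<Sum>i\<in>Poly_Mapping.keys m. Poly_Mapping.single i (Poly_Mapping.lookup m i)) 1"
    by (simp add: sum_single_keys[symmetric])
  finally show ?thesis
    by (simp add: single_sum_eq_prod single_single_eq_Var_power)
qed

text \<open>Replaces monomial expansions below: evaluation, substitution and restriction to a line
  all respect the ring operations.\<close>

lemma polys_in_induct [consumes 1, case_names const var add mult]:
  assumes p: "p \<in> polys_in T"
    and c: "\<And>c. K (Const c)" and v: "\<And>i. i \<in> T \<Longrightarrow> K (Var i)"
    and a: "\<And>p q. K p \<Longrightarrow> K q \<Longrightarrow> K (p + q)"
    and m: "\<And>p q. K p \<Longrightarrow> K q \<Longrightarrow> K (p * q)"
  shows "K p"
proof -
  have pow: "K (Var i ^ k)" if "i \<in> T" for i k
  proof (induction k)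
    case 0
    then show ?case using c[of 1] by simp
  next
    case (Suc k)
    from m[OF v[OF that] Suc] show ?case by simp
  qed
  have mono: "K (Poly_Mapping.single x d)" if "Poly_Mapping.keys x \<subseteq> T" for x d
  proof -
    have "K (\<Prod>i\<in>L. Var i ^ Poly_Mapping.lookup x i)" if "finite L" "L \<subseteq> T" for L
      using that
    proof (induction L rule: finite_induct)
      case empty
      then show ?case using c[of 1] by simp
    next
      case (insert i L)
      then have "K (Var i ^ Poly_Mapping.lookup x i)"
        and "K (\<Prod>i\<in>L. Var i ^ Poly_Mapping.lookup x i)" using pow by auto
      from m[OF this] show ?case using insert.hyps by (simp del: Const_1)
    qed
    then show ?thesis
      unfolding single_eq_prod_Var by (intro m c) (use that in simp_all)
  qed
  have "K (\<Sum>x\<in>L. Poly_Mapping.single x (Poly_Mapping.lookup p x))"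
    if "finite L" "L \<subseteq> Poly_Mapping.keys p" for L
    using that
  proof (induction L rule: finite_induct)
    case empty
    then show ?case using c[of 0] by simp
  next
    case (insert x F)
    have "Poly_Mapping.keys x \<subseteq> T" using p insert.prems by (auto simp: polys_in_def)
    then show ?case using insert a mono by simp
  qed
  then show ?thesis
    using sum_single_keys[of p] by (metis finite_keys order_refl)
qed

lemma poly_eval_cong:
  assumes "p \<in> polys_in T" "\<And>i. i \<in> T \<Longrightarrow> y $ i = z $ i"
  shows "poly_eval p y = poly_eval p z"
  using assms(1) by (induction rule: polys_in_induct) (auto simp: assms(2))

text \<open>Entries beyond the dimension of a vector are the same unspecified values for all vectors
  of that dimension.\<close>

lemma vec_index_beyond:
  assumes "y \<in> carrier_vec n" "z \<in> carrier_vec n" "\<not> i < n"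
  shows "y $ i = z $ i"
  using assms unfolding carrier_vec_def
  by (transfer, auto simp: mk_vec_def)

section \<open>Functions induced by polynomials\<close>

text \<open>Determinants and compositions can be recognised as polynomial functions by closure
  rules, and a polynomial representing them is extracted only when an ideal is involved.\<close>

definition polyfun :: "nat \<Rightarrow> (complex vec \<Rightarrow> complex) \<Rightarrow> bool" where
  "polyfun n f \<longleftrightarrow> (\<exists>p \<in> polys n. \<forall>y \<in> carrier_vec n. f y = poly_eval p y)"

lemma polyfun_const: "polyfun n (\<lambda>_. c)"
  unfolding polyfun_def by (rule bexI[of _ "Const c"]) (auto simp: polys_eq)

lemma polyfun_index: "polyfun n (\<lambda>y. y $ i)"
proof (cases "i < n")
  case True
  then show ?thesis
    unfolding polyfun_def by (intro bexI[of _ "Var i"]) (auto simp: polys_eq)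
next
  case False
  show ?thesis
    unfolding polyfun_def
    by (intro bexI[of _ "Const (0\<^sub>v n $ i)"] ballI)
       (use False vec_index_beyond[of _ n "0\<^sub>v n" i] in \<open>auto simp: polys_eq\<close>)
qed

lemma polyfun_add: "polyfun n f \<Longrightarrow> polyfun n g \<Longrightarrow> polyfun n (\<lambda>y. f y + g y)"
  unfolding polyfun_def polys_eq by (metis poly_eval_add polys_in_add)

lemma polyfun_mult: "polyfun n f \<Longrightarrow> polyfun n g \<Longrightarrow> polyfun n (\<lambda>y. f y * g y)"
  unfolding polyfun_def polys_eq by (metis poly_eval_mult polys_in_mult)

lemma polyfun_diff: "polyfun n f \<Longrightarrow> polyfun n g \<Longrightarrow> polyfun n (\<lambda>y. f y - g y)"
  unfolding polyfun_def polys_eq by (metis poly_eval_diff polys_in_diff)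

lemma polyfun_sum: "(\<And>a. a \<in> A \<Longrightarrow> polyfun n (f a)) \<Longrightarrow> polyfun n (\<lambda>y. \<Sum>a\<in>A. f a y)"
  by (induction A rule: infinite_finite_induct) (auto intro: polyfun_add polyfun_const)

lemma polyfun_prod: "(\<And>a. a \<in> A \<Longrightarrow> polyfun n (f a)) \<Longrightarrow> polyfun n (\<lambda>y. \<Prod>a\<in>A. f a y)"
  by (induction A rule: infinite_finite_induct) (auto intro: polyfun_mult polyfun_const)

lemma polyfun_cong:
  "polyfun n f \<Longrightarrow> (\<And>y. y \<in> carrier_vec n \<Longrightarrow> f y = g y) \<Longrightarrow> polyfun n g"
  unfolding polyfun_def by metis

text \<open>The variables of \<open>p\<close> are unrestricted: on \<open>carrier_vec n\<close>,
  those of index at least \<open>n\<close> evaluate to constants.\<close>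

lemma polyfun_poly_eval: "polyfun n (poly_eval p)"
proof -
  have "p \<in> polys_in UNIV" by (simp add: polys_in_def)
  then show ?thesis
  proof (induction rule: polys_in_induct)
    case (const c)
    then show ?case by (simp add: polyfun_const)
  next
    case (var i)
    then show ?case by (simp add: polyfun_index)
  next
    case (add p q)
    then show ?case using polyfun_add[of n "poly_eval p" "poly_eval q"]
      by (auto elim: polyfun_cong)
  next
    case (mult p q)
    then show ?case using polyfun_mult[of n "poly_eval p" "poly_eval q"]
      by (auto elim: polyfun_cong)
  qed
qed

lemma polyfun_compose:
  assumes "p \<in> polys N" "\<And>i. i < N \<Longrightarrow> polyfun n (\<lambda>y. \<Phi> y $ i)"
  shows "polyfun n (\<lambda>y. poly_eval p (\<Phi> y))"
  using assms(1) unfolding polys_eq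
proof (induction rule: polys_in_induct)
  case (const c)
  then show ?case by (simp add: polyfun_const)
next
  case (var i)
  then show ?case by (simp add: assms(2))
next
  case (add p q)
  then show ?case by (auto intro!: polyfun_add)
next
  case (mult p q)
  then show ?case by (auto intro!: polyfun_mult)
qed

lemma polyfun_det:
  assumes "\<And>i j. i < k \<Longrightarrow> j < k \<Longrightarrow> polyfun n (\<lambda>y. A y $$ (i, j))"
    and "\<And>y. A y \<in> carrier_mat k k"
  shows "polyfun n (\<lambda>y. det (A y))"
proof -
  have d: "det (A y) = (\<Sum>\<pi> | \<pi> permutes {0..<k}. signof \<pi> * (\<Prod>i = 0..<k. A y $$ (i, \<pi> i)))" for y
    using assms(2)[of y] by (simp add: det_def)
  show ?thesis
    unfolding d
    by (intro polyfun_sum polyfun_mult polyfun_const polyfun_prod assms(1))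
       (auto simp: permutes_in_image)
qed

lemma poly_eval_line:
  assumes "p \<in> polys n"
  shows "\<exists>P. \<forall>s. poly_eval p (vec n (\<lambda>i. a i + s * b i)) = poly P s"
  using assms unfolding polys_eq
proof (induction rule: polys_in_induct)
  case (const c)
  then show ?case by (intro exI[of _ "[:c:]"]) simp
next
  case (var i)
  then show ?case by (intro exI[of _ "[:a i, b i:]"]) simp
next
  case (add p q)
  then obtain P Q where "\<forall>s. poly_eval p (vec n (\<lambda>i. a i + s * b i)) = poly P s"
    "\<forall>s. poly_eval q (vec n (\<lambda>i. a i + s * b i)) = poly Q s" by blast
  then show ?case by (intro exI[of _ "P + Q"]) simp
next
  case (mult p q)
  then obtain P Q where "\<forall>s. poly_eval p (vec n (\<lambda>i. a i + s * b i)) = poly P s"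
    "\<forall>s. poly_eval q (vec n (\<lambda>i. a i + s * b i)) = poly Q s" by blast
  then show ?case by (intro exI[of _ "P * Q"]) simp
qed

text \<open>On the line through \<open>y\<close> and \<open>z\<close> both polynomials become
  nonzero univariate ones, and their product has finitely many roots. Working on a line keeps every
  coordinate in which \<open>y\<close> and \<open>z\<close> agree.\<close>

lemma common_nonzero_on_line:
  assumes "p \<in> polys n" "q \<in> polys n" "y \<in> carrier_vec n" "z \<in> carrier_vec n"
    and "poly_eval p y \<noteq> 0" "poly_eval q z \<noteq> 0"
  shows "\<exists>s. poly_eval p (vec n (\<lambda>i. y $ i + s * (z $ i - y $ i))) \<noteq> 0 \<and>
             poly_eval q (vec n (\<lambda>i. y $ i + s * (z $ i - y $ i))) \<noteq> 0"
proof -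
  let ?l = "\<lambda>s. vec n (\<lambda>i. y $ i + s * (z $ i - y $ i))"
  obtain P where P: "\<And>s. poly_eval p (?l s) = poly P s"
    using poly_eval_line[OF assms(1)] by metis
  obtain Q where Q: "\<And>s. poly_eval q (?l s) = poly Q s"
    using poly_eval_line[OF assms(2)] by metis
  have l: "?l 0 = y" "?l 1 = z" using assms by auto
  have "P \<noteq> 0" "Q \<noteq> 0"
    using P[of 0] Q[of 1] assms l by auto
  then have "P * Q \<noteq> 0" by simp
  then have "finite {s. poly (P * Q) s = 0}" by (rule poly_roots_finite)
  then obtain s where "poly (P * Q) s \<noteq> 0"
    using infinite_UNIV_char_0[where 'a = complex] by (metis (mono_tags) UNIV_I mem_Collect_eq rev_finite_subset subsetI)
  then show ?thesis using P Q by auto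
qed

section \<open>Partial derivatives\<close>

lemma keys_minus_subset: "Poly_Mapping.keys (m - m') \<subseteq> Poly_Mapping.keys (m :: nat \<Rightarrow>\<^sub>0 nat)"
  by (rule subsetI) (simp add: in_keys_iff lookup_minus)

lemma polys_in_partial_deriv: "p \<in> polys_in T \<Longrightarrow> partial_deriv j p \<in> polys_in T"
  unfolding partial_deriv_def
proof (rule polys_in_sum)
  fix m assume p: "p \<in> polys_in T" and m: "m \<in> Poly_Mapping.keys p"
  have "Poly_Mapping.keys (m - Poly_Mapping.single j 1) \<subseteq> Poly_Mapping.keys m"
    by (rule keys_minus_subset)
  then show "Poly_Mapping.single (m - Poly_Mapping.single j 1)
       (of_nat (Poly_Mapping.lookup m j) * Poly_Mapping.lookup p m) \<in> polys_in T"
    using p m by (auto simp: polys_in_def split: if_splits)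
qed

definition vec_upd :: "'a vec \<Rightarrow> nat \<Rightarrow> 'a \<Rightarrow> 'a vec" where
  "vec_upd y j s = vec (dim_vec y) (\<lambda>i. if i = j then s else y $ i)"

lemma vec_upd_carrier [simp]: "vec_upd y j s \<in> carrier_vec n \<longleftrightarrow> y \<in> carrier_vec n"
  unfolding vec_upd_def by (metis carrier_vecD carrier_vecI dim_vec)

lemma dim_vec_upd [simp]: "dim_vec (vec_upd y j s) = dim_vec y"
  by (simp add: vec_upd_def)

lemma vec_upd_index: "i < dim_vec y \<Longrightarrow> vec_upd y j s $ i = (if i = j then s else y $ i)"
  by (simp add: vec_upd_def)

lemma vec_upd_same [simp]: "vec_upd y j (y $ j) = y"
proof (rule eq_vecI)
  fix i assume "i < dim_vec y"
  then show "vec_upd y j (y $ j) $ i = y $ i"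
    by (cases "i = j") (simp_all add: vec_upd_index)
qed (simp add: vec_upd_def)

lemma eval_monom_deriv:
  assumes y: "y \<in> carrier_vec n" and m: "Poly_Mapping.keys m \<subseteq> {..<n}" and j: "j < n"
  shows "((\<lambda>s. eval_monom (vec_upd y j s) m) has_field_derivative
     of_nat (Poly_Mapping.lookup m j) * eval_monom y (m - Poly_Mapping.single j 1)) (at (y $ j))"
proof -
  let ?c = "\<Prod>i \<in> {..<n} - {j}. y $ i ^ Poly_Mapping.lookup m i"
  have e: "eval_monom (vec_upd y j s) m = s ^ Poly_Mapping.lookup m j * ?c" for s
  proof -
    have "eval_monom (vec_upd y j s) m =
       (\<Prod>i \<in> {..<n}. (if i = j then s else y $ i) ^ Poly_Mapping.lookup m i)"
      by (subst eval_monom_superset[of "{..<n}"]) (use m y in \<open>auto simp: vec_upd_index intro!: prod.cong\<close>)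
    also have "\<dots> = s ^ Poly_Mapping.lookup m j *
       (\<Prod>i \<in> {..<n} - {j}. (if i = j then s else y $ i) ^ Poly_Mapping.lookup m i)"
      by (subst prod.remove[of _ j]) (use j in auto)
    also have "(\<Prod>i \<in> {..<n} - {j}. (if i = j then s else y $ i) ^ Poly_Mapping.lookup m i) = ?c"
      by (intro prod.cong) auto
    finally show ?thesis .
  qed
  have k: "Poly_Mapping.keys (m - Poly_Mapping.single j 1) \<subseteq> {..<n}"
    using m keys_minus_subset by blast
  have "eval_monom y (m - Poly_Mapping.single j 1) =
     (\<Prod>i \<in> {..<n}. y $ i ^ (Poly_Mapping.lookup m i - Poly_Mapping.lookup (Poly_Mapping.single j 1) i))"
    by (subst eval_monom_superset[of "{..<n}"]) (use k in \<open>auto simp: lookup_minus\<close>)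
  also have "\<dots> = y $ j ^ (Poly_Mapping.lookup m j - 1) *
     (\<Prod>i \<in> {..<n} - {j}. y $ i ^ (Poly_Mapping.lookup m i - Poly_Mapping.lookup (Poly_Mapping.single j 1) i))"
    by (subst prod.remove[of _ j]) (use j in auto)
  also have "(\<Prod>i \<in> {..<n} - {j}. y $ i ^ (Poly_Mapping.lookup m i - Poly_Mapping.lookup (Poly_Mapping.single j 1) i)) = ?c"
    by (intro prod.cong) (auto simp: lookup_single)
  finally have f: "eval_monom y (m - Poly_Mapping.single j 1) = y $ j ^ (Poly_Mapping.lookup m j - 1) * ?c" .
  show ?thesis
    unfolding e f by (auto intro!: derivative_eq_intros)
qed

text \<open>Identifies the formal derivative with the analytic one along a coordinate line. The
  product rule and all explicit gradients below then follow from uniqueness of derivatives.\<close>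

lemma partial_deriv_has_derivative:
  assumes "p \<in> polys n" "y \<in> carrier_vec n" "j < n"
  shows "((\<lambda>s. poly_eval p (vec_upd y j s)) has_field_derivative
     poly_eval (partial_deriv j p) y) (at (y $ j))"
proof -
  have e: "poly_eval p z = (\<Sum>m\<in>Poly_Mapping.keys p. Poly_Mapping.lookup p m * eval_monom z m)" for z
    by (simp add: poly_eval_def eval_monom_def)
  have f: "poly_eval (partial_deriv j p) y = (\<Sum>m\<in>Poly_Mapping.keys p. Poly_Mapping.lookup p m *
     (of_nat (Poly_Mapping.lookup m j) * eval_monom y (m - Poly_Mapping.single j 1)))"
    by (simp add: partial_deriv_def poly_eval_single algebra_simps)
  show ?thesis
    unfolding e f
    by (intro DERIV_sum DERIV_cmult eval_monom_deriv) (use assms in \<open>auto simp: polys_def\<close>)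
qed

lemma partial_deriv_eqI:
  assumes "p \<in> polys n" "y \<in> carrier_vec n" "j < n"
    and "((\<lambda>s. poly_eval p (vec_upd y j s)) has_field_derivative D) (at (y $ j))"
  shows "poly_eval (partial_deriv j p) y = D"
  using DERIV_unique[OF partial_deriv_has_derivative[OF assms(1-3)] assms(4)] .

definition grad :: "nat \<Rightarrow> cpoly \<Rightarrow> complex vec \<Rightarrow> complex vec" where
  "grad n p y = vec n (\<lambda>j. poly_eval (partial_deriv j p) y)"

lemma grad_carrier [simp]: "grad n p y \<in> carrier_vec n"
  by (simp add: grad_def)

lemma grad_add:
  assumes "p \<in> polys n" "q \<in> polys n" "y \<in> carrier_vec n"
  shows "grad n (p + q) y = grad n p y + grad n q y"
proof -
  have "p + q \<in> polys n" using assms polys_in_add by (simp add: polys_eq)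
  then show ?thesis
    by (intro eq_vecI) (auto simp: grad_def intro!: partial_deriv_eqI DERIV_add
        partial_deriv_has_derivative assms)
qed

lemma grad_mult:
  assumes "p \<in> polys n" "q \<in> polys n" "y \<in> carrier_vec n"
  shows "grad n (p * q) y = poly_eval q y \<cdot>\<^sub>v grad n p y + poly_eval p y \<cdot>\<^sub>v grad n q y"
proof -
  have pq: "p * q \<in> polys n" using assms polys_in_mult by (simp add: polys_eq)
  show ?thesis
  proof (intro eq_vecI)
    fix j assume "j < dim_vec (poly_eval q y \<cdot>\<^sub>v grad n p y + poly_eval p y \<cdot>\<^sub>v grad n q y)"
    then have j: "j < n" by (simp add: grad_def)
    have "poly_eval (partial_deriv j (p * q)) y =
       poly_eval (partial_deriv j p) y * poly_eval q y + poly_eval (partial_deriv j q) y * poly_eval p y"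
      using DERIV_mult[OF partial_deriv_has_derivative[OF assms(1,3) j]
            partial_deriv_has_derivative[OF assms(2,3) j]]
      by (intro partial_deriv_eqI[OF pq assms(3) j]) simp
    then show "grad n (p * q) y $ j = (poly_eval q y \<cdot>\<^sub>v grad n p y + poly_eval p y \<cdot>\<^sub>v grad n q y) $ j"
      using j by (simp add: grad_def)
  qed (simp add: grad_def)
qed

lemma grad_0 [simp]: "grad n 0 y = 0\<^sub>v n"
  by (intro eq_vecI) (auto simp: grad_def partial_deriv_def)

lemma partial_deriv_Var_not_in:
  assumes "p \<in> polys_in T" "j \<notin> T"
  shows "partial_deriv j p = 0"
proof -
  have "Poly_Mapping.lookup m j = 0" if "m \<in> Poly_Mapping.keys p" for m
    using assms that by (force simp: polys_in_def in_keys_iff)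
  then show ?thesis
    unfolding partial_deriv_def by (intro sum.neutral) simp
qed

text \<open>Views one further variable as the indeterminate of a univariate polynomial, which is the
  form required by pseudo-division.\<close>

lemma polys_in_insert_iff:
  "p \<in> polys_in (insert j T) \<longleftrightarrow> (\<exists>P. (\<forall>i. coeff P i \<in> polys_in T) \<and> p = poly P (Var j))"
proof
  assume "p \<in> polys_in (insert j T)"
  then show "\<exists>P. (\<forall>i. coeff P i \<in> polys_in T) \<and> p = poly P (Var j)"
  proof (induction rule: polys_in_induct)
    case (const c)
    then show ?case by (intro exI[of _ "[:Const c:]"]) (auto simp: coeff_pCons split: nat.splits)
  next
    case (var i)
    then show ?case
    proof (cases "i = j")
      case True
      then show ?thesis by (intro exI[of _ "[:0, 1:]"]) (auto simp: coeff_pCons split: nat.splits)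
    next
      case False
      then show ?thesis using var
        by (intro exI[of _ "[:Var i:]"]) (auto simp: coeff_pCons split: nat.splits)
    qed
  next
    case (add p q)
    then obtain P Q where "\<forall>i. coeff P i \<in> polys_in T" "p = poly P (Var j)"
      "\<forall>i. coeff Q i \<in> polys_in T" "q = poly Q (Var j)" by blast
    then show ?case by (intro exI[of _ "P + Q"]) (auto intro: polys_in_add)
  next
    case (mult p q)
    then obtain P Q where "\<forall>i. coeff P i \<in> polys_in T" "p = poly P (Var j)"
      "\<forall>i. coeff Q i \<in> polys_in T" "q = poly Q (Var j)" by blast
    then show ?case
      by (intro exI[of _ "P * Q"]) (auto simp: coeff_mult intro!: polys_in_sum polys_in_mult)
  qed
next
  assume "\<exists>P. (\<forall>i. coeff P i \<in> polys_in T) \<and> p = poly P (Var j)"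
  then show "p \<in> polys_in (insert j T)"
    using polys_in_mono[of T "insert j T"]
    by (auto simp: poly_altdef intro!: polys_in_sum polys_in_mult polys_in_power)
qed

lemma poly_eval_poly: "poly_eval (poly P q) y = poly (map_poly (\<lambda>c. poly_eval c y) P) (poly_eval q y)"
proof (induction P)
  case (pCons a P)
  then show ?case
    by (simp add: map_poly_pCons)
qed simp

lemma polys_in_emptyD:
  assumes "p \<in> polys_in {}"
  shows "p = Const (Poly_Mapping.lookup p 0)"
proof -
  have "Poly_Mapping.lookup p m = 0" if "m \<noteq> 0" for m
  proof (rule ccontr)
    assume "Poly_Mapping.lookup p m \<noteq> 0"
    then have "Poly_Mapping.keys m = {}"
      using assms by (simp add: polys_in_def in_keys_iff)
    then show False using that by simp
  qed
  then show ?thesis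
    by (intro poly_mapping_eqI) (simp add: Const_def lookup_single when_def)
qed

text \<open>Induction on the variables: choose a point where the leading coefficient in the last
  variable is nonzero, then avoid the finitely many roots of the specialised polynomial.\<close>

lemma nonzero_polynomial_nonzero_value:
  assumes "finite T" "p \<in> polys_in T" "p \<noteq> 0" "T \<subseteq> {..<n}"
  shows "\<exists>y \<in> carrier_vec n. poly_eval p y \<noteq> 0"
  using assms
proof (induction T arbitrary: p rule: finite_induct)
  case empty
  have "p = Const (Poly_Mapping.lookup p 0)" by (rule polys_in_emptyD[OF empty(1)])
  then have "poly_eval p (0\<^sub>v n) \<noteq> 0"
    using empty(2) poly_eval_Const[of "Poly_Mapping.lookup p 0" "0\<^sub>v n"] by (metis Const_0)
  then show ?case by (intro bexI[of _ "0\<^sub>v n"]) auto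
next
  case (insert j T)
  obtain P where P: "\<forall>i. coeff P i \<in> polys_in T" "p = poly P (Var j)"
    using insert.prems(1) polys_in_insert_iff by blast
  then have "P \<noteq> 0" using insert.prems by auto
  then have "lead_coeff P \<noteq> 0" by simp
  moreover have "lead_coeff P \<in> polys_in T" "T \<subseteq> {..<n}" using P insert.prems by auto
  ultimately obtain y where y: "y \<in> carrier_vec n" "poly_eval (lead_coeff P) y \<noteq> 0"
    using insert.IH[of "lead_coeff P"] by blast
  let ?Q = "map_poly (\<lambda>c. poly_eval c y) P"
  have "coeff ?Q (degree P) \<noteq> 0" using y by (simp add: coeff_map_poly)
  then have "?Q \<noteq> 0" by (metis coeff_0)
  then have "finite {s. poly ?Q s = 0}" by (rule poly_roots_finite)
  then obtain s where s: "poly ?Q s \<noteq> 0"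
    using infinite_UNIV_char_0[where 'a = complex] by (metis (mono_tags) UNIV_I mem_Collect_eq rev_finite_subset subsetI)
  let ?z = "vec_upd y j s"
  have j: "j < n" using insert by auto
  have "poly_eval (coeff P i) ?z = poly_eval (coeff P i) y" for i
  proof (rule poly_eval_cong)
    show "coeff P i \<in> polys_in T" using P by blast
    fix k assume "k \<in> T"
    then have "k < dim_vec y" "k \<noteq> j" using insert.hyps insert.prems y by auto
    then show "?z $ k = y $ k" by (simp add: vec_upd_index)
  qed
  then have "map_poly (\<lambda>c. poly_eval c ?z) P = ?Q"
    by (intro poly_eqI) (simp add: coeff_map_poly)
  then have "poly_eval p ?z = poly ?Q s"
    using y j by (simp add: P poly_eval_poly vec_upd_index)
  then show ?case using s y by (intro bexI[of _ ?z]) auto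
qed

section \<open>Subrings and adjunction of an element\<close>

text \<open>Subrings are sets in a single type, so that the successive rings of the tower of
  coordinates and the ideal of \<open>V\<close> can be compared directly.\<close>

definition subring_set :: "'a::comm_ring_1 set \<Rightarrow> bool" where
  "subring_set A \<longleftrightarrow> 1 \<in> A \<and> (\<forall>a\<in>A. \<forall>b\<in>A. a - b \<in> A \<and> a * b \<in> A)"

definition coeffs_in :: "'a::comm_ring_1 set \<Rightarrow> 'a poly \<Rightarrow> bool" where
  "coeffs_in A P \<longleftrightarrow> (\<forall>i. coeff P i \<in> A)"

definition adjoin :: "'a::comm_ring_1 set \<Rightarrow> 'a \<Rightarrow> 'a set" where
  "adjoin A x = {poly P x | P. coeffs_in A P}"

context
  fixes A :: "'a::comm_ring_1 set"
  assumes A: "subring_set A"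
begin

lemma subring_1: "1 \<in> A"
  and subring_diff: "a \<in> A \<Longrightarrow> b \<in> A \<Longrightarrow> a - b \<in> A"
  and subring_mult: "a \<in> A \<Longrightarrow> b \<in> A \<Longrightarrow> a * b \<in> A"
  using A by (auto simp: subring_set_def)

lemma subring_0: "0 \<in> A"
  using subring_diff[OF subring_1 subring_1] by simp

lemma subring_uminus: "a \<in> A \<Longrightarrow> - a \<in> A"
  using subring_diff[OF subring_0] by fastforce

lemma subring_add: "a \<in> A \<Longrightarrow> b \<in> A \<Longrightarrow> a + b \<in> A"
  using subring_diff[OF _ subring_uminus] by fastforce

lemma subring_sum: "(\<And>i. i \<in> K \<Longrightarrow> f i \<in> A) \<Longrightarrow> sum f K \<in> A"
  by (induction K rule: infinite_finite_induct) (auto intro: subring_0 subring_add)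

lemma subring_power: "a \<in> A \<Longrightarrow> a ^ k \<in> A"
  by (induction k) (auto intro: subring_1 subring_mult)

lemma coeffs_in_0: "coeffs_in A 0"
  and coeffs_in_add: "coeffs_in A P \<Longrightarrow> coeffs_in A Q \<Longrightarrow> coeffs_in A (P + Q)"
  and coeffs_in_diff: "coeffs_in A P \<Longrightarrow> coeffs_in A Q \<Longrightarrow> coeffs_in A (P - Q)"
  and coeffs_in_smult: "a \<in> A \<Longrightarrow> coeffs_in A P \<Longrightarrow> coeffs_in A (smult a P)"
  and coeffs_in_monom: "a \<in> A \<Longrightarrow> coeffs_in A (monom a k)"
  and coeffs_in_mult: "coeffs_in A P \<Longrightarrow> coeffs_in A Q \<Longrightarrow> coeffs_in A (P * Q)"
  and coeffs_in_const: "a \<in> A \<Longrightarrow> coeffs_in A [:a:]"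
  by (auto simp: coeffs_in_def coeff_mult coeff_pCons split: nat.splits
      intro!: subring_0 subring_add subring_diff subring_mult subring_sum)

lemma coeffs_in_sum: "(\<And>i. i \<in> K \<Longrightarrow> coeffs_in A (f i)) \<Longrightarrow> coeffs_in A (sum f K)"
  by (induction K rule: infinite_finite_induct) (auto intro: coeffs_in_0 coeffs_in_add)

lemma subset_adjoin: "A \<subseteq> adjoin A x"
proof
  fix a assume "a \<in> A"
  then show "a \<in> adjoin A x"
    unfolding adjoin_def by (intro CollectI exI[of _ "[:a:]"]) (simp add: coeffs_in_const)
qed

lemma mem_adjoin: "coeffs_in A P \<Longrightarrow> poly P x \<in> adjoin A x"
  by (auto simp: adjoin_def)

lemma subring_adjoin: "subring_set (adjoin A x)"
  unfolding subring_set_def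
proof (intro conjI ballI)
  show "1 \<in> adjoin A x" using subset_adjoin subring_1 by blast
  fix a b assume "a \<in> adjoin A x" "b \<in> adjoin A x"
  then obtain P Q where "coeffs_in A P" "coeffs_in A Q" "a = poly P x" "b = poly Q x"
    by (auto simp: adjoin_def)
  then show "a - b \<in> adjoin A x" "a * b \<in> adjoin A x"
    using mem_adjoin[OF coeffs_in_diff[of P Q]] mem_adjoin[OF coeffs_in_mult[of P Q]] by auto
qed

text \<open>Multiplying by the leading coefficient of \<open>s\<close> replaces division by it. The
  bound on the degree of the quotient is what later allows top coefficients to be compared.\<close>

lemma pseudo_division:
  assumes "coeffs_in A f" and s: "coeffs_in A s" "0 < degree s"
  shows "\<exists>N q t. coeffs_in A q \<and> coeffs_in A t \<and> smult (lead_coeff s ^ N) f = q * s + t \<and>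
    degree t < degree s \<and> degree q \<le> degree f - degree s"
  using assms(1)
proof (induction "degree f" arbitrary: f rule: less_induct)
  case less
  show ?case
  proof (cases "degree f < degree s")
    case True
    then show ?thesis
      using less.prems by (intro exI[of _ 0] exI[of _ 0] exI[of _ f]) (auto intro: coeffs_in_0)
  next
    case False
    let ?k = "degree f - degree s"
    let ?m = "monom (lead_coeff f) ?k"
    let ?f = "smult (lead_coeff s) f - ?m * s"
    have lc: "lead_coeff f \<in> A" "lead_coeff s \<in> A" using less.prems s by (auto simp: coeffs_in_def)
    have co: "coeffs_in A ?f"
      using less.prems s lc by (intro coeffs_in_diff coeffs_in_mult coeffs_in_smult coeffs_in_monom)
    have "degree ?f \<le> degree f"
    proof (rule degree_diff_le)
      show "degree (?m * s) \<le> degree f"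
        using degree_mult_le[of ?m s] degree_monom_le[of "lead_coeff f" ?k] False by linarith
    qed (rule degree_smult_le)
    moreover have "coeff ?f (degree f) = 0"
      using False by (simp add: coeff_monom_mult)
    \<comment> \<open>Losing the top coefficient lowers the degree only because
      \<open>degree f\<close> is positive, being at least \<open>degree s\<close>.\<close>
    ultimately have deg: "degree ?f < degree f"
      using s False by (metis leading_coeff_0_iff le_neq_implies_less degree_0 not_less_zero not_gr_zero)
    obtain N q t where h: "coeffs_in A q" "coeffs_in A t" "smult (lead_coeff s ^ N) ?f = q * s + t"
      "degree t < degree s" "degree q \<le> degree ?f - degree s"
      using less.hyps[OF deg co] by blast
    let ?q = "q + smult (lead_coeff s ^ N) ?m"
    have "smult (lead_coeff s ^ Suc N) f = smult (lead_coeff s ^ N) ?f + smult (lead_coeff s ^ N) (?m * s)"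
      by (simp add: smult_diff_right mult.commute)
    also have "\<dots> = ?q * s + t"
      unfolding h(3) by (simp add: algebra_simps)
    finally have "smult (lead_coeff s ^ Suc N) f = ?q * s + t" .
    moreover have "degree ?q \<le> ?k"
    proof (rule degree_add_le)
      show "degree q \<le> ?k" using h deg by linarith
      show "degree (smult (lead_coeff s ^ N) ?m) \<le> ?k"
        by (rule order.trans[OF degree_smult_le degree_monom_le])
    qed
    moreover have "coeffs_in A ?q"
      using h lc by (intro coeffs_in_add coeffs_in_smult coeffs_in_monom subring_power)
    ultimately show ?thesis using h by blast
  qed
qed

end

section \<open>Prime ideals and minimal relations\<close>

definition prime_ideal :: "'a::comm_ring_1 set \<Rightarrow> bool" where
  "prime_ideal I \<longleftrightarrow> 0 \<in> I \<and> 1 \<notin> I \<and> (\<forall>a\<in>I. \<forall>b\<in>I. a + b \<in> I) \<and> (\<forall>a\<in>I. \<forall>b. b * a \<in> I) \<and>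
     (\<forall>a b. a * b \<in> I \<longrightarrow> a \<in> I \<or> b \<in> I)"

context
  fixes I :: "'a::comm_ring_1 set"
  assumes I: "prime_ideal I"
begin

lemma prime_ideal_0: "0 \<in> I"
  and prime_ideal_1: "1 \<notin> I"
  and prime_ideal_add: "a \<in> I \<Longrightarrow> b \<in> I \<Longrightarrow> a + b \<in> I"
  and prime_ideal_mult: "a \<in> I \<Longrightarrow> b * a \<in> I"
  and prime_ideal_prime: "a * b \<in> I \<Longrightarrow> a \<in> I \<or> b \<in> I"
  using I by (auto simp: prime_ideal_def)

lemma prime_ideal_mult2: "a \<in> I \<Longrightarrow> a * b \<in> I"
  using prime_ideal_mult by (simp add: mult.commute)

lemma prime_ideal_uminus: "a \<in> I \<Longrightarrow> - a \<in> I"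
  using prime_ideal_mult[of a "- 1"] by simp

lemma prime_ideal_diff: "a \<in> I \<Longrightarrow> b \<in> I \<Longrightarrow> a - b \<in> I"
  using prime_ideal_add[OF _ prime_ideal_uminus] by fastforce

lemma prime_ideal_power: "a ^ k \<in> I \<Longrightarrow> a \<in> I"
  by (induction k) (use prime_ideal_1 prime_ideal_prime in auto)

lemma prime_ideal_prod: "finite K \<Longrightarrow> prod f K \<in> I \<Longrightarrow> \<exists>i\<in>K. f i \<in> I"
  by (induction K rule: finite_induct) (use prime_ideal_1 prime_ideal_prime in auto)

lemma prime_ideal_diff_iff: "a - b \<in> I \<Longrightarrow> a \<in> I \<longleftrightarrow> b \<in> I"
  using prime_ideal_add[of "a - b" b] prime_ideal_diff[of a "a - b"] by auto

end

text \<open>\<open>G\<close> plays the role of the minimal polynomial of the residue class of \<open>x\<close> modulo \<open>I\<close>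
  over the fraction field of the image of \<open>A\<close>.\<close>

locale minimal_relation =
  fixes A I :: "'a::idom set" and x :: 'a and G :: "'a poly"
  assumes A: "subring_set A" and I: "prime_ideal I"
    and G: "coeffs_in A G" "poly G x \<in> I" "lead_coeff G \<notin> I"
    and minimal: "\<And>P i. coeffs_in A P \<Longrightarrow> poly P x \<in> I \<Longrightarrow> degree P < degree G \<Longrightarrow> coeff P i \<in> I"

lemma drop_lead_coeff:
  fixes P :: "'a::comm_ring_1 poly"
  assumes "0 < degree P"
  shows "degree (P - monom (lead_coeff P) (degree P)) < degree P"
    and "i \<noteq> degree P \<Longrightarrow> coeff (P - monom (lead_coeff P) (degree P)) i = coeff P i"
    and "poly (P - monom (lead_coeff P) (degree P)) x = poly P x - lead_coeff P * x ^ degree P"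
proof -
  let ?Q = "P - monom (lead_coeff P) (degree P)"
  have "degree ?Q \<le> degree P" by (rule degree_diff_le) (auto intro: degree_monom_le)
  moreover have "coeff ?Q (degree P) = 0" by simp
  ultimately show "degree ?Q < degree P"
    using assms by (metis leading_coeff_0_iff le_neq_implies_less degree_0 less_irrefl)
qed (auto simp: poly_monom)

text \<open>Take a relation of least degree among those with some coefficient outside
  \<open>I\<close>. If its leading coefficient were in \<open>I\<close>, deleting the top term would
  leave a relation of smaller degree of the same kind.\<close>

lemma minimal_relation_exists:
  assumes A: "subring_set A" and I: "prime_ideal I"
    and P: "coeffs_in A P" "poly P x \<in> I" "coeff P i \<notin> I"
  shows "\<exists>G. minimal_relation A I x G"
proof -
  let ?M = "\<lambda>G. coeffs_in A G \<and> poly G x \<in> I \<and> (\<exists>i. coeff G i \<notin> I)"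
  obtain G where G: "?M G" and min: "\<And>H. ?M H \<Longrightarrow> degree G \<le> degree H"
    using ex_has_least_nat[of ?M P degree] P by blast
  have "lead_coeff G \<notin> I"
  proof
    assume lc: "lead_coeff G \<in> I"
    obtain i where i: "coeff G i \<notin> I" using G by blast
    have ne: "i \<noteq> degree G" using lc i by metis
    have "coeff G i \<noteq> 0" using i prime_ideal_0[OF I] by metis
    then have "i \<le> degree G" by (rule le_degree)
    then have pos: "0 < degree G" using ne by linarith
    let ?H = "G - monom (lead_coeff G) (degree G)"
    have "coeffs_in A ?H"
      using G by (intro coeffs_in_diff coeffs_in_monom A) (auto simp: coeffs_in_def)
    moreover have "poly ?H x \<in> I"
      unfolding drop_lead_coeff(3)[OF pos]
      using G lc by (intro prime_ideal_diff prime_ideal_mult2 I) auto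
    moreover have "coeff ?H i \<notin> I" using drop_lead_coeff(2)[OF pos ne] i by simp
    ultimately have "degree G \<le> degree ?H" using min by blast
    then show False using drop_lead_coeff(1)[OF pos] by simp
  qed
  then show ?thesis
    using G min by (intro exI[of _ G], unfold_locales) (use A I in \<open>auto simp: not_le[symmetric]\<close>)
qed

context minimal_relation
begin

lemma degree_pos: "0 < degree G"
proof (rule ccontr)
  assume "\<not> 0 < degree G"
  then obtain c where "G = [:c:]" using degree_eq_zeroE by auto
  then show False using G by simp
qed

text \<open>A multiple of \<open>b\<close> of minimal positive degree in \<open>x\<close> would yield a proper factor of \<open>G\<close>.\<close>

lemma multiple_in_base:
  assumes b: "b \<in> adjoin A x" "b \<notin> I"
  shows "\<exists>c \<in> adjoin A x. \<exists>a \<in> A - I. b * c - a \<in> I"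
proof -
  \<comment> \<open>Representatives of multiples of \<open>b\<close> modulo \<open>I\<close> that
    stay outside \<open>I\<close>; the aim is to find one of degree 0.\<close>
  let ?M = "\<lambda>s. coeffs_in A s \<and> poly s x \<notin> I \<and> (\<exists>c \<in> adjoin A x. b * c - poly s x \<in> I)"
  have Bring: "subring_set (adjoin A x)" by (rule subring_adjoin[OF A])
  obtain P where P: "coeffs_in A P" "b = poly P x" using b by (auto simp: adjoin_def)
  have "?M P"
    using P b subring_1[OF Bring] prime_ideal_0[OF I] by (intro conjI bexI[of _ 1]) auto
  then obtain s where s: "?M s" and min: "\<And>t. ?M t \<Longrightarrow> degree s \<le> degree t"
    using ex_has_least_nat[of ?M P degree] by blast
  obtain c where c: "c \<in> adjoin A x" "b * c - poly s x \<in> I" using s by blast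
  have sc: "coeffs_in A s" using s by blast
  have "degree s = 0"
  proof (rule ccontr)
    assume "degree s \<noteq> 0"
    then have pos: "0 < degree s" by simp
    have lcA: "lead_coeff s \<in> A" using s by (auto simp: coeffs_in_def)
    have lc: "lead_coeff s \<notin> I"
    proof
      assume lc: "lead_coeff s \<in> I"
      let ?t = "s - monom (lead_coeff s) (degree s)"
      have lx: "lead_coeff s * x ^ degree s \<in> I" using lc by (intro prime_ideal_mult2 I)
      have "coeffs_in A ?t"
        using sc lcA by (intro coeffs_in_diff coeffs_in_monom A)
      moreover have "poly ?t x \<notin> I"
        unfolding drop_lead_coeff(3)[OF pos]
        using s prime_ideal_add[OF I _ lx, of "poly s x - lead_coeff s * x ^ degree s"] by auto
      moreover have "b * c - poly ?t x \<in> I"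
        unfolding drop_lead_coeff(3)[OF pos] using prime_ideal_add[OF I c(2) lx]
        by (simp add: algebra_simps)
      ultimately have "degree s \<le> degree ?t" using min c(1) by blast
      then show False using drop_lead_coeff(1)[OF pos] by simp
    qed
    \<comment> \<open>Otherwise the pseudo-remainder of \<open>s\<close> by \<open>G\<close> would
      be a representative of smaller degree.\<close>
    have lt: "degree s < degree G"
    proof (rule ccontr)
      assume nlt: "\<not> degree s < degree G"
      obtain N q t where d: "coeffs_in A q" "coeffs_in A t"
        "smult (lead_coeff G ^ N) s = q * G + t" "degree t < degree G"
        using pseudo_division[OF A sc G(1) degree_pos] by blast
      let ?h = "lead_coeff G ^ N"
      have hA: "?h \<in> A" using G by (intro subring_power[OF A]) (auto simp: coeffs_in_def)
      have e: "?h * poly s x = poly q x * poly G x + poly t x"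
        using arg_cong[OF d(3), of "\<lambda>p. poly p x"] by simp
      have "?h * poly s x - poly t x \<in> I"
        using G(2) by (simp add: e prime_ideal_mult[OF I])
      moreover have "?h * poly s x \<notin> I"
        using prime_ideal_prime[OF I] prime_ideal_power[OF I] G(3) s by blast
      ultimately have tI: "poly t x \<notin> I" using prime_ideal_diff_iff[OF I] by blast
      have "b * (c * ?h) - poly t x = ?h * (b * c - poly s x) + poly q x * poly G x"
        using e by (simp add: algebra_simps)
      then have "b * (c * ?h) - poly t x \<in> I"
        using c G(2) by (simp add: prime_ideal_add[OF I] prime_ideal_mult[OF I])
      moreover have "c * ?h \<in> adjoin A x"
        using c hA subset_adjoin[OF A] by (intro subring_mult[OF Bring]) auto
      ultimately have "degree s \<le> degree t" using min d(2) tI by blast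
      then show False using d nlt by simp
    qed
    \<comment> \<open>Now \<open>G\<close> is divided by \<open>s\<close>. The remainder is again
      congruent to a multiple of \<open>b\<close>, so by minimality its value lies in
      \<open>I\<close>; hence so does the value of \<open>q\<close>. As
      \<open>degree q < degree G\<close>, the coefficients of \<open>q\<close> lie in
      \<open>I\<close>, and comparing coefficients at \<open>degree G\<close> puts a power of
      \<open>lead_coeff s\<close> times \<open>lead_coeff G\<close> into \<open>I\<close>.\<close>
    obtain N q t where d: "coeffs_in A q" "coeffs_in A t"
      "smult (lead_coeff s ^ N) G = q * s + t" "degree t < degree s" "degree q \<le> degree G - degree s"
      using pseudo_division[OF A G(1) sc pos] by blast
    let ?h = "lead_coeff s ^ N"
    have e: "?h * poly G x = poly q x * poly s x + poly t x"
      using arg_cong[OF d(3), of "\<lambda>p. poly p x"] by simp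
    have qA: "poly q x \<in> adjoin A x" using d mem_adjoin[OF A] by blast
    have "poly t x \<in> I"
    proof (rule ccontr)
      assume nt: "poly t x \<notin> I"
      have "b * (- (c * poly q x)) - poly t x = - (poly q x * (b * c - poly s x)) - ?h * poly G x"
        using e by (simp add: algebra_simps)
      then have "b * (- (c * poly q x)) - poly t x \<in> I"
        using c G(2) by (auto intro!: prime_ideal_diff[OF I] prime_ideal_uminus[OF I] prime_ideal_mult[OF I])
      moreover have "- (c * poly q x) \<in> adjoin A x"
        using c qA by (intro subring_uminus[OF Bring] subring_mult[OF Bring])
      ultimately have "degree s \<le> degree t" using min d(2) nt by blast
      then show False using d by simp
    qed
    then have "poly q x * poly s x \<in> I"
      using prime_ideal_diff[OF I prime_ideal_mult[OF I G(2), of ?h]] e by (metis add_diff_cancel_right')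
    then have "poly q x \<in> I" using prime_ideal_prime[OF I] s by blast
    moreover have "degree q < degree G" using d(5) pos degree_pos by linarith
    ultimately have qI: "coeff q (degree G - degree s) \<in> I" using minimal d(1) by blast
    have "coeff (q * s) (degree G) = coeff q (degree G - degree s) * lead_coeff s"
    proof (cases "degree q = degree G - degree s")
      case True
      then show ?thesis using coeff_mult_degree_sum[of q s] lt by simp
    next
      case False
      then have l: "degree q < degree G - degree s" using d(5) by simp
      then have "degree (q * s) < degree G" using degree_mult_le[of q s] by linarith
      then show ?thesis using l by (simp add: coeff_eq_0)
    qed
    moreover have "coeff t (degree G) = 0" using d(4) lt by (intro coeff_eq_0) simp
    ultimately have "?h * lead_coeff G = coeff q (degree G - degree s) * lead_coeff s"
      using arg_cong[OF d(3), of "\<lambda>p. coeff p (degree G)"] by simp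
    then have "?h * lead_coeff G \<in> I" using qI by (simp add: prime_ideal_mult2[OF I])
    then show False
      using prime_ideal_prime[OF I] prime_ideal_power[OF I] lc G(3) by blast
  qed
  then obtain a where a: "s = [:a:]" using degree_eq_zeroE by blast
  have "coeff s 0 \<in> A" using sc by (simp add: coeffs_in_def)
  then have "a \<in> A - I" using s a by auto
  then show ?thesis using c a by auto
qed

text \<open>The assumption says that the residue ring has characteristic zero. The derivative has
  smaller degree than \<open>G\<close>, so by minimality its value could lie in \<open>I\<close>
  only if the coefficient \<open>degree G * lead_coeff G\<close> did.\<close>

lemma separant_not_in:
  assumes "\<And>k::nat. 0 < k \<Longrightarrow> of_nat k \<notin> I"
  shows "poly (pderiv G) x \<notin> I"
proof
  assume h: "poly (pderiv G) x \<in> I"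
  have co: "coeffs_in A (pderiv G)"
  proof -
    have "of_nat k \<in> A" for k :: nat
      by (induction k) (auto intro: subring_0[OF A] subring_1[OF A] subring_add[OF A])
    then show ?thesis
      using G(1) by (auto simp: coeffs_in_def coeff_pderiv simp del: of_nat_Suc intro: subring_mult[OF A])
  qed
  have "degree (pderiv G) \<le> degree G - 1"
    by (rule degree_le) (auto simp: coeff_pderiv coeff_eq_0)
  then have "degree (pderiv G) < degree G" using degree_pos by linarith
  then have "coeff (pderiv G) (degree G - 1) \<in> I" using minimal co h by blast
  moreover have "coeff (pderiv G) (degree G - 1) = of_nat (degree G) * lead_coeff G"
    using degree_pos by (simp add: coeff_pderiv del: of_nat_Suc)
  ultimately show False
    using assms[OF degree_pos] G(3) prime_ideal_prime[OF I] by metis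
qed

text \<open>The pseudo-remainder is a relation of degree below \<open>G\<close>, so all its
  coefficients lie in \<open>I\<close>. Membership in \<open>I\<close> thereby descends to the
  smaller ring \<open>A\<close>, which drives both the lifting of points and the computation of
  gradients.\<close>

lemma reduce_modulo:
  assumes "b \<in> adjoin A x" "b \<in> I"
  shows "\<exists>N q P. q \<in> adjoin A x \<and> coeffs_in A P \<and> (\<forall>i. coeff P i \<in> I) \<and>
    lead_coeff G ^ N * b = q * poly G x + poly P x"
proof -
  obtain f where f: "coeffs_in A f" "b = poly f x" using assms by (auto simp: adjoin_def)
  obtain N q t where d: "coeffs_in A q" "coeffs_in A t" "smult (lead_coeff G ^ N) f = q * G + t"
    "degree t < degree G"
    using pseudo_division[OF A f(1) G(1) degree_pos] by blast
  have e: "lead_coeff G ^ N * b = poly q x * poly G x + poly t x"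
    using arg_cong[OF d(3), of "\<lambda>p. poly p x"] f by simp
  have "poly t x \<in> I"
    using prime_ideal_diff[OF I prime_ideal_mult[OF I assms(2), of "lead_coeff G ^ N"]
        prime_ideal_mult[OF I G(2), of "poly q x"]] e by simp
  then have "\<forall>i. coeff t i \<in> I" using minimal d by blast
  then show ?thesis using e d mem_adjoin[OF A] by blast
qed

end

section \<open>Hilbert's basis theorem\<close>

text \<open>The ascending chain condition for the ideals of \<open>A\<close> generated by initial
  segments of a sequence, i.e. the Noetherian property.\<close>

definition noeth :: "'a::comm_ring_1 set \<Rightarrow> bool" where
  "noeth A \<longleftrightarrow> (\<forall>f::nat \<Rightarrow> 'a. range f \<subseteq> A \<longrightarrow>
     (\<exists>n c. (\<forall>i. c i \<in> A) \<and> f n = (\<Sum>i<n. c i * f i)))"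

definition lincombs :: "'a::comm_ring_1 set \<Rightarrow> (nat \<Rightarrow> 'a) \<Rightarrow> nat \<Rightarrow> 'a set" where
  "lincombs A f n = {\<Sum>i<n. c i * f i | c. \<forall>i. c i \<in> A}"

context
  fixes A :: "'a::comm_ring_1 set"
  assumes A: "subring_set A"
begin

lemma lincombs_diff: "a \<in> lincombs A f n \<Longrightarrow> b \<in> lincombs A f n \<Longrightarrow> a - b \<in> lincombs A f n"
proof -
  assume "a \<in> lincombs A f n" "b \<in> lincombs A f n"
  then obtain c d where "a = (\<Sum>i<n. c i * f i)" "\<forall>i. c i \<in> A" "b = (\<Sum>i<n. d i * f i)" "\<forall>i. d i \<in> A"
    by (auto simp: lincombs_def)
  then show ?thesis
    unfolding lincombs_def
    by (intro CollectI exI[of _ "\<lambda>i. c i - d i"])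
       (auto simp: sum_subtractf algebra_simps intro: subring_diff[OF A])
qed

lemma lincombs_mult: "a \<in> lincombs A f n \<Longrightarrow> r \<in> A \<Longrightarrow> r * a \<in> lincombs A f n"
proof -
  assume "a \<in> lincombs A f n" and r: "r \<in> A"
  then obtain c where "a = (\<Sum>i<n. c i * f i)" "\<forall>i. c i \<in> A"
    by (auto simp: lincombs_def)
  then show ?thesis
    unfolding lincombs_def using r
    by (intro CollectI exI[of _ "\<lambda>i. r * c i"])
       (auto simp: sum_distrib_left mult.assoc intro: subring_mult[OF A])
qed

lemma lincombs_0: "0 \<in> lincombs A f n"
  unfolding lincombs_def by (intro CollectI exI[of _ "\<lambda>_. 0"]) (auto intro: subring_0[OF A])

lemma lincombs_add: "a \<in> lincombs A f n \<Longrightarrow> b \<in> lincombs A f n \<Longrightarrow> a + b \<in> lincombs A f n"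
  using lincombs_diff[of a f n "0 - b"] lincombs_diff[OF lincombs_0, of b f n] by simp

lemma lincombs_sum: "(\<And>i. i \<in> K \<Longrightarrow> g i \<in> lincombs A f n) \<Longrightarrow> sum g K \<in> lincombs A f n"
  by (induction K rule: infinite_finite_induct) (auto intro: lincombs_0 lincombs_add)

lemma lincombs_member:
  assumes "i < n" shows "f i \<in> lincombs A f n"
proof -
  have "(\<Sum>j<n. (if j = i then 1 else 0) * f j) = (\<Sum>j<n. if j = i then f i else 0)"
    by (intro sum.cong) auto
  also have "\<dots> = f i" using assms by simp
  finally show ?thesis
    unfolding lincombs_def
    by (intro CollectI exI[of _ "\<lambda>j. if j = i then 1 else 0"])
       (auto intro: subring_0[OF A] subring_1[OF A])
qed

lemma lincombs_mono:
  assumes "m \<le> n" shows "lincombs A f m \<subseteq> lincombs A f n"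
proof
  fix a assume "a \<in> lincombs A f m"
  then obtain c where c: "a = (\<Sum>i<m. c i * f i)" "\<forall>i. c i \<in> A" by (auto simp: lincombs_def)
  show "a \<in> lincombs A f n"
    unfolding c(1) using c(2) assms by (intro lincombs_sum lincombs_mult lincombs_member) auto
qed

lemma lincombs_trans:
  assumes "\<And>i. i < k \<Longrightarrow> g i \<in> lincombs A f n" "a \<in> lincombs A g k"
  shows "a \<in> lincombs A f n"
proof -
  obtain c where c: "a = (\<Sum>i<k. c i * g i)" "\<forall>i. c i \<in> A" using assms by (auto simp: lincombs_def)
  show ?thesis
    unfolding c(1) using c(2) assms by (intro lincombs_sum lincombs_mult) auto
qed

end

text \<open>Hilbert's argument: from an ideal \<open>J\<close> that is not finitely generated pick
  successively \<open>Q n\<close> of least degree outside the ideal of its predecessors. A relation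
  between the leading coefficients then allows the degree of some \<open>Q n\<close> to be
  lowered.\<close>

theorem noeth_adjoin:
  assumes A: "subring_set A" and no: "noeth A"
  shows "noeth (adjoin A x)"
proof (rule ccontr)
  assume "\<not> noeth (adjoin A x)"
  define B where "B = adjoin A x"
  have B: "subring_set B" unfolding B_def by (rule subring_adjoin[OF A])
  obtain f where f: "\<And>n. f n \<in> B" "\<And>n. f n \<notin> lincombs B f n"
    using \<open>\<not> noeth (adjoin A x)\<close> unfolding noeth_def lincombs_def B_def by blast
  define J where "J = (\<Union>n. lincombs B f n)"
  have Jdiff: "a - b \<in> J" if ab: "a \<in> J" "b \<in> J" for a b
  proof -
    obtain m n where "a \<in> lincombs B f m" "b \<in> lincombs B f n" using ab by (auto simp: J_def)
    then have "a \<in> lincombs B f (max m n)" "b \<in> lincombs B f (max m n)"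
      using lincombs_mono[OF B, of m "max m n" f] lincombs_mono[OF B, of n "max m n" f] by auto
    then have "a - b \<in> lincombs B f (max m n)" by (rule lincombs_diff[OF B])
    then show ?thesis by (auto simp: J_def)
  qed
  have Jmult: "r * a \<in> J" if "a \<in> J" "r \<in> B" for a r
    using that lincombs_mult[OF B] by (fastforce simp: J_def)
  have Jfin: "\<exists>n. \<forall>i<k. g i \<in> lincombs B f n" if "\<forall>i<k. g i \<in> J" for k :: nat and g
    using that
  proof (induction k)
    case (Suc k)
    then obtain n m where n: "\<forall>i<k. g i \<in> lincombs B f n" and m: "g k \<in> lincombs B f m"
      by (auto simp: J_def)
    have "\<forall>i<Suc k. g i \<in> lincombs B f (max m n)"
      using n m lincombs_mono[OF B, of m "max m n" f] lincombs_mono[OF B, of n "max m n" f]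
      by (auto simp: less_Suc_eq)
    then show ?case by blast
  qed simp
  have Jnot: "\<exists>a\<in>J. a \<notin> lincombs B g k" if gJ: "\<forall>i<k. g i \<in> J" for g k
  proof -
    obtain n where n: "\<forall>i<k. g i \<in> lincombs B f n" using Jfin[OF gJ] by blast
    have "f n \<notin> lincombs B g k" using lincombs_trans[OF B, of k g f n "f n"] n f by blast
    moreover have "f n \<in> J" using lincombs_member[OF B, of n "Suc n" f] by (auto simp: J_def)
    ultimately show ?thesis by blast
  qed
  \<comment> \<open>Degrees are those of representing polynomials, since an element of
    \<open>adjoin A x\<close> may have several representatives.\<close>
  let ?C = "\<lambda>g n Q. coeffs_in A Q \<and> poly Q x \<in> J \<and> poly Q x \<notin> lincombs B (\<lambda>i. poly (g i) x) n"
  let ?P = "\<lambda>g n Q. ?C g n Q \<and> (\<forall>Q'. ?C g n Q' \<longrightarrow> degree Q \<le> degree Q')"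
  have JB: "J \<subseteq> B"
  proof
    fix a assume "a \<in> J"
    then obtain n c where "a = (\<Sum>i<n. c i * f i)" "\<forall>i. c i \<in> B" by (auto simp: J_def lincombs_def)
    then show "a \<in> B" using f by (auto intro!: subring_sum[OF B] subring_mult[OF B])
  qed
  have "\<exists>Q. \<forall>n. ?P Q n (Q n)"
  proof (rule dependent_wellorder_choice)
    fix r :: "'a poly" and g g' :: "nat \<Rightarrow> 'a poly" and n :: nat
    assume "\<And>i. i < n \<Longrightarrow> g i = g' i"
    then have "lincombs B (\<lambda>i. poly (g i) x) n = lincombs B (\<lambda>i. poly (g' i) x) n"
      by (simp add: lincombs_def)
    then show "?P g n r = ?P g' n r" by simp
  next
    fix n :: nat and g assume "\<And>i. i < n \<Longrightarrow> ?P g i (g i)"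
    then have "\<forall>i<n. poly (g i) x \<in> J" by blast
    then obtain a where "a \<in> J" "a \<notin> lincombs B (\<lambda>i. poly (g i) x) n"
      using Jnot[of n "\<lambda>i. poly (g i) x"] by blast
    moreover obtain Q where "coeffs_in A Q" "a = poly Q x"
      using \<open>a \<in> J\<close> JB by (auto simp: B_def adjoin_def)
    ultimately have "?C g n Q" by simp
    then show "\<exists>Q. ?P g n Q" using ex_has_least_nat[of "?C g n" Q degree] by simp
  qed
  then obtain Q where "\<forall>n. ?P Q n (Q n)" ..
  then have Q: "coeffs_in A (Q n)" "poly (Q n) x \<in> J" "poly (Q n) x \<notin> lincombs B (\<lambda>i. poly (Q i) x) n"
    and min: "\<And>R. coeffs_in A R \<Longrightarrow> poly R x \<in> J \<Longrightarrow> poly R x \<notin> lincombs B (\<lambda>i. poly (Q i) x) n \<Longrightarrow>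
      degree (Q n) \<le> degree R" for n
    by simp_all
  have lcA: "lead_coeff (Q n) \<in> A" for n using Q(1) by (simp add: coeffs_in_def)
  then have "range (\<lambda>n. lead_coeff (Q n)) \<subseteq> A" by blast
  then have "\<exists>n c. (\<forall>i. c i \<in> A) \<and> lead_coeff (Q n) = (\<Sum>i<n. c i * lead_coeff (Q i))"
    using no unfolding noeth_def by meson
  then obtain n c where c: "\<And>i. c i \<in> A" and lc: "lead_coeff (Q n) = (\<Sum>i<n. c i * lead_coeff (Q i))"
    by metis
  have mono: "degree (Q i) \<le> degree (Q n)" if i: "i < n" for i
  proof -
    have "poly (Q n) x \<notin> lincombs B (\<lambda>i. poly (Q i) x) i"
      using Q(3)[of n] lincombs_mono[OF B, of i n "\<lambda>i. poly (Q i) x"] i by auto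
    then show ?thesis using min[OF Q(1,2)] by blast
  qed
  \<comment> \<open>Each \<open>Q i\<close> is shifted to the degree of \<open>Q n\<close>; by the
    relation \<open>lc\<close> the difference \<open>R\<close> loses its top coefficient while
    staying outside the ideal of the predecessors.\<close>
  define T where "T = (\<Sum>i<n. monom (c i) (degree (Q n) - degree (Q i)) * Q i)"
  define R where "R = Q n - T"
  have coT: "coeffs_in A (monom (c i) (degree (Q n) - degree (Q i)) * Q i)" for i
    by (intro coeffs_in_mult coeffs_in_monom A c Q(1))
  have coR: "coeffs_in A R"
    unfolding R_def T_def by (intro coeffs_in_diff coeffs_in_sum A coT Q(1))
  have Tl: "poly T x \<in> lincombs B (\<lambda>i. poly (Q i) x) n"
    unfolding T_def poly_sum poly_mult
    by (intro lincombs_sum[OF B] lincombs_mult[OF B] lincombs_member[OF B])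
       (auto simp: B_def intro!: mem_adjoin[OF A] coeffs_in_monom[OF A] c)
  have J0: "0 \<in> J" using lincombs_0[OF B] by (auto simp: J_def)
  have Jadd: "a + b \<in> J" if "a \<in> J" "b \<in> J" for a b
    using Jdiff[OF that(1) Jdiff[OF J0 that(2)]] by simp
  have Jsum: "sum g K \<in> J" if "\<And>i. i \<in> K \<Longrightarrow> g i \<in> J" for g and K :: "nat set"
    using that by (induction K rule: infinite_finite_induct) (auto intro: J0 Jadd)
  have TJ: "poly T x \<in> J"
    unfolding T_def poly_sum poly_mult
    by (intro Jsum Jmult Q(2)) (auto simp: B_def intro!: mem_adjoin[OF A] coeffs_in_monom[OF A] c)
  have RJ: "poly R x \<in> J" unfolding R_def using Q(2) TJ by (simp add: Jdiff)
  have Rl: "poly R x \<notin> lincombs B (\<lambda>i. poly (Q i) x) n"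
  proof
    assume "poly R x \<in> lincombs B (\<lambda>i. poly (Q i) x) n"
    from lincombs_add[OF B this Tl] show False using Q(3)[of n] by (simp add: R_def)
  qed
  have dT: "degree T \<le> degree (Q n)"
    unfolding T_def
  proof (rule degree_sum_le)
    fix i assume "i \<in> {..<n}"
    then show "degree (monom (c i) (degree (Q n) - degree (Q i)) * Q i) \<le> degree (Q n)"
      using mono[of i] degree_mult_le[of "monom (c i) (degree (Q n) - degree (Q i))" "Q i"]
        degree_monom_le[of "c i" "degree (Q n) - degree (Q i)"] by simp
  qed simp
  have "coeff T (degree (Q n)) = (\<Sum>i<n. c i * lead_coeff (Q i))"
    unfolding T_def coeff_sum
    by (intro sum.cong refl) (simp add: coeff_monom_mult mono not_less)
  then have cR: "coeff R (degree (Q n)) = 0" by (simp add: R_def lc)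
  have dR: "degree R \<le> degree (Q n)" unfolding R_def using dT by (intro degree_diff_le) auto
  have "degree (Q n) \<le> degree R" by (rule min[OF coR RJ Rl])
  then have "lead_coeff R = 0" using cR dR by simp
  then have "R = 0" by simp
  then show False using Rl lincombs_0[OF B] by simp
qed

section \<open>Rank, minors and left kernels\<close>

context vec_space
begin

lemma orthogonal_span:
  assumes "S \<subseteq> carrier_vec n" "v \<in> carrier_vec n" "\<And>s. s \<in> S \<Longrightarrow> v \<bullet> s = 0" "u \<in> span S"
  shows "v \<bullet> u = 0"
proof -
  obtain a T where T: "finite T" "T \<subseteq> S" "u = lincomb a T"
    using assms(4) by (auto simp: span_def)
  have Tc: "T \<subseteq> carrier_vec n" using T assms by auto
  have u: "dim_vec u = n" using T Tc lincomb_dim by blast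
  have "v \<bullet> u = (\<Sum>i\<in>{0..<n}. v $ i * (\<Sum>x\<in>T. a x * x $ i))"
    unfolding scalar_prod_def using lincomb_index[OF _ Tc] T u by simp
  also have "\<dots> = (\<Sum>x\<in>T. a x * (\<Sum>i\<in>{0..<n}. v $ i * x $ i))"
    unfolding sum_distrib_left by (subst sum.swap) (simp add: algebra_simps)
  also have "\<dots> = (\<Sum>x\<in>T. a x * (v \<bullet> x))"
    using Tc by (intro sum.cong) (auto simp: scalar_prod_def)
  also have "\<dots> = 0" using T assms by (intro sum.neutral) auto
  finally show ?thesis .
qed

lemma column_basis:
  assumes "A \<in> carrier_mat n nc"
  obtains S where "S \<subseteq> set (cols A)" "lin_indpt S" "card S = rank A" "set (cols A) \<subseteq> span S"
    "S \<subseteq> carrier_vec n" "finite S"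
proof -
  have c: "set (cols A) \<subseteq> carrier_vec n" using assms cols_dim by blast
  have "lin_indpt {}"
    using finite_lin_dep[of "{}"] by auto
  then obtain S where S: "maximal S (\<lambda>T. T \<subseteq> set (cols A) \<and> lin_indpt T)"
    using maximal_exists_superset[of "set (cols A)" "\<lambda>T. T \<subseteq> set (cols A) \<and> lin_indpt T" "{}"] by auto
  then have S1: "S \<subseteq> set (cols A)" "lin_indpt S" by (auto simp: maximal_def)
  have Sc: "S \<subseteq> carrier_vec n" using S1 c by blast
  have "u \<in> span S" if u: "u \<in> set (cols A)" for u
  proof (rule ccontr)
    assume nu: "u \<notin> span S"
    then have "u \<notin> S" using in_own_span[of S] Sc by auto
    then have "lin_indpt (S \<union> {u})"
      using lin_dep_iff_in_span[of S u] Sc S1 nu u c by auto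
    then have "S \<union> {u} = S" using S u S1 unfolding maximal_def by blast
    then show False using \<open>u \<notin> S\<close> by blast
  qed
  then have "set (cols A) \<subseteq> span S" by blast
  then show thesis
    using that[of S] S1 Sc rank_card_indpt[OF assms S] finite_subset[OF S1(1)] by auto
qed

lemma rank_le_card_span:
  assumes A: "A \<in> carrier_mat n nc" and U: "finite U" "U \<subseteq> carrier_vec n" "set (cols A) \<subseteq> span U"
  shows "rank A \<le> card U"
proof -
  obtain S where S: "S \<subseteq> set (cols A)" "lin_indpt S" "card S = rank A"
    "set (cols A) \<subseteq> span S" "S \<subseteq> carrier_vec n" "finite S"
    by (rule column_basis[OF A])
  have "S \<subseteq> span U" using S(1) U(3) by blast
  then have "\<exists>C :: 'a vec set. int (card C) \<le> int (card U) - int (card S)"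
    using replacement[OF S(6) U(1) _ S(2)] U(2) by auto
  then show ?thesis using S(3) by auto
qed

lemma rank_le_rank_span:
  assumes A: "A \<in> carrier_mat n nc" and B: "B \<in> carrier_mat n k" "set (cols B) \<subseteq> span (set (cols A))"
  shows "rank B \<le> rank A"
proof -
  obtain S where S: "S \<subseteq> set (cols A)" "lin_indpt S" "card S = rank A"
    "set (cols A) \<subseteq> span S" "S \<subseteq> carrier_vec n" "finite S"
    by (rule column_basis[OF A])
  have "span (set (cols A)) \<subseteq> span S"
    using S(4,5) by (intro span_is_subset span_is_submodule) auto
  then show ?thesis
    using rank_le_card_span[OF B(1) S(6,5)] B(2) S(3) by auto
qed

text \<open>The common form of both lower bounds for Jacobian ranks. If
  \<open>rank A + card C\<close> were below \<open>n\<close>, the vectors of a column basis together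
  with the unit vectors for \<open>C\<close> would leave a nonzero vector orthogonal to all of
  them.\<close>

lemma trivial_left_kernel_rank:
  assumes A: "A \<in> carrier_mat n nc" and C: "C \<subseteq> {..<n}"
    and triv: "\<And>v. v \<in> carrier_vec n \<Longrightarrow> (\<And>j. j < nc \<Longrightarrow> v \<bullet> col A j = 0) \<Longrightarrow>
      (\<And>i. i \<in> C \<Longrightarrow> v $ i = 0) \<Longrightarrow> v = 0\<^sub>v n"
  shows "n \<le> rank A + card C"
proof (rule ccontr)
  assume neg: "\<not> n \<le> rank A + card C"
  obtain S where S: "S \<subseteq> set (cols A)" "lin_indpt S" "card S = rank A"
    "set (cols A) \<subseteq> span S" "S \<subseteq> carrier_vec n" "finite S"
    by (rule column_basis[OF A])
  have fC: "finite C" using C finite_subset by blast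
  obtain xs where xs: "set xs = S" "distinct xs" using finite_distinct_list[OF S(6)] by blast
  obtain cs where cs: "set cs = C" "distinct cs" using finite_distinct_list[OF fC] by blast
  have lx: "length xs = rank A" "length cs = card C"
    using distinct_card[OF xs(2)] distinct_card[OF cs(2)] xs(1) cs(1) S(3) by simp_all
  define L where "L = xs @ map (unit_vec n) cs"
  have lL: "length L < n" using neg lx by (simp add: L_def)
  have Lc: "set L \<subseteq> carrier_vec n" using xs S by (auto simp: L_def)
  let ?c = "\<lambda>i. if i < length L then L ! i else 0\<^sub>v n"
  \<comment> \<open>Fewer than \<open>n\<close> rows are prescribed. The row of index
    \<open>length L\<close> is zero, which makes \<open>M\<close> singular, and a kernel vector of
    \<open>M\<close> is orthogonal to all of \<open>L\<close>.\<close>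
  define M where "M = mat\<^sub>r n n (\<lambda>i. if i = length L then 0\<^sub>v n else ?c i)"
  have Mc: "M \<in> carrier_mat n n" by (simp add: M_def)
  have "det M = 0"
    unfolding M_def
  proof (rule det_row_0[OF lL], rule Pi_I)
    show "?c i \<in> carrier_vec n" for i
      using Lc nth_mem[of i L] by auto
  qed
  then obtain v where v: "v \<in> carrier_vec n" "v \<noteq> 0\<^sub>v n" "M *\<^sub>v v = 0\<^sub>v n"
    using det_0_iff_vec_prod_zero_field[OF Mc] by blast
  have vl: "v \<bullet> u = 0" if u: "u \<in> set L" for u
  proof -
    obtain i where i: "i < length L" "u = L ! i" using u by (auto simp: in_set_conv_nth)
    have uc: "u \<in> carrier_vec n" using u Lc by auto
    have "row M i = u"
      unfolding M_def using i lL uc by (subst row_mat_of_row_fun) auto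
    then have "u \<bullet> v = (M *\<^sub>v v) $ i" using i lL Mc by simp
    also have "\<dots> = 0" using v i lL by simp
    finally show ?thesis using comm_scalar_prod[OF uc v(1)] by simp
  qed
  have "v = 0\<^sub>v n"
  proof (rule triv[OF v(1)])
    fix j assume "j < nc"
    then have "col A j \<in> set (cols A)" using A by (metis carrier_matD(2) cols_length cols_nth nth_mem)
    then have c: "col A j \<in> span S" using S(4) by blast
    show "v \<bullet> col A j = 0"
    proof (rule orthogonal_span[OF S(5) v(1) _ c])
      fix s assume "s \<in> S"
      then show "v \<bullet> s = 0" by (intro vl) (simp add: L_def xs)
    qed
  next
    fix i assume i: "i \<in> C"
    then have "v \<bullet> unit_vec n i = 0" by (intro vl) (auto simp: L_def cs)
    then show "v $ i = 0" using i C v(1) by (auto simp: scalar_prod_right_unit subset_iff)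
  qed
  then show False using v by blast
qed

text \<open>Index functions instead of index sets describe the minor, so rows and columns may come
  in any order. Injectivity of \<open>g\<close> on the columns is forced by the nonzero
  determinant.\<close>

lemma rank_ge_minor:
  assumes A: "A \<in> carrier_mat n nc" and f: "\<And>i. i < k \<Longrightarrow> f i < n" and g: "\<And>j. j < k \<Longrightarrow> g j < nc"
    and det: "det (mat k k (\<lambda>(i, j). A $$ (f i, g j))) \<noteq> 0"
  shows "k \<le> rank A"
proof -
  let ?M = "mat k k (\<lambda>(i, j). A $$ (f i, g j))"
  let ?B = "mat n k (\<lambda>(i, j). A $$ (i, g j))"
  have M: "?M \<in> carrier_mat k k" and B: "?B \<in> carrier_mat n k" by auto
  have colB: "col ?B j = col A (g j)" if "j < k" for j
    using that A g by (intro eq_vecI) auto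
  have sub: "set (cols ?B) \<subseteq> set (cols A)"
    using colB g A by (auto simp: cols_def)
  have dist: "distinct (cols ?B)"
  proof -
    have "col ?B i \<noteq> col ?B j" if ij: "i < k" "j < k" "i \<noteq> j" for i j
    proof
      assume e: "col ?B i = col ?B j"
      have e': "A $$ (l, g i) = A $$ (l, g j)" if l: "l < n" for l
        using arg_cong[OF e, of "\<lambda>v. v $ l"] ij l by simp
      have "col ?M i = col ?M j"
        using e' f ij by (intro eq_vecI) auto
      then show False using det_identical_cols[OF M ij(3,1,2)] det by blast
    qed
    then show ?thesis by (auto simp: distinct_conv_nth)
  qed
  have "lin_indpt (set (cols ?B))"
  proof
    assume "lin_dep (set (cols ?B))"
    then obtain v where v: "v \<in> carrier_vec k" "v \<noteq> 0\<^sub>v k" "?B *\<^sub>v v = 0\<^sub>v n"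
      using lin_depE[OF B _ dist] by blast
    have "?M *\<^sub>v v = 0\<^sub>v k"
    proof (rule eq_vecI)
      fix i assume i: "i < dim_vec (0\<^sub>v k)"
      have "row ?M i = row ?B (f i)" using i f by (intro eq_vecI) auto
      then have "(?M *\<^sub>v v) $ i = (?B *\<^sub>v v) $ f i" using i f by simp
      then show "(?M *\<^sub>v v) $ i = 0\<^sub>v k $ i" using v i f by simp
    qed simp
    then show False using det_0_iff_vec_prod_zero_field[OF M] v det by blast
  qed
  then have "rank ?B = k" using lin_indpt_full_rank[OF B dist] by blast
  moreover have "rank ?B \<le> rank A"
    using sub in_own_span[of "set (cols A)"] cols_dim[of A] A
    by (intro rank_le_rank_span[OF A B]) auto
  ultimately show ?thesis by simp
qed

lemma independent_columns:
  assumes A: "A \<in> carrier_mat n nc" and k: "k \<le> rank A"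
  obtains g where "inj_on g {..<k}" "\<And>j. j < k \<Longrightarrow> g j < nc"
    "\<And>v. v \<in> carrier_vec k \<Longrightarrow> mat n k (\<lambda>(i, j). A $$ (i, g j)) *\<^sub>v v = 0\<^sub>v n \<Longrightarrow> v = 0\<^sub>v k"
proof -
  obtain S where S: "S \<subseteq> set (cols A)" "lin_indpt S" "card S = rank A"
    "set (cols A) \<subseteq> span S" "S \<subseteq> carrier_vec n" "finite S"
    by (rule column_basis[OF A])
  have "k \<le> card S" using k S(3) by simp
  then obtain T where T: "T \<subseteq> S" "card T = k" "finite T"
    by (rule obtain_subset_with_card_n)
  have indT: "lin_indpt T" by (rule subset_li_is_li[OF S(2) T(1)])
  obtain xs where xs: "set xs = T" "distinct xs" using finite_distinct_list[OF T(3)] by blast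
  have lx: "length xs = k" using distinct_card[OF xs(2)] xs(1) T(2) by simp
  have "\<forall>j<k. \<exists>i<nc. col A i = xs ! j"
  proof (intro allI impI)
    fix j assume "j < k"
    then have "xs ! j \<in> T" using xs(1) lx nth_mem by metis
    then have "xs ! j \<in> set (cols A)" using T(1) S(1) by blast
    then show "\<exists>i<nc. col A i = xs ! j" using A by (auto simp: cols_def)
  qed
  then obtain g where g: "\<And>j. j < k \<Longrightarrow> g j < nc \<and> col A (g j) = xs ! j" by metis
  let ?B = "mat n k (\<lambda>(i, j). A $$ (i, g j))"
  have B: "?B \<in> carrier_mat n k" by simp
  have colB: "col ?B j = xs ! j" if j: "j < k" for j
  proof -
    have gj: "g j < nc" "col A (g j) = xs ! j" using g[OF j] by auto
    have "col ?B j = col A (g j)" using j A gj(1) by (intro eq_vecI) auto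
    then show ?thesis using gj(2) by simp
  qed
  have cB: "cols ?B = xs" using colB lx by (intro nth_equalityI) auto
  show thesis
  proof
    show "inj_on g {..<k}"
    proof (rule inj_onI)
      fix i j assume ij: "i \<in> {..<k}" "j \<in> {..<k}" "g i = g j"
      then have "xs ! i = xs ! j" using g by (metis lessThan_iff)
      then show "i = j" using ij xs lx by (simp add: nth_eq_iff_index_eq)
    qed
    show "g j < nc" if "j < k" for j using g that by blast
    fix v assume v: "v \<in> carrier_vec k" "?B *\<^sub>v v = 0\<^sub>v n"
    show "v = 0\<^sub>v k"
      using lin_depI[OF B v(1) _ v(2)] cB xs indT by auto
  qed
qed

end

section \<open>Minors given by index functions and by index sets\<close>

lemma bij_betw_pick:
  assumes "finite J"
  shows "bij_betw (pick J) {..<card J} J"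
proof -
  have "pick J ` {..<card J} \<subseteq> J" using pick_in_set_le by auto
  moreover have "inj_on (pick J) {..<card J}"
  proof (rule linorder_inj_onI)
    fix i j assume "i < j" "i \<in> {..<card J}" "j \<in> {..<card J}"
    then show "pick J i \<noteq> pick J j" using pick_mono_le[of j J i] by auto
  qed auto
  ultimately show ?thesis
    using assms by (simp add: bij_betw_def card_image card_subset_eq)
qed

text \<open>Select \<open>k\<close> independent columns, then select columns of the transpose of the
  resulting matrix: its left kernel is trivial precisely because the first selection is
  independent.\<close>

lemma nonzero_minor_of_rank:
  fixes A :: "'a::field mat"
  assumes A: "A \<in> carrier_mat n nc" and k: "k \<le> vec_space.rank n A"
  obtains f g where "inj_on f {..<k}" "inj_on g {..<k}"
    "\<And>i. i < k \<Longrightarrow> f i < n" "\<And>j. j < k \<Longrightarrow> g j < nc"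
    "det (mat k k (\<lambda>(i, j). A $$ (f i, g j))) \<noteq> 0"
proof -
  obtain g where g: "inj_on g {..<k}" "\<And>j. j < k \<Longrightarrow> g j < nc"
    and tr: "\<And>v. v \<in> carrier_vec k \<Longrightarrow> mat n k (\<lambda>(i, j). A $$ (i, g j)) *\<^sub>v v = 0\<^sub>v n \<Longrightarrow> v = 0\<^sub>v k"
    using vec_space.independent_columns[OF A k] by metis
  let ?T = "mat k n (\<lambda>(j, i). A $$ (i, g j))"
  have T: "?T \<in> carrier_mat k n" by simp
  have "k \<le> vec_space.rank k ?T + card ({} :: nat set)"
  proof (rule vec_space.trivial_left_kernel_rank[OF T])
    fix v :: "'a vec"
    assume v: "v \<in> carrier_vec k" and o: "\<And>j. j < n \<Longrightarrow> v \<bullet> col ?T j = 0"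
    show "v = 0\<^sub>v k"
    proof (rule tr[OF v], rule eq_vecI)
      fix i assume "i < dim_vec (0\<^sub>v n)"
      then have i: "i < n" by simp
      have "row (mat n k (\<lambda>(i, j). A $$ (i, g j))) i = col ?T i"
        using i by (intro eq_vecI) auto
      then show "(mat n k (\<lambda>(i, j). A $$ (i, g j)) *\<^sub>v v) $ i = 0\<^sub>v n $ i"
        using i o[OF i] v comm_scalar_prod[OF v, of "col ?T i"] by simp
    qed simp
  qed simp
  then have "k \<le> vec_space.rank k ?T" by simp
  from vec_space.independent_columns[OF T this] obtain f where f: "inj_on f {..<k}"
    "\<And>j. j < k \<Longrightarrow> f j < n"
    and tr2: "\<And>v. v \<in> carrier_vec k \<Longrightarrow> mat k k (\<lambda>(i, j). ?T $$ (i, f j)) *\<^sub>v v = 0\<^sub>v k \<Longrightarrow> v = 0\<^sub>v k"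
    by metis
  let ?S = "mat k k (\<lambda>(i, j). ?T $$ (i, f j))"
  have S: "?S \<in> carrier_mat k k" by simp
  have "det ?S \<noteq> 0" using det_0_iff_vec_prod_zero_field[OF S] tr2 by blast
  moreover have "transpose_mat ?S = mat k k (\<lambda>(i, j). A $$ (f i, g j))"
    using f by (intro eq_matI) auto
  ultimately have "det (mat k k (\<lambda>(i, j). A $$ (f i, g j))) \<noteq> 0"
    using det_transpose[OF S] by simp
  then show thesis using that f g by blast
qed

text \<open>A kernel vector of the reindexed matrix is carried by the inverse of \<open>q\<close> to
  one of the original matrix, so no signs of permutations have to be tracked.\<close>

lemma det_reindex_nonzero:
  fixes A :: "'a::field mat"
  assumes det: "det (mat k k (\<lambda>(i, j). A $$ (f i, g j))) \<noteq> 0"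
    and p: "bij_betw p {..<k} {..<k}" and q: "bij_betw q {..<k} {..<k}"
  shows "det (mat k k (\<lambda>(i, j). A $$ (f (p i), g (q j)))) \<noteq> 0"
proof
  let ?M = "mat k k (\<lambda>(i, j). A $$ (f i, g j))"
  let ?N = "mat k k (\<lambda>(i, j). A $$ (f (p i), g (q j)))"
  have M: "?M \<in> carrier_mat k k" and N: "?N \<in> carrier_mat k k" by auto
  have p1: "p i < k" "q i < k" if "i < k" for i
    using that p q by (auto simp: bij_betw_def)
  assume "det ?N = 0"
  then obtain v where v: "v \<in> carrier_vec k" "v \<noteq> 0\<^sub>v k" "?N *\<^sub>v v = 0\<^sub>v k"
    using det_0_iff_vec_prod_zero_field[OF N] by blast
  define q' where "q' = inv_into {..<k} q"
  define w where "w = vec k (\<lambda>j. v $ q' j)"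
  have q': "bij_betw q' {..<k} {..<k}" unfolding q'_def by (rule bij_betw_inv_into[OF q])
  have qq: "q' (q j) = j" if "j < k" for j
    using that q by (simp add: q'_def bij_betw_def)
  have "?M *\<^sub>v w = 0\<^sub>v k"
  proof (rule eq_vecI)
    fix i assume "i < dim_vec (0\<^sub>v k)"
    then obtain i' where i: "i = p i'" "i' < k" using p by (auto simp: bij_betw_def)
    have "(?M *\<^sub>v w) $ i = (\<Sum>j\<in>{..<k}. A $$ (f (p i'), g j) * v $ q' j)"
      using i p1 by (simp add: scalar_prod_def w_def lessThan_atLeast0)
    also have "\<dots> = (\<Sum>j\<in>{..<k}. A $$ (f (p i'), g (q j)) * v $ j)"
      by (subst sum.reindex_bij_betw[OF q, symmetric]) (simp add: qq)
    also have "\<dots> = (?N *\<^sub>v v) $ i'"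
      using i v(1) by (simp add: scalar_prod_def lessThan_atLeast0)
    finally show "(?M *\<^sub>v w) $ i = 0\<^sub>v k $ i" using v i p1 by simp
  qed simp
  moreover have "w \<noteq> 0\<^sub>v k"
  proof
    assume w: "w = 0\<^sub>v k"
    have "v $ j = 0" if j: "j < k" for j
      using arg_cong[OF w, of "\<lambda>u. u $ q j"] j p1 qq by (simp add: w_def)
    then show False using v by (metis carrier_vecD eq_vecI index_zero_vec)
  qed
  moreover have "w \<in> carrier_vec k" by (simp add: w_def)
  ultimately show False using det_0_iff_vec_prod_zero_field[OF M] det by blast
qed

lemma minors_vanish_iff_rank:
  assumes A: "A \<in> carrier_mat n nc"
  shows "minors_vanish k A \<longleftrightarrow> vec_space.rank n A < k"
proof
  assume "vec_space.rank n A < k"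
  then show "minors_vanish k A"
    using vec_space.rank_gt_minor[OF A] A unfolding minors_vanish_def
    by (metis (no_types, lifting) Collect_mem_eq Collect_cong carrier_matD(2) lessThan_iff not_le subsetD)
next
  assume mv: "minors_vanish k A"
  show "vec_space.rank n A < k"
  proof (rule ccontr)
    assume "\<not> vec_space.rank n A < k"
    then have "k \<le> vec_space.rank n A" by simp
    then obtain f g where fg: "inj_on f {..<k}" "inj_on g {..<k}"
      "\<And>i. i < k \<Longrightarrow> f i < n" "\<And>j. j < k \<Longrightarrow> g j < nc"
      "det (mat k k (\<lambda>(i, j). A $$ (f i, g j))) \<noteq> 0"
      using nonzero_minor_of_rank[OF A] by metis
    let ?I = "f ` {..<k}" and ?J = "g ` {..<k}"
    have card: "card ?I = k" "card ?J = k" using fg by (simp_all add: card_image)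
    \<comment> \<open>\<open>p\<close> and \<open>q\<close> rearrange the indices so that
      \<open>f\<close> and \<open>g\<close> list their ranges in increasing order, as
      \<open>pick\<close> does.\<close>
    define p where "p = (\<lambda>i. inv_into {..<k} f (pick ?I i))"
    define q where "q = (\<lambda>j. inv_into {..<k} g (pick ?J j))"
    have bf: "bij_betw f {..<k} ?I" "bij_betw g {..<k} ?J" using fg by (auto simp: bij_betw_def)
    have pi: "bij_betw (pick ?I) {..<k} ?I" "bij_betw (pick ?J) {..<k} ?J"
      using bij_betw_pick[of ?I] bij_betw_pick[of ?J] card by auto
    have bp: "bij_betw p {..<k} {..<k}" "bij_betw q {..<k} {..<k}"
      using bij_betw_trans[OF pi(1) bij_betw_inv_into[OF bf(1)]]
        bij_betw_trans[OF pi(2) bij_betw_inv_into[OF bf(2)]]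
      by (simp_all add: p_def q_def o_def)
    have fp: "f (p i) = pick ?I i" "g (q i) = pick ?J i" if i: "i < k" for i
    proof -
      have "pick ?I i \<in> ?I" "pick ?J i \<in> ?J"
        using pi i unfolding bij_betw_def by blast+
      then show "f (p i) = pick ?I i" "g (q i) = pick ?J i"
        unfolding p_def q_def by (metis f_inv_into_f)+
    qed
    have "{i. i < dim_row A \<and> i \<in> ?I} = ?I" "{j. j < dim_col A \<and> j \<in> ?J} = ?J"
      using fg A by auto
    then have "submatrix A ?I ?J = mat k k (\<lambda>(i, j). A $$ (f (p i), g (q j)))"
      by (intro eq_matI) (auto simp: submatrix_def card fp)
    then have "det (submatrix A ?I ?J) \<noteq> 0"
      using det_reindex_nonzero[OF fg(5) bp] by simp
    moreover have "?I \<subseteq> {..<dim_row A}" "?J \<subseteq> {..<dim_col A}" using fg A by auto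
    ultimately show False using mv card unfolding minors_vanish_def by blast
  qed
qed

lemma rank_append_column:
  fixes A :: "'a::field mat"
  assumes A: "A \<in> carrier_mat n nc" and v: "v \<in> carrier_vec n"
  defines "B \<equiv> mat_of_cols n (cols A @ [v])"
  shows "B \<in> carrier_mat n (nc + 1)"
    and "v \<in> vec_space.col_space n A \<Longrightarrow> vec_space.rank n B \<le> vec_space.rank n A"
    and "v \<notin> vec_space.col_space n A \<Longrightarrow> vec_space.rank n A + 1 \<le> vec_space.rank n B"
    and "vec_space.rank n B \<le> vec_space.rank n A + 1"
proof -
  interpret vec_space "TYPE('a)" n .
  show B: "B \<in> carrier_mat n (nc + 1)" using A by (auto simp: B_def intro!: carrier_matI)
  have cA: "set (cols A) \<subseteq> carrier_vec n" using A cols_dim by blast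
  have cB: "set (cols B) = insert v (set (cols A))"
    unfolding B_def using cA v by (subst cols_mat_of_cols) auto
  have own: "set (cols A) \<subseteq> span (set (cols A))" using in_own_span cA by auto
  show "rank B \<le> rank A" if "v \<in> col_space A"
    using that own by (intro rank_le_rank_span[OF A B]) (auto simp: cB col_space_def)
  obtain S where S: "S \<subseteq> set (cols A)" "lin_indpt S" "card S = rank A"
    "set (cols A) \<subseteq> span S" "S \<subseteq> carrier_vec n" "finite S"
    by (rule column_basis[OF A])
  show "rank A + 1 \<le> rank B" if nv: "v \<notin> col_space A"
  proof -
    have "span S \<subseteq> col_space A"
      unfolding col_space_def using S(1) by (rule span_is_monotone)
    then have "v \<notin> span S" using nv by blast
    moreover have "v \<notin> S" using \<open>v \<notin> span S\<close> in_own_span[of S] S by auto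
    ultimately have "lin_indpt (S \<union> {v})"
      using lin_dep_iff_in_span[of S v] S v by auto
    then have "card (S \<union> {v}) \<le> rank B"
      using S by (intro rank_ge_card_indpt[OF B]) (auto simp: cB)
    then show ?thesis using \<open>v \<notin> S\<close> S by simp
  qed
  have "rank B \<le> card (insert v S)"
  proof (rule rank_le_card_span[OF B])
    have "span S \<subseteq> span (insert v S)" by (rule span_is_monotone) auto
    moreover have "insert v S \<subseteq> span (insert v S)" using in_own_span[of "insert v S"] S v by auto
    ultimately show "set (cols B) \<subseteq> span (insert v S)" using S by (auto simp: cB)
  qed (use S v in auto)
  also have "\<dots> \<le> rank A + 1" using S card_insert_le_m1[of "card S + 1" S v]
    by (simp add: card_insert_if)
  finally show "rank B \<le> rank A + 1" .
qed

section \<open>Finite generation of polynomial ideals\<close>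

lemma subring_polys_in: "subring_set (polys_in T)"
  by (simp add: subring_set_def polys_in_diff polys_in_mult)

lemma adjoin_polys_in: "adjoin (polys_in T) (Var j) = polys_in (insert j T)"
  unfolding adjoin_def coeffs_in_def using polys_in_insert_iff[of _ j T] by blast

lemma noeth_polys_in: "finite T \<Longrightarrow> noeth (polys_in T)"
proof (induction T rule: finite_induct)
  case empty
  show ?case
    unfolding noeth_def
  proof (intro allI impI)
    fix f :: "nat \<Rightarrow> cpoly" assume f: "range f \<subseteq> polys_in {}"
    then have "f 0 \<in> polys_in {}" "f (Suc 0) \<in> polys_in {}" by auto
    then obtain a b where e: "f 0 = Const a" "f (Suc 0) = Const b"
      using polys_in_emptyD by metis
    show "\<exists>n c. (\<forall>i. c i \<in> polys_in {}) \<and> f n = (\<Sum>i<n. c i * f i)"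
    proof (cases "a = 0")
      case True
      then show ?thesis using e by (intro exI[of _ 0] exI[of _ "\<lambda>_. 0"]) auto
    next
      case False
      then show ?thesis
        using e by (intro exI[of _ "Suc 0"] exI[of _ "\<lambda>_. Const (b / a)"])
          (simp add: Const_mult[symmetric])
    qed
  qed
next
  case (insert j T)
  then show ?case
    using noeth_adjoin[OF subring_polys_in insert.IH, of "Var j"] by (simp add: adjoin_polys_in)
qed

lemma noeth_polys: "noeth (polys n)"
  by (simp add: polys_eq noeth_polys_in)

text \<open>Otherwise elements of \<open>P\<close> outside the span of their predecessors could be
  chosen forever. \<open>P\<close> may be any subset, not just an ideal.\<close>

lemma noeth_finite_generation:
  assumes no: "noeth A" and P: "P \<subseteq> A"
  shows "\<exists>g k. (\<forall>i<k. g i \<in> P) \<and> P \<subseteq> lincombs A g k"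
proof (rule ccontr)
  assume neg: "\<nexists>g k. (\<forall>i<k. g i \<in> P) \<and> P \<subseteq> lincombs A g k"
  have "\<exists>g. \<forall>n. g n \<in> P \<and> g n \<notin> lincombs A g n"
  proof (rule dependent_wellorder_choice)
    fix r and g g' :: "nat \<Rightarrow> 'a" and n :: nat
    assume "\<And>i. i < n \<Longrightarrow> g i = g' i"
    then have "lincombs A g n = lincombs A g' n" by (simp add: lincombs_def)
    then show "(r \<in> P \<and> r \<notin> lincombs A g n) = (r \<in> P \<and> r \<notin> lincombs A g' n)" by simp
  next
    fix n :: nat and g assume "\<And>i. i < n \<Longrightarrow> g i \<in> P \<and> g i \<notin> lincombs A g i"
    then show "\<exists>r. r \<in> P \<and> r \<notin> lincombs A g n" using neg by blast
  qed
  then obtain g where g: "\<And>n. g n \<in> P" "\<And>n. g n \<notin> lincombs A g n" by blast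
  have "range g \<subseteq> A" using g(1) P by blast
  then have "\<exists>n c. (\<forall>i. c i \<in> A) \<and> g n = (\<Sum>i<n. c i * g i)" using no unfolding noeth_def by blast
  then show False using g(2) unfolding lincombs_def by blast
qed

section \<open>Varieties and their ideals\<close>

definition vanish :: "complex vec set \<Rightarrow> cpoly set" where
  "vanish V = {p. \<forall>y \<in> V. poly_eval p y = 0}"

lemma vanish_mono: "W \<subseteq> V \<Longrightarrow> vanish V \<subseteq> vanish W"
  by (auto simp: vanish_def)

lemma vanishing_ideal_eq: "vanishing_ideal n V = polys n \<inter> vanish V"
  by (auto simp: vanishing_ideal_def vanish_def)

lemma vanish_lincombs:
  assumes "\<And>i. i < k \<Longrightarrow> g i \<in> vanish V" "p \<in> lincombs A g k"
  shows "p \<in> vanish V"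
  using assms by (auto simp: vanish_def lincombs_def)

text \<open>By Hilbert's basis theorem infinite systems of equations are admissible, in particular a
  whole vanishing ideal.\<close>

lemma variety_zero_set:
  assumes "P \<subseteq> polys n"
  shows "variety n (zero_set n P)"
proof -
  obtain g k where g: "\<forall>i<k. g i \<in> P" "P \<subseteq> lincombs (polys n) g k"
    using noeth_finite_generation[OF noeth_polys assms] by blast
  have "zero_set n (g ` {..<k}) \<subseteq> zero_set n P"
  proof
    fix y assume y: "y \<in> zero_set n (g ` {..<k})"
    then have "g i \<in> vanish {y}" if "i < k" for i using that by (auto simp: zero_set_def vanish_def)
    then have "P \<subseteq> vanish {y}" using vanish_lincombs[of k g "{y}"] g(2) by blast
    then show "y \<in> zero_set n P" using y by (auto simp: zero_set_def vanish_def)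
  qed
  moreover have "zero_set n P \<subseteq> zero_set n (g ` {..<k})" using g(1) by (auto simp: zero_set_def)
  ultimately have "zero_set n P = zero_set n (g ` {..<k})" by blast
  moreover have "g ` {..<k} \<subseteq> polys n" using g(1) assms by auto
  ultimately show ?thesis unfolding variety_def by blast
qed

lemma variety_iff: "variety n V \<longleftrightarrow> (\<exists>P \<subseteq> polys n. V = zero_set n P)"
  using variety_zero_set unfolding variety_def by blast

lemma variety_carrier: "variety n V \<Longrightarrow> V \<subseteq> carrier_vec n"
  by (auto simp: variety_def zero_set_def)

lemma variety_eq_zero_set: "variety n V \<Longrightarrow> V = zero_set n (vanishing_ideal n V)"
  by (auto simp: variety_def zero_set_def vanishing_ideal_def)

lemma variety_memI:
  assumes "variety n V" "y \<in> carrier_vec n" "\<And>p. p \<in> polys n \<Longrightarrow> p \<in> vanish V \<Longrightarrow> poly_eval p y = 0"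
  shows "y \<in> V"
proof -
  have "y \<in> zero_set n (vanishing_ideal n V)"
    using assms(2,3) by (auto simp: zero_set_def vanishing_ideal_eq)
  then show ?thesis using variety_eq_zero_set[OF assms(1)] by simp
qed

lemma variety_Int: "variety n A \<Longrightarrow> variety n B \<Longrightarrow> variety n (A \<inter> B)"
proof -
  assume "variety n A" "variety n B"
  then obtain P Q where "P \<subseteq> polys n" "A = zero_set n P" "Q \<subseteq> polys n" "B = zero_set n Q"
    unfolding variety_iff by blast
  then show ?thesis
    unfolding variety_iff by (intro exI[of _ "P \<union> Q"]) (auto simp: zero_set_def)
qed

lemma variety_polyfun:
  assumes "\<And>f. f \<in> F \<Longrightarrow> polyfun n f"
  shows "variety n {y \<in> carrier_vec n. \<forall>f\<in>F. f y = 0}"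
proof -
  define P where "P = {p \<in> polys n. \<exists>f\<in>F. \<forall>y\<in>carrier_vec n. f y = poly_eval p y}"
  have "{y \<in> carrier_vec n. \<forall>f\<in>F. f y = 0} = zero_set n P"
  proof (intro equalityI subsetI)
    fix y assume y: "y \<in> {y \<in> carrier_vec n. \<forall>f\<in>F. f y = 0}"
    have "poly_eval p y = 0" if p: "p \<in> P" for p
    proof -
      obtain f where "f \<in> F" "\<forall>y\<in>carrier_vec n. f y = poly_eval p y"
        using p unfolding P_def by blast
      then show ?thesis using y by fastforce
    qed
    then show "y \<in> zero_set n P" using y by (simp add: zero_set_def)
  next
    fix y assume y: "y \<in> zero_set n P"
    have "f y = 0" if f: "f \<in> F" for f
    proof -
      obtain p where p: "p \<in> polys n" "\<forall>y\<in>carrier_vec n. f y = poly_eval p y"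
        using assms[OF f] unfolding polyfun_def by blast
      then have "p \<in> P" using f unfolding P_def by blast
      then show ?thesis using p(2) y by (simp add: zero_set_def)
    qed
    then show "y \<in> {y \<in> carrier_vec n. \<forall>f\<in>F. f y = 0}" using y by (simp add: zero_set_def)
  qed
  moreover have "P \<subseteq> polys n" unfolding P_def by blast
  ultimately show ?thesis unfolding variety_iff by blast
qed

lemma variety_polyfun_Int:
  assumes "variety n V" "\<And>f. f \<in> F \<Longrightarrow> polyfun n f"
  shows "variety n {y \<in> V. \<forall>f\<in>F. f y = 0}"
proof -
  have "{y \<in> V. \<forall>f\<in>F. f y = 0} = V \<inter> {y \<in> carrier_vec n. \<forall>f\<in>F. f y = 0}"
    using variety_carrier[OF assms(1)] by auto
  then show ?thesis using variety_Int[OF assms(1) variety_polyfun[OF assms(2)]] by simp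
qed

lemma variety_poly_eval_Int: "variety n V \<Longrightarrow> variety n {y \<in> V. poly_eval p y = 0}"
  using variety_polyfun_Int[of n V "{poly_eval p}"] polyfun_poly_eval by auto

text \<open>A strictly descending chain would provide polynomials \<open>p k\<close> vanishing on
  \<open>Z (Suc k)\<close> but not on \<open>Z k\<close>. Some \<open>p k\<close> is a combination
  of its predecessors, all of which vanish on \<open>Z k\<close>.\<close>

lemma minimal_variety:
  assumes "Z0 \<in> \<Z>" and var: "\<And>W. W \<in> \<Z> \<Longrightarrow> variety n W"
  shows "\<exists>W\<in>\<Z>. \<forall>W'\<in>\<Z>. W' \<subseteq> W \<longrightarrow> W' = W"
proof (rule ccontr)
  assume "\<not> ?thesis"
  then have neg: "\<exists>W'. W' \<in> \<Z> \<and> W' \<subset> W" if "W \<in> \<Z>" for W using that by blast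
  have "\<exists>Z. \<forall>k. Z k \<in> \<Z> \<and> Z (Suc k) \<subset> Z k"
    by (rule dependent_nat_choice) (use assms(1) neg in auto)
  then obtain Z where Z: "\<And>k. Z k \<in> \<Z>" "\<And>k. Z (Suc k) \<subset> Z k" by blast
  have "\<exists>p. p \<in> polys n \<and> p \<in> vanish (Z (Suc k)) \<and> p \<notin> vanish (Z k)" for k
  proof (rule ccontr)
    assume "\<nexists>p. p \<in> polys n \<and> p \<in> vanish (Z (Suc k)) \<and> p \<notin> vanish (Z k)"
    then have *: "polys n \<inter> vanish (Z (Suc k)) \<subseteq> vanish (Z k)" by blast
    have "Z k \<subseteq> Z (Suc k)"
    proof
      fix y assume y: "y \<in> Z k"
      show "y \<in> Z (Suc k)"
        by (rule variety_memI[OF var[OF Z(1)]])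
           (use y * variety_carrier[OF var[OF Z(1)]] in \<open>auto simp: vanish_def\<close>)
    qed
    then show False using Z(2)[of k] by blast
  qed
  then obtain p where p: "\<And>k. p k \<in> polys n" "\<And>k. p k \<in> vanish (Z (Suc k))" "\<And>k. p k \<notin> vanish (Z k)"
    by metis
  have "range p \<subseteq> polys n" using p(1) by blast
  then obtain k where k: "p k \<in> lincombs (polys n) p k"
    using noeth_polys[of n] unfolding noeth_def lincombs_def by blast
  have mono: "Z j \<subseteq> Z i" if "i \<le> j" for i j
    using that by (rule lift_Suc_antimono_le[of Z, rotated]) (use Z(2) in blast)
  have "p i \<in> vanish (Z k)" if "i < k" for i
    using p(2)[of i] vanish_mono[OF mono[of "Suc i" k]] that by auto
  then show False using vanish_lincombs[OF _ k] p(3) by blast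
qed

text \<open>Needed to apply the rank bound for Jacobians to \<Sigma>, which is known only as a
  closure.\<close>

lemma ideal_generators_exist:
  assumes "V \<subseteq> carrier_vec n"
  shows "\<exists>qs. ideal_generators n V qs"
proof -
  have "vanishing_ideal n V \<subseteq> polys n" by (auto simp: vanishing_ideal_eq)
  then obtain g k where g: "\<forall>i<k. g i \<in> vanishing_ideal n V" "vanishing_ideal n V \<subseteq> lincombs (polys n) g k"
    using noeth_finite_generation[OF noeth_polys] by blast
  let ?qs = "map g [0..<k]"
  have "generated_ideal n ?qs \<subseteq> vanishing_ideal n V"
  proof
    fix p assume "p \<in> generated_ideal n ?qs"
    then obtain q where q: "p = (\<Sum>i<k. q i * g i)" "\<forall>i<k. q i \<in> polys n"
      by (auto simp: generated_ideal_def)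
    then have "p \<in> polys n" using g(1) unfolding q(1) vanishing_ideal_eq polys_eq
      by (auto intro!: polys_in_sum polys_in_mult)
    moreover have "p \<in> vanish V" using g(1) by (auto simp: q(1) vanishing_ideal_eq vanish_def)
    ultimately show "p \<in> vanishing_ideal n V" by (simp add: vanishing_ideal_eq)
  qed
  moreover have "lincombs (polys n) g k \<subseteq> generated_ideal n ?qs"
    by (auto simp: lincombs_def generated_ideal_def)
  ultimately have "ideal_generators n V ?qs"
    using g by (auto simp: ideal_generators_def vanishing_ideal_eq)
  then show ?thesis by blast
qed

section \<open>Irreducible varieties\<close>

lemma irreducible_prime:
  assumes "irreducible_variety n V"
  shows "prime_ideal (vanish V)"
  unfolding prime_ideal_def
proof (intro conjI)
  have V: "variety n V" "V \<noteq> {}" using assms by (auto simp: irreducible_variety_def)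
  show "1 \<notin> vanish V" using V by (auto simp: vanish_def)
  show "\<forall>a b. a * b \<in> vanish V \<longrightarrow> a \<in> vanish V \<or> b \<in> vanish V"
  proof (intro allI impI, rule ccontr)
    fix a b assume ab: "a * b \<in> vanish V" and n: "\<not> (a \<in> vanish V \<or> b \<in> vanish V)"
    let ?A = "{y \<in> V. poly_eval a y = 0}" and ?B = "{y \<in> V. poly_eval b y = 0}"
    have "variety n ?A" "variety n ?B" using variety_poly_eval_Int[OF V(1)] by auto
    moreover have "?A \<subset> V" "?B \<subset> V" using n by (auto simp: vanish_def)
    moreover have "V = ?A \<union> ?B" using ab by (auto simp: vanish_def)
    ultimately show False using assms unfolding irreducible_variety_def by blast
  qed
qed (auto simp: vanish_def)

lemma irreducible_varietyI:
  assumes V: "variety n V" "V \<noteq> {}"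
    and pr: "\<And>p q. p \<in> polys n \<Longrightarrow> q \<in> polys n \<Longrightarrow> p * q \<in> vanish V \<Longrightarrow> p \<in> vanish V \<or> q \<in> vanish V"
  shows "irreducible_variety n V"
proof -
  have "False" if h: "variety n A" "variety n B" "A \<subset> V" "B \<subset> V" "V = A \<union> B" for A B
  proof -
    have ex: "\<exists>p\<in>polys n. p \<in> vanish C \<and> p \<notin> vanish V" if C: "variety n C" "C \<subset> V" for C
    proof (rule ccontr)
      assume "\<not> ?thesis"
      then have *: "polys n \<inter> vanish C \<subseteq> vanish V" by blast
      have "V \<subseteq> C"
      proof
        fix y assume y: "y \<in> V"
        show "y \<in> C"
          by (rule variety_memI[OF C(1)])
             (use y * variety_carrier[OF V(1)] in \<open>auto simp: vanish_def\<close>)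
      qed
      then show False using C by blast
    qed
    obtain p where p: "p \<in> polys n" "p \<in> vanish A" "p \<notin> vanish V" using ex h by blast
    obtain q where q: "q \<in> polys n" "q \<in> vanish B" "q \<notin> vanish V" using ex h by blast
    have "p * q \<in> vanish V" using p(2) q(2) unfolding h(5) by (auto simp: vanish_def)
    then show False using pr p q by blast
  qed
  then show ?thesis using V unfolding irreducible_variety_def by blast
qed

lemma irreducible_Un:
  assumes V: "irreducible_variety n V" "V \<subseteq> A \<union> B" and AB: "variety n A" "variety n B"
  shows "V \<subseteq> A \<or> V \<subseteq> B"
proof (rule ccontr)
  assume n: "\<not> (V \<subseteq> A \<or> V \<subseteq> B)"
  have "variety n (V \<inter> A)" "variety n (V \<inter> B)"
    using V AB variety_Int unfolding irreducible_variety_def by auto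
  moreover have "V \<inter> A \<subset> V" "V \<inter> B \<subset> V" "V = (V \<inter> A) \<union> (V \<inter> B)" using n V by auto
  ultimately show False using V(1) unfolding irreducible_variety_def by blast
qed

text \<open>The product of the polynomials stays outside the prime ideal. All genericity arguments
  below take this form.\<close>

lemma irreducible_common_point:
  assumes V: "irreducible_variety n V" and f: "finite F" "\<And>p. p \<in> F \<Longrightarrow> p \<notin> vanish V"
  obtains y where "y \<in> V" "\<And>p. p \<in> F \<Longrightarrow> poly_eval p y \<noteq> 0"
proof -
  have "prod (\<lambda>p. p) F \<notin> vanish V"
    using prime_ideal_prod[OF irreducible_prime[OF V] f(1), of "\<lambda>p. p"] f(2) by blast
  then obtain y where "y \<in> V" "poly_eval (prod (\<lambda>p. p) F) y \<noteq> 0" by (auto simp: vanish_def)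
  then show thesis using that f(1) by auto
qed

lemma zariski_closure_eq:
  assumes "S \<subseteq> carrier_vec n"
  shows "zariski_closure n S = zero_set n (vanishing_ideal n S)"
proof
  have "variety n (zero_set n (vanishing_ideal n S))"
    by (rule variety_zero_set) (auto simp: vanishing_ideal_eq)
  moreover have "S \<subseteq> zero_set n (vanishing_ideal n S)"
    using assms by (auto simp: zero_set_def vanishing_ideal_def)
  ultimately show "zariski_closure n S \<subseteq> zero_set n (vanishing_ideal n S)"
    unfolding zariski_closure_def by blast
  show "zero_set n (vanishing_ideal n S) \<subseteq> zariski_closure n S"
    unfolding zariski_closure_def
  proof (intro Inter_greatest)
    fix W assume "W \<in> {W. variety n W \<and> S \<subseteq> W}"
    then have W: "variety n W" "S \<subseteq> W" by auto
    have "vanishing_ideal n W \<subseteq> vanishing_ideal n S"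
      using vanish_mono[OF W(2)] by (auto simp: vanishing_ideal_eq)
    then have "zero_set n (vanishing_ideal n S) \<subseteq> zero_set n (vanishing_ideal n W)"
      by (auto simp: zero_set_def)
    then show "zero_set n (vanishing_ideal n S) \<subseteq> W" using variety_eq_zero_set[OF W(1)] by simp
  qed
qed

lemma zariski_closure_variety: "S \<subseteq> carrier_vec n \<Longrightarrow> variety n (zariski_closure n S)"
  by (subst zariski_closure_eq) (auto intro!: variety_zero_set simp: vanishing_ideal_eq)

lemma zariski_closure_superset: "S \<subseteq> zariski_closure n S"
  unfolding zariski_closure_def by blast

lemma zariski_closure_minimal: "variety n W \<Longrightarrow> S \<subseteq> W \<Longrightarrow> zariski_closure n S \<subseteq> W"
  unfolding zariski_closure_def by blast

lemma vanish_zariski_closure: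
  assumes "S \<subseteq> carrier_vec n" "p \<in> polys n"
  shows "p \<in> vanish (zariski_closure n S) \<longleftrightarrow> p \<in> vanish S"
proof
  assume "p \<in> vanish S"
  then show "p \<in> vanish (zariski_closure n S)"
    using assms by (auto simp: zariski_closure_eq zero_set_def vanishing_ideal_eq vanish_def)
qed (use vanish_mono[OF zariski_closure_superset] in blast)

lemma irreducible_zariski_closure:
  assumes S: "S \<subseteq> carrier_vec n" "S \<noteq> {}"
    and pr: "\<And>p q. p \<in> polys n \<Longrightarrow> q \<in> polys n \<Longrightarrow> p * q \<in> vanish S \<Longrightarrow> p \<in> vanish S \<or> q \<in> vanish S"
  shows "irreducible_variety n (zariski_closure n S)"
proof (rule irreducible_varietyI[OF zariski_closure_variety[OF S(1)]])
  show "zariski_closure n S \<noteq> {}" using S zariski_closure_superset by blast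
  fix p q assume h: "p \<in> polys n" "q \<in> polys n" "p * q \<in> vanish (zariski_closure n S)"
  have "p * q \<in> vanish S" using h(3) vanish_mono[OF zariski_closure_superset] by blast
  then show "p \<in> vanish (zariski_closure n S) \<or> q \<in> vanish (zariski_closure n S)"
    using pr h by (simp add: vanish_zariski_closure[OF S(1)])
qed

section \<open>Algebraic independence of coordinates\<close>

definition indep :: "complex vec set \<Rightarrow> nat set \<Rightarrow> bool" where
  "indep V S \<longleftrightarrow> polys_in S \<inter> vanish V \<subseteq> {0}"

text \<open>For irreducible \<open>V\<close> this is the transcendence degree of the function field,
  since a transcendence basis can be chosen among the coordinates. For empty \<open>V\<close> no set
  is independent and the value is unspecified.\<close>

definition adim :: "nat \<Rightarrow> complex vec set \<Rightarrow> nat" where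
  "adim n V = Max (card ` {S. S \<subseteq> {..<n} \<and> indep V S})"

lemma indep_empty: "V \<noteq> {} \<Longrightarrow> indep V {}"
  unfolding indep_def
proof
  fix p assume V: "V \<noteq> {}" and p: "p \<in> polys_in {} \<inter> vanish V"
  then have "p = Const (Poly_Mapping.lookup p 0)" using polys_in_emptyD by blast
  moreover from this have "Poly_Mapping.lookup p 0 = 0"
    using p V poly_eval_Const unfolding vanish_def by (metis (mono_tags, lifting) IntD2 all_not_in_conv mem_Collect_eq)
  ultimately show "p \<in> {0}" by simp
qed

lemma indep_mono: "indep W S \<Longrightarrow> W \<subseteq> V \<Longrightarrow> indep V S"
  unfolding indep_def using vanish_mono[of W V] by blast

lemma indep_imp_nonempty: "indep V S \<Longrightarrow> V \<noteq> {}"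
proof
  assume i: "indep V S" and "V = {}"
  then have "(1::cpoly) \<in> polys_in S \<inter> vanish V" by (simp add: vanish_def)
  then have "(1::cpoly) \<in> {0}" using i unfolding indep_def by blast
  then show False by simp
qed

lemma adim_ge: "S \<subseteq> {..<n} \<Longrightarrow> indep V S \<Longrightarrow> card S \<le> adim n V"
  unfolding adim_def by (intro Max_ge) auto

lemma adim_witness:
  assumes "V \<noteq> {}"
  obtains S where "S \<subseteq> {..<n}" "indep V S" "card S = adim n V"
proof -
  have "adim n V \<in> card ` {S. S \<subseteq> {..<n} \<and> indep V S}"
    unfolding adim_def using indep_empty[OF assms] by (intro Max_in) auto
  then show thesis using that by auto
qed

lemma adim_mono: "W \<noteq> {} \<Longrightarrow> W \<subseteq> V \<Longrightarrow> adim n W \<le> adim n V"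
proof -
  assume "W \<noteq> {}" and s: "W \<subseteq> V"
  from adim_witness[OF this(1)] obtain S where S: "S \<subseteq> {..<n}" "indep W S" "card S = adim n W" .
  then show ?thesis using adim_ge[OF S(1) indep_mono[OF S(2) s]] by simp
qed

section \<open>Transcendence bases of coordinates\<close>

text \<open>Maximality under inclusion is what provides an algebraic relation over \<open>S\<close>
  for each further coordinate; a set of largest size has this property.\<close>

locale coordinate_basis =
  fixes n :: nat and V :: "complex vec set" and S :: "nat set"
  assumes irr: "irreducible_variety n V" and S: "S \<subseteq> {..<n}" and ind: "indep V S"
    and max: "\<And>j. j < n \<Longrightarrow> j \<notin> S \<Longrightarrow> \<not> indep V (insert j S)"

lemma coordinate_basis_witness:
  assumes "irreducible_variety n V" "S \<subseteq> {..<n}" "indep V S" "adim n V \<le> card S"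
  shows "coordinate_basis n V S"
proof
  fix j assume j: "j < n" "j \<notin> S"
  show "\<not> indep V (insert j S)"
  proof
    assume "indep V (insert j S)"
    then have "card (insert j S) \<le> adim n V" using assms(2) j by (intro adim_ge) auto
    moreover have "finite S" using assms(2) finite_subset by blast
    ultimately show False using assms(4) j by simp
  qed
qed (use assms in auto)

context coordinate_basis
begin

definition I where "I = vanish V"

text \<open>The tower climbs from \<open>T 0 = S\<close> to \<open>T n = {..<n}\<close>; a step
  whose coordinate already belongs to \<open>S\<close> changes nothing.\<close>

definition T where "T m = S \<union> {..<m}"

text \<open>A choice that is meaningful only for \<open>m < n\<close> outside
  \<open>S\<close>.\<close>

definition G where "G m = (SOME G. minimal_relation (polys_in (T m)) I (Var m) G)"

lemma variety: "variety n V" and nonempty: "V \<noteq> {}" and carrier: "V \<subseteq> carrier_vec n"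
  using irr variety_carrier by (auto simp: irreducible_variety_def)

lemma I: "prime_ideal I"
  unfolding I_def by (rule irreducible_prime[OF irr])

lemma fin_S: "finite S"
  using S finite_subset by blast

lemma base_in_I: "p \<in> polys_in S \<Longrightarrow> p \<in> I \<Longrightarrow> p = 0"
  using ind unfolding indep_def I_def by blast

lemma T_0: "T 0 = S"
  by (simp add: T_def)

lemma T_Suc: "T (Suc m) = insert m (T m)"
  by (auto simp: T_def lessThan_Suc)

lemma T_Suc_in: "m \<in> S \<Longrightarrow> T (Suc m) = T m"
  by (auto simp: T_def lessThan_Suc)

lemma T_n: "T n = {..<n}"
  using S by (auto simp: T_def)

lemma T_subset: "m \<le> n \<Longrightarrow> T m \<subseteq> {..<n}"
  using S by (auto simp: T_def)

lemma polys_T: "m \<le> n \<Longrightarrow> polys_in (T m) \<subseteq> polys n"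
  using polys_in_mono[OF T_subset] by (simp add: polys_eq)

lemma polys_S_T: "polys_in S \<subseteq> polys_in (T m)"
  by (rule polys_in_mono) (auto simp: T_def)

lemma notin_T: "m \<notin> S \<Longrightarrow> m \<notin> T m"
  by (simp add: T_def)

lemma poly_eval_I: "p \<in> I \<Longrightarrow> y \<in> V \<Longrightarrow> poly_eval p y = 0"
  by (simp add: I_def vanish_def)

text \<open>Maximality of \<open>S\<close> gives a nonzero relation over \<open>S\<close>. Its
  leading coefficient is a nonzero polynomial in \<open>S\<close>, hence not in \<open>I\<close> by
  independence, so a minimal relation exists already over the larger ring.\<close>

lemma G:
  assumes m: "m < n" "m \<notin> S"
  shows "minimal_relation (polys_in (T m)) I (Var m) (G m)"
proof -
  obtain p where p: "p \<in> polys_in (insert m S)" "p \<in> I" "p \<noteq> 0"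
    using max[OF m] unfolding indep_def I_def by blast
  then obtain P where P: "\<forall>i. coeff P i \<in> polys_in S" "p = poly P (Var m)"
    using polys_in_insert_iff by blast
  have "P \<noteq> 0" using P p by auto
  then have "lead_coeff P \<noteq> 0" by simp
  then have "coeff P (degree P) \<notin> I" using base_in_I P(1) by blast
  moreover have "coeffs_in (polys_in (T m)) P"
    using P(1) polys_S_T unfolding coeffs_in_def by blast
  ultimately have "\<exists>G. minimal_relation (polys_in (T m)) I (Var m) G"
    using p P by (intro minimal_relation_exists[OF subring_polys_in I]) auto
  then show ?thesis unfolding G_def by (rule someI_ex)
qed

text \<open>Descend the tower by \<open>multiple_in_base\<close> and multiply the cofactors. In
  other words, inverting the nonzero polynomials in \<open>S\<close> turns the coordinate ring into
  a field.\<close>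

lemma multiple_in_basis:
  "m \<le> n \<Longrightarrow> p \<in> polys_in (T m) \<Longrightarrow> p \<notin> I \<Longrightarrow>
    \<exists>q \<in> polys_in (T m). \<exists>r \<in> polys_in S. r \<notin> I \<and> p * q - r \<in> I"
proof (induction m arbitrary: p)
  case 0
  then show ?case
    using prime_ideal_0[OF I] by (intro bexI[of _ 1] bexI[of _ p]) (auto simp: T_0)
next
  case (Suc m)
  show ?case
  proof (cases "m \<in> S")
    case True
    then have "T (Suc m) = T m" by (rule T_Suc_in)
    then show ?thesis using Suc by simp
  next
    case False
    interpret minimal_relation "polys_in (T m)" I "Var m" "G m"
      using G False Suc.prems(1) by simp
    have ad: "adjoin (polys_in (T m)) (Var m) = polys_in (T (Suc m))"
      by (simp add: adjoin_polys_in T_Suc)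
    obtain c a where c: "c \<in> polys_in (T (Suc m))" "a \<in> polys_in (T m)" "a \<notin> I" "p * c - a \<in> I"
      using multiple_in_base[of p] Suc.prems unfolding ad by blast
    obtain q r where q: "q \<in> polys_in (T m)" "r \<in> polys_in S" "r \<notin> I" "a * q - r \<in> I"
      using Suc.IH[of a] c Suc.prems(1) by auto
    have "p * (c * q) - r = q * (p * c - a) + (a * q - r)" by (simp add: algebra_simps)
    then have "p * (c * q) - r \<in> I"
      by (simp only:) (intro prime_ideal_add[OF I] prime_ideal_mult[OF I] c q)
    moreover have "c * q \<in> polys_in (T (Suc m))"
      using c(1) q(1) polys_in_mono[of "T m" "T (Suc m)"] by (intro polys_in_mult) (auto simp: T_Suc)
    ultimately show ?thesis using q by blast
  qed
qed

text \<open>One coordinate at a time: the new coordinate is a root of the minimal relation.\<close>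

lemma lift_generic_points:
  obtains r where "r \<in> polys_in S" "r \<noteq> 0"
    "\<And>a. a \<in> carrier_vec n \<Longrightarrow> poly_eval r a \<noteq> 0 \<Longrightarrow> \<exists>y\<in>V. \<forall>i\<in>S. y $ i = a $ i"
proof -
  \<comment> \<open>Modulo \<open>I\<close>, \<open>r m\<close> is a multiple of the leading
    coefficient of \<open>G m\<close>. Hence \<open>r m\<close> being nonzero at \<open>a\<close>
    prevents \<open>G m\<close> from losing degree at a partial lift of \<open>a\<close>.\<close>
  have "\<exists>q r. r \<in> polys_in S \<and> r \<notin> I \<and> lead_coeff (G m) * q - r \<in> I \<and> q \<in> polys_in (T m)"
    if m: "m < n" "m \<notin> S" for m
  proof -
    interpret minimal_relation "polys_in (T m)" I "Var m" "G m" by (rule G[OF m])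
    have "lead_coeff (G m) \<in> polys_in (T m)" using G(1) by (simp add: coeffs_in_def)
    then show ?thesis using multiple_in_basis[of m "lead_coeff (G m)"] G(3) m by auto
  qed
  then obtain q r where qr: "\<And>m. m < n \<Longrightarrow> m \<notin> S \<Longrightarrow> r m \<in> polys_in S \<and> r m \<notin> I \<and>
      lead_coeff (G m) * q m - r m \<in> I \<and> q m \<in> polys_in (T m)" by metis
  define R where "R = (\<Prod>m\<in>{..<n} - S. r m)"
  have R: "R \<in> polys_in S" unfolding R_def using qr by (intro polys_in_prod) auto
  have "R \<notin> I"
    unfolding R_def using prime_ideal_prod[OF I, of "{..<n} - S" r] qr by auto
  then have R0: "R \<noteq> 0" using prime_ideal_0[OF I] by metis
  have "\<exists>y\<in>carrier_vec n. (\<forall>i\<in>S. y $ i = a $ i) \<and> (\<forall>p\<in>I \<inter> polys_in (T m). poly_eval p y = 0)"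
    if a: "a \<in> carrier_vec n" "poly_eval R a \<noteq> 0" and m: "m \<le> n" for a m
    using m
  proof (induction m)
    case 0
    have "poly_eval p a = 0" if "p \<in> I \<inter> polys_in (T 0)" for p
      using base_in_I[of p] that by (simp add: T_0)
    then show ?case using a by blast
  next
    case (Suc m)
    then obtain y where y: "y \<in> carrier_vec n" "\<forall>i\<in>S. y $ i = a $ i"
      "\<And>p. p \<in> I \<Longrightarrow> p \<in> polys_in (T m) \<Longrightarrow> poly_eval p y = 0" by auto
    show ?case
    proof (cases "m \<in> S")
      case True
      then have "T (Suc m) = T m" by (rule T_Suc_in)
      then show ?thesis using y by auto
    next
      case False
      have m: "m < n" using Suc.prems by simp
      interpret minimal_relation "polys_in (T m)" I "Var m" "G m" by (rule G[OF m False])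
      have qm: "r m \<in> polys_in S" "r m \<notin> I" "lead_coeff (G m) * q m - r m \<in> I" "q m \<in> polys_in (T m)"
        using qr[OF m False] by auto
      have lcT: "lead_coeff (G m) \<in> polys_in (T m)" using G(1) by (simp add: coeffs_in_def)
      have "lead_coeff (G m) * q m - r m \<in> polys_in (T m)"
        using lcT qm polys_S_T by (intro polys_in_diff polys_in_mult) auto
      then have "poly_eval (lead_coeff (G m) * q m - r m) y = 0" using y(3) qm by blast
      moreover have "poly_eval (r m) y = poly_eval (r m) a"
        using qm(1) by (rule poly_eval_cong) (use y(2) in auto)
      moreover have "poly_eval (r m) a \<noteq> 0"
        using a(2) m False by (auto simp: R_def)
      ultimately have lcy: "poly_eval (lead_coeff (G m)) y \<noteq> 0" by auto
      let ?Q = "map_poly (\<lambda>c. poly_eval c y) (G m)"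
      \<comment> \<open>The specialised relation keeps positive degree and so has a root, which
        becomes the new coordinate.\<close>
      have "coeff ?Q (degree (G m)) \<noteq> 0" using lcy by (simp add: coeff_map_poly)
      then have "degree (G m) \<le> degree ?Q" by (rule le_degree)
      then have "degree ?Q \<noteq> 0" using degree_pos by simp
      then have "\<not> constant (poly ?Q)" by (simp add: constant_degree)
      then obtain t where t: "poly ?Q t = 0" using fundamental_theorem_of_algebra by blast
      define z where "z = vec_upd y m t"
      have dy: "dim_vec y = n" using y(1) by simp
      have zy: "poly_eval c z = poly_eval c y" if "c \<in> polys_in (T m)" for c
        using that
      proof (rule poly_eval_cong)
        fix i assume i: "i \<in> T m"
        then have "i < n" "i \<noteq> m" using T_subset[of m] m notin_T[OF False] by auto
        then show "z $ i = y $ i" by (simp add: z_def vec_upd_index dy)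
      qed
      have zm: "z $ m = t" using m by (simp add: z_def vec_upd_index dy)
      have mp: "map_poly (\<lambda>c. poly_eval c z) P = map_poly (\<lambda>c. poly_eval c y) P"
        if "coeffs_in (polys_in (T m)) P" for P
        using that by (intro poly_eqI) (simp add: coeff_map_poly coeffs_in_def zy)
      have "poly_eval p z = 0" if p: "p \<in> I" "p \<in> polys_in (T (Suc m))" for p
      proof -
        have "p \<in> adjoin (polys_in (T m)) (Var m)" using p by (simp add: adjoin_polys_in T_Suc)
        \<comment> \<open>Up to a factor nonzero at \<open>z\<close>, \<open>p\<close> is a
          combination of the relation, which vanishes by the choice of \<open>t\<close>, and of
          coefficients in \<open>I\<close> from the previous stage, which vanish at
          \<open>y\<close>.\<close>
        from reduce_modulo[OF this p(1)] obtain N q P where d: "coeffs_in (polys_in (T m)) P"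
          "\<forall>i. coeff P i \<in> I" "lead_coeff (G m) ^ N * p = q * poly (G m) (Var m) + poly P (Var m)"
          by blast
        have "poly_eval (poly (G m) (Var m)) z = 0"
          by (simp add: poly_eval_poly mp[OF G(1)] zm t)
        moreover have "map_poly (\<lambda>c. poly_eval c z) P = 0"
          unfolding mp[OF d(1)] using d(1,2) y(3)
          by (intro poly_eqI) (simp add: coeff_map_poly coeffs_in_def)
        then have "poly_eval (poly P (Var m)) z = 0" by (simp add: poly_eval_poly)
        ultimately have "poly_eval (lead_coeff (G m) ^ N * p) z = 0" by (simp add: d(3))
        then show ?thesis using lcy zy[OF lcT] by simp
      qed
      moreover have "z $ i = a $ i" if i: "i \<in> S" for i
      proof -
        have "i < n" "i \<noteq> m" using i S False by auto
        then show ?thesis using y(2) i by (simp add: z_def vec_upd_index dy)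
      qed
      moreover have "z \<in> carrier_vec n" using y(1) by (simp add: z_def)
      ultimately show ?thesis by blast
    qed
  qed
  from this[of _ n] have ex: "\<exists>y\<in>carrier_vec n. (\<forall>i\<in>S. y $ i = a $ i) \<and> (\<forall>p\<in>I \<inter> polys n. poly_eval p y = 0)"
    if "a \<in> carrier_vec n" "poly_eval R a \<noteq> 0" for a
    using that by (simp add: T_n polys_eq)
  show thesis
  proof (rule that[OF R R0])
    fix a assume "a \<in> carrier_vec n" "poly_eval R a \<noteq> 0"
    then obtain y where y: "y \<in> carrier_vec n" "\<forall>i\<in>S. y $ i = a $ i"
      "\<forall>p\<in>I \<inter> polys n. poly_eval p y = 0" using ex by blast
    then have "y \<in> V" by (intro variety_memI[OF variety]) (auto simp: I_def)
    then show "\<exists>y\<in>V. \<forall>i\<in>S. y $ i = a $ i" using y by blast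
  qed
qed

end

section \<open>Krull dimension\<close>

text \<open>If the dimensions agreed, a largest independent set \<open>S\<close> for
  \<open>W\<close> would be a basis for \<open>V\<close>. A polynomial vanishing on \<open>W\<close>
  but not on \<open>V\<close> divides, modulo the ideal of \<open>V\<close>, a nonzero polynomial in
  \<open>S\<close>; the latter then vanishes on \<open>W\<close>, against independence
  there.\<close>

lemma adim_strict_mono:
  assumes V: "irreducible_variety n V" and W: "irreducible_variety n W" "W \<subset> V"
  shows "adim n W < adim n V"
proof (rule ccontr)
  assume neg: "\<not> adim n W < adim n V"
  have Wv: "variety n W" "W \<noteq> {}" using W by (auto simp: irreducible_variety_def)
  obtain S where Sw: "S \<subseteq> {..<n}" "indep W S" "card S = adim n W" by (rule adim_witness[OF Wv(2)])
  have "indep V S" using indep_mono[OF Sw(2)] W by blast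
  then interpret coordinate_basis n V S
    using V Sw neg by (intro coordinate_basis_witness) auto
  have "\<exists>f\<in>polys n. f \<in> vanish W \<and> f \<notin> I"
  proof (rule ccontr)
    assume "\<not> ?thesis"
    then have *: "polys n \<inter> vanish W \<subseteq> I" by blast
    have "V \<subseteq> W"
    proof
      fix y assume y: "y \<in> V"
      show "y \<in> W"
        by (rule variety_memI[OF Wv(1)]) (use y * carrier poly_eval_I in auto)
    qed
    then show False using W by blast
  qed
  then obtain f where f: "f \<in> polys_in (T n)" "f \<in> vanish W" "f \<notin> I"
    by (auto simp: T_n polys_eq)
  obtain q r where r: "r \<in> polys_in S" "r \<notin> I" "f * q - r \<in> I"
    using multiple_in_basis[OF order_refl f(1,3)] by blast
  have "r \<in> vanish W"
  proof -
    have "poly_eval r y = 0" if y: "y \<in> W" for y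
    proof -
      have "poly_eval (f * q - r) y = 0" using poly_eval_I[OF r(3)] y W by blast
      then show ?thesis using f(2) y by (simp add: vanish_def)
    qed
    then show ?thesis by (simp add: vanish_def)
  qed
  then have "r = 0" using r(1) Sw(2) unfolding indep_def by blast
  then show False using r(2) prime_ideal_0[OF I] by simp
qed

text \<open>Fixing one basis coordinate \<open>s\<close> at a suitable value keeps
  \<open>S - {s}\<close> independent on the slice. A minimal subvariety of the slice with this
  property is irreducible, which spares a decomposition into components.\<close>

lemma irreducible_slice:
  assumes V: "irreducible_variety n V" and d: "0 < adim n V"
  obtains W where "irreducible_variety n W" "W \<subset> V" "adim n V = Suc (adim n W)"
proof -
  have Vv: "variety n V" "V \<noteq> {}" using V by (auto simp: irreducible_variety_def)
  obtain S where Sw: "S \<subseteq> {..<n}" "indep V S" "card S = adim n V" by (rule adim_witness[OF Vv(2)])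
  interpret coordinate_basis n V S
    using V Sw by (intro coordinate_basis_witness) auto
  have "S \<noteq> {}" using d Sw(3) by auto
  then obtain s where s: "s \<in> S" by blast
  have sn: "s < n" using s Sw(1) by auto
  obtain r where r: "r \<in> polys_in S" "r \<noteq> 0"
    and lift: "\<And>a. a \<in> carrier_vec n \<Longrightarrow> poly_eval r a \<noteq> 0 \<Longrightarrow> \<exists>y\<in>V. \<forall>i\<in>S. y $ i = a $ i"
    by (rule lift_generic_points) blast
  have Spolys: "polys_in S \<subseteq> polys n" using polys_in_mono[OF Sw(1)] by (simp add: polys_eq)
  have S'S: "polys_in (S - {s}) \<subseteq> polys_in S" by (rule polys_in_mono) auto
  obtain a0 where a0: "a0 \<in> carrier_vec n" "poly_eval r a0 \<noteq> 0"
    using nonzero_polynomial_nonzero_value[OF fin_S r Sw(1)] by blast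
  \<comment> \<open>Taken from a point where \<open>r\<close> is nonzero, so that generic points of
    the slice still lift to \<open>V\<close>.\<close>
  define c where "c = a0 $ s"
  define \<Z> where "\<Z> = {W. variety n W \<and> W \<subseteq> V \<and> (\<forall>y\<in>W. y $ s = c) \<and> indep W (S - {s})}"
  let ?W0 = "{y \<in> V. \<forall>f\<in>{\<lambda>y. y $ s - c}. f y = 0}"
  have "indep ?W0 (S - {s})"
    unfolding indep_def
  proof (rule ccontr)
    assume "\<not> polys_in (S - {s}) \<inter> vanish ?W0 \<subseteq> {0}"
    then obtain p where p: "p \<in> polys_in (S - {s})" "p \<in> vanish ?W0" "p \<noteq> 0" by blast
    obtain a1 where a1: "a1 \<in> carrier_vec n" "poly_eval p a1 \<noteq> 0"
      using nonzero_polynomial_nonzero_value[OF _ p(1,3), of n] fin_S Sw(1) by blast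
    \<comment> \<open>Moving \<open>a1\<close> into the slice is harmless, since \<open>p\<close>
      does not involve the coordinate \<open>s\<close>.\<close>
    define a2 where "a2 = vec_upd a1 s c"
    have d1: "dim_vec a1 = n" using a1 by simp
    have a2: "a2 \<in> carrier_vec n" using a1 by (simp add: a2_def)
    have "poly_eval p a2 = poly_eval p a1"
      using p(1) by (rule poly_eval_cong) (use Sw(1) d1 in \<open>auto simp: a2_def vec_upd_index\<close>)
    then have pa2: "poly_eval p a2 \<noteq> 0" using a1 by simp
    have a2s: "a2 $ s = c" using sn d1 by (simp add: a2_def vec_upd_index)
    have rp: "r \<in> polys n" "p \<in> polys n" using r(1) p(1) Spolys S'S by auto
    \<comment> \<open>Both endpoints have \<open>s\<close>-entry \<open>c\<close>, so the line
      through them stays in the slice.\<close>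
    obtain k where k: "poly_eval r (vec n (\<lambda>i. a0 $ i + k * (a2 $ i - a0 $ i))) \<noteq> 0"
      "poly_eval p (vec n (\<lambda>i. a0 $ i + k * (a2 $ i - a0 $ i))) \<noteq> 0"
      using common_nonzero_on_line[OF rp a0(1) a2 a0(2) pa2] by blast
    define a where "a = vec n (\<lambda>i. a0 $ i + k * (a2 $ i - a0 $ i))"
    have "a $ s = c" using sn a2s by (simp add: a_def c_def)
    have "a \<in> carrier_vec n" by (simp add: a_def)
    then obtain y where y: "y \<in> V" "\<forall>i\<in>S. y $ i = a $ i" using lift[of a] k(1) by (auto simp: a_def)
    have "y \<in> ?W0" using y s \<open>a $ s = c\<close> by simp
    then have "poly_eval p y = 0" using p(2) unfolding vanish_def by blast
    moreover have "poly_eval p y = poly_eval p a"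
      using p(1) by (rule poly_eval_cong) (use y(2) in auto)
    ultimately show False using k(2) by (simp add: a_def)
  qed
  moreover have "variety n ?W0"
    by (rule variety_polyfun_Int[OF Vv(1)])
       (auto intro!: polyfun_diff polyfun_index polyfun_const)
  ultimately have W0: "?W0 \<in> \<Z>" by (auto simp: \<Z>_def)
  have "\<exists>W\<in>\<Z>. \<forall>W'\<in>\<Z>. W' \<subseteq> W \<longrightarrow> W' = W"
    by (rule minimal_variety[OF W0, of n]) (simp add: \<Z>_def)
  then obtain W where W: "W \<in> \<Z>" and Wmin: "\<And>W'. W' \<in> \<Z> \<Longrightarrow> W' \<subseteq> W \<Longrightarrow> W' = W"
    by blast
  have Wv: "variety n W" "W \<subseteq> V" "\<forall>y\<in>W. y $ s = c" "indep W (S - {s})" using W by (auto simp: \<Z>_def)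
  have Wirr: "irreducible_variety n W"
  proof (rule irreducible_varietyI[OF Wv(1) indep_imp_nonempty[OF Wv(4)]], rule ccontr)
    fix p q assume pq: "p * q \<in> vanish W" and n: "\<not> (p \<in> vanish W \<or> q \<in> vanish W)"
    \<comment> \<open>By minimality, cutting \<open>W\<close> properly by one equation destroys the
      independence of \<open>S - {s}\<close>. Relations for the two cuts multiply to a relation on
      \<open>W\<close>.\<close>
    have ex: "\<exists>f. f \<in> polys_in (S - {s}) \<and> f \<in> vanish {y \<in> W. poly_eval p y = 0} \<and> f \<noteq> 0"
      if "p \<notin> vanish W" for p
    proof -
      let ?A = "{y \<in> W. poly_eval p y = 0}"
      have "?A \<noteq> W" using that by (auto simp: vanish_def)
      then have "?A \<notin> \<Z>" using Wmin[of ?A] by blast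
      moreover have "variety n ?A" by (rule variety_poly_eval_Int[OF Wv(1)])
      ultimately have "\<not> indep ?A (S - {s})" using Wv(2,3) by (auto simp: \<Z>_def)
      then show ?thesis unfolding indep_def by blast
    qed
    obtain f where f: "f \<in> polys_in (S - {s})" "f \<in> vanish {y \<in> W. poly_eval p y = 0}" "f \<noteq> 0"
      using ex n by blast
    obtain g where g: "g \<in> polys_in (S - {s})" "g \<in> vanish {y \<in> W. poly_eval q y = 0}" "g \<noteq> 0"
      using ex n by blast
    have "f * g \<in> vanish W" using f(2) g(2) pq by (auto simp: vanish_def)
    moreover have "f * g \<in> polys_in (S - {s})" using f g by (intro polys_in_mult)
    ultimately have "f * g = 0" using Wv(4) unfolding indep_def by blast
    then show False using f g by simp
  qed
  have "W \<noteq> V"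
  proof
    assume "W = V"
    then have "Var s - Const c \<in> I" using Wv(3) by (simp add: I_def vanish_def)
    moreover have "Var s - Const c \<in> polys_in S" using s by (intro polys_in_diff) auto
    ultimately have "Var s - Const c = 0" by (intro base_in_I)
    then have "poly_eval (Var s - Const c) (vec n (\<lambda>_. c + 1)) = 0" by simp
    then show False using sn by simp
  qed
  then have Wlt: "W \<subset> V" using Wv(2) by blast
  have "adim n W < adim n V" by (rule adim_strict_mono[OF V Wirr Wlt])
  moreover have "card (S - {s}) \<le> adim n W" using Sw(1) Wv(4) by (intro adim_ge) auto
  ultimately have "adim n V = Suc (adim n W)" using s Sw(3) fin_S by (simp add: card_Diff_singleton_if)
  then show thesis using that Wirr Wlt by blast
qed

lemma irreducible_chain:
  "irreducible_variety n V \<Longrightarrow>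
    \<exists>Z. (\<forall>i\<le>adim n V. irreducible_variety n (Z i) \<and> Z i \<subseteq> V) \<and> (\<forall>i<adim n V. Z i \<subset> Z (Suc i))"
proof (induction "adim n V" arbitrary: V)
  case 0
  then show ?case by (intro exI[of _ "\<lambda>_. V"]) auto
next
  case (Suc d)
  obtain W where W: "irreducible_variety n W" "W \<subset> V" "adim n V = Suc (adim n W)"
    using irreducible_slice[OF Suc.prems] Suc.hyps(2) by (metis zero_less_Suc)
  then have "d = adim n W" using Suc.hyps(2) by simp
  then obtain Z where Z: "\<forall>i\<le>d. irreducible_variety n (Z i) \<and> Z i \<subseteq> W" "\<forall>i<d. Z i \<subset> Z (Suc i)"
    using Suc.hyps(1)[of W] W(1) by blast
  let ?Z = "\<lambda>i. if i \<le> d then Z i else V"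
  have "\<forall>i\<le>adim n V. irreducible_variety n (?Z i) \<and> ?Z i \<subseteq> V"
    using Z(1) W(2) Suc.prems by auto
  moreover have "?Z i \<subset> ?Z (Suc i)" if i: "i < adim n V" for i
  proof (cases "i < d")
    case True
    then show ?thesis using Z(2) by simp
  next
    case False
    then have "i = d" using i Suc.hyps(2) by simp
    then show ?thesis using Z(1) W(2) by auto
  qed
  ultimately have "(\<forall>i\<le>adim n V. irreducible_variety n (?Z i) \<and> ?Z i \<subseteq> V) \<and>
      (\<forall>i<adim n V. ?Z i \<subset> ?Z (Suc i))" by blast
  then show ?case by (rule exI[of _ ?Z])
qed

theorem variety_dim_eq_adim:
  assumes V: "irreducible_variety n V"
  shows "variety_dim n V = enat (adim n V)"
proof (rule antisym)
  show "variety_dim n V \<le> enat (adim n V)"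
    unfolding variety_dim_def
  proof (rule Sup_least)
    fix x assume "x \<in> {enat k | k. \<exists>Z. (\<forall>i\<le>k. irreducible_variety n (Z i) \<and> Z i \<subseteq> V) \<and>
                        (\<forall>i<k. Z i \<subset> Z (Suc i))}"
    then obtain k Z where k: "x = enat k" and Z: "\<forall>i\<le>k. irreducible_variety n (Z i) \<and> Z i \<subseteq> V"
      "\<forall>i<k. Z i \<subset> Z (Suc i)" by blast
    have "i \<le> adim n (Z i)" if "i \<le> k" for i
      using that
    proof (induction i)
      case (Suc i)
      have "adim n (Z i) < adim n (Z (Suc i))"
        by (rule adim_strict_mono) (use Z Suc.prems in auto)
      then show ?case using Suc by simp
    qed simp
    then have "k \<le> adim n (Z k)" by simp
    also have "\<dots> \<le> adim n V"
      using Z(1) by (intro adim_mono) (auto simp: irreducible_variety_def)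
    finally show "x \<le> enat (adim n V)" by (simp add: k)
  qed
  show "enat (adim n V) \<le> variety_dim n V"
    unfolding variety_dim_def using irreducible_chain[OF V] by (intro Sup_upper) blast
qed

section \<open>Rank of the Jacobian matrix\<close>

abbreviation cspan :: "nat \<Rightarrow> complex vec set \<Rightarrow> complex vec set" where
  "cspan n \<equiv> LinearCombinations.module.span class_ring (module_vec TYPE(complex) n)"

text \<open>At a common zero the product rule reduces to
  \<open>grad n (q * p) y = poly_eval q y \<cdot>\<^sub>v grad n p y\<close>. Hence \<open>K\<close>
  is an ideal of \<open>polys n\<close>, and factors not vanishing at \<open>y\<close> may be
  cancelled from products in it.\<close>

lemma grad_ideal_span:
  assumes "y \<in> carrier_vec n" and U: "U \<subseteq> carrier_vec n"
  defines "K \<equiv> {p \<in> polys n. poly_eval p y = 0 \<and> grad n p y \<in> cspan n U}"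
  shows "0 \<in> K" "\<And>p q. p \<in> K \<Longrightarrow> q \<in> K \<Longrightarrow> p + q \<in> K" "\<And>p q. p \<in> K \<Longrightarrow> q \<in> polys n \<Longrightarrow> q * p \<in> K"
    "\<And>p q. p \<in> polys n \<Longrightarrow> poly_eval p y = 0 \<Longrightarrow> q \<in> polys n \<Longrightarrow> poly_eval q y \<noteq> 0 \<Longrightarrow> q * p \<in> K \<Longrightarrow> p \<in> K"
    "\<And>p. p \<in> polys n \<Longrightarrow> poly_eval p y = 0 \<Longrightarrow> grad n p y \<in> U \<Longrightarrow> p \<in> K"
proof -
  interpret vec_space "TYPE(complex)" n .
  have add: "u + w \<in> span U" if "u \<in> span U" "w \<in> span U" for u w
    using submodule.m_closed[OF span_is_submodule[of U]] that U by simp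
  have smult: "c \<cdot>\<^sub>v u \<in> span U" if "u \<in> span U" for u c
    using submodule.smult_closed[OF span_is_submodule[of U]] that U by simp
  have zero: "0\<^sub>v n \<in> span U"
    using submodule.zero_closed[OF span_is_submodule[of U]] U by simp
  show "0 \<in> K" using zero by (simp add: K_def polys_eq)
  show "p + q \<in> K" if "p \<in> K" "q \<in> K" for p q
    using that add by (auto simp: K_def polys_eq grad_add assms(1) polys_in_add)
  have gm: "grad n (q * p) y = poly_eval q y \<cdot>\<^sub>v grad n p y"
    if "p \<in> polys n" "poly_eval p y = 0" "q \<in> polys n" for p q
  proof -
    have "grad n (q * p) y = 0 \<cdot>\<^sub>v grad n q y + poly_eval q y \<cdot>\<^sub>v grad n p y"
      using grad_mult[OF that(3,1) assms(1)] that(2) by simp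
    also have "\<dots> = poly_eval q y \<cdot>\<^sub>v grad n p y"
      by (intro eq_vecI) (auto simp: grad_def)
    finally show ?thesis .
  qed
  show "p \<in> K" if "p \<in> polys n" "poly_eval p y = 0" "grad n p y \<in> U" for p
    using that in_own_span[of U] U by (auto simp: K_def)
  show "q * p \<in> K" if "p \<in> K" "q \<in> polys n" for p q
    using that smult by (auto simp: K_def gm polys_eq polys_in_mult)
  show "p \<in> K" if h: "p \<in> polys n" "poly_eval p y = 0" "q \<in> polys n" "poly_eval q y \<noteq> 0" "q * p \<in> K" for p q
  proof -
    have "poly_eval q y \<cdot>\<^sub>v grad n p y \<in> span U" using h by (simp add: K_def gm)
    then have "inverse (poly_eval q y) \<cdot>\<^sub>v (poly_eval q y \<cdot>\<^sub>v grad n p y) \<in> span U" by (rule smult)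
    then show ?thesis using h by (simp add: K_def smult_smult_assoc)
  qed
qed

lemma Dmat_carrier [simp]: "Dmat n ps y \<in> carrier_mat n (length ps)"
  by (simp add: Dmat_def)

lemma dim_Dmat [simp]: "dim_row (Dmat n ps y) = n" "dim_col (Dmat n ps y) = length ps"
  by (simp_all add: Dmat_def)

lemma col_Dmat: "i < length ps \<Longrightarrow> col (Dmat n ps y) i = grad n (ps ! i) y"
  by (intro eq_vecI) (auto simp: Dmat_def grad_def)

lemma polyfun_Dmat:
  assumes "i < n" "j < length ps"
  shows "polyfun n (\<lambda>y. Dmat n ps y $$ (i, j))"
  using assms by (simp add: Dmat_def polyfun_poly_eval)

context coordinate_basis
begin

definition relation_grads where
  "relation_grads y = (\<lambda>m. grad n (poly (G m) (Var m)) y) ` ({..<n} - S)"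

lemma relation_grads_carrier: "relation_grads y \<subseteq> carrier_vec n"
  by (auto simp: relation_grads_def)

lemma relation_polys:
  assumes m: "m < n" "m \<notin> S"
  shows "poly (G m) (Var m) \<in> I" "poly (G m) (Var m) \<in> polys_in (T (Suc m))"
    "coeffs_in (polys_in (T m)) (G m)"
proof -
  interpret minimal_relation "polys_in (T m)" I "Var m" "G m" by (rule G[OF m])
  show "poly (G m) (Var m) \<in> I" "coeffs_in (polys_in (T m)) (G m)" using G by auto
  then show "poly (G m) (Var m) \<in> polys_in (T (Suc m))"
    using mem_adjoin[OF A, of "G m" "Var m"] by (simp add: adjoin_polys_in T_Suc)
qed

text \<open>Induction up the tower: \<open>reduce_modulo\<close> expresses a power of the leading
  coefficient times \<open>p\<close> through the relation for \<open>m\<close> and coefficients in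
  \<open>I\<close> from the previous stage. The closure properties of \<open>grad_ideal_span\<close>
  transfer this to gradients.\<close>

lemma generic_gradient_span:
  "m \<le> n \<Longrightarrow> p \<in> I \<Longrightarrow> p \<in> polys_in (T m) \<Longrightarrow>
    \<exists>h\<in>polys n. h \<notin> I \<and> (\<forall>y\<in>V. poly_eval h y \<noteq> 0 \<longrightarrow>
      grad n p y \<in> cspan n (relation_grads y))"
proof (induction m arbitrary: p)
  case 0
  then have p0: "p = 0" using base_in_I by (simp add: T_0)
  show ?case
  proof (intro bexI[of _ 1] conjI ballI impI)
    fix y assume "y \<in> V"
    then have "y \<in> carrier_vec n" using carrier by blast
    from grad_ideal_span(1)[OF this relation_grads_carrier[of y]] show "grad n p y \<in> cspan n (relation_grads y)"
      by (simp add: p0)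
  qed (use prime_ideal_1[OF I] in \<open>auto simp: polys_eq\<close>)
next
  case (Suc m)
  show ?case
  proof (cases "m \<in> S")
    case True
    then have "T (Suc m) = T m" by (rule T_Suc_in)
    then show ?thesis using Suc by simp
  next
    case False
    have m: "m < n" using Suc.prems by simp
    interpret minimal_relation "polys_in (T m)" I "Var m" "G m" by (rule G[OF m False])
    let ?l = "lead_coeff (G m)"
    have lT: "?l \<in> polys_in (T m)" using G(1) by (simp add: coeffs_in_def)
    have "p \<in> adjoin (polys_in (T m)) (Var m)" using Suc.prems by (simp add: adjoin_polys_in T_Suc)
    from reduce_modulo[OF this Suc.prems(2)] obtain N q P where
      d: "q \<in> adjoin (polys_in (T m)) (Var m)" "coeffs_in (polys_in (T m)) P" "\<forall>i. coeff P i \<in> I"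
        "?l ^ N * p = q * poly (G m) (Var m) + poly P (Var m)" by blast
    have "\<exists>h. h \<in> polys n \<and> h \<notin> I \<and> (\<forall>y\<in>V. poly_eval h y \<noteq> 0 \<longrightarrow>
      grad n (coeff P i) y \<in> cspan n (relation_grads y))" for i
      using Suc.IH[of "coeff P i"] m d(2,3) by (auto simp: coeffs_in_def)
    then obtain h where h: "\<And>i. h i \<in> polys n" "\<And>i. h i \<notin> I"
      "\<And>i y. y \<in> V \<Longrightarrow> poly_eval (h i) y \<noteq> 0 \<Longrightarrow>
      grad n (coeff P i) y \<in> cspan n (relation_grads y)"
      by metis
    \<comment> \<open>Collects the leading coefficient to be cancelled and the exceptional
      polynomials of the finitely many coefficients.\<close>
    define H where "H = ?l * (\<Prod>i\<le>degree P. h i)"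
    have Tn: "polys_in (T m) \<subseteq> polys n" "polys_in (T (Suc m)) \<subseteq> polys n" using polys_T m by auto
    have Hp: "H \<in> polys n"
      unfolding H_def polys_eq using lT Tn h(1) by (auto simp: polys_eq intro!: polys_in_mult polys_in_prod)
    have "(\<Prod>i\<le>degree P. h i) \<notin> I" using prime_ideal_prod[OF I, of "{..degree P}" h] h(2) by auto
    then have HI: "H \<notin> I" unfolding H_def using prime_ideal_prime[OF I] G(3) by blast
    have "grad n p y \<in> cspan n (relation_grads y)"
      if y: "y \<in> V" "poly_eval H y \<noteq> 0" for y
    proof -
      define K where "K = {p \<in> polys n. poly_eval p y = 0 \<and> grad n p y \<in> cspan n (relation_grads y)}"
      have yc: "y \<in> carrier_vec n" using y carrier by auto
      have U: "relation_grads y \<subseteq> carrier_vec n" by (auto simp: relation_grads_def)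
      note K = grad_ideal_span[OF yc U, folded K_def]
      have ly: "poly_eval ?l y \<noteq> 0" and hy: "poly_eval (h i) y \<noteq> 0" if "i \<le> degree P" for i
        using y(2) that by (auto simp: H_def)
      then have ly: "poly_eval ?l y \<noteq> 0" by blast
      have c: "coeff P i \<in> K" if i: "i \<le> degree P" for i
      proof -
        have "coeff P i \<in> polys n" using d(2) Tn by (auto simp: coeffs_in_def)
        then show ?thesis using h(3)[OF y(1) hy[OF i]] d(3) poly_eval_I y(1) by (auto simp: K_def)
      qed
      have Ksum: "sum f L \<in> K" if "\<And>i. i \<in> L \<Longrightarrow> f i \<in> K" for f and L :: "nat set"
        using that by (induction L rule: infinite_finite_induct) (auto intro: K(1,2))
      have "poly P (Var m) \<in> K"
        unfolding poly_altdef
        by (rule Ksum, subst mult.commute, rule K(3))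
           (use c m in \<open>auto simp: polys_eq intro: polys_in_power\<close>)
      moreover have "q * poly (G m) (Var m) \<in> K"
      proof (rule K(3))
        have gp: "poly (G m) (Var m) \<in> polys n" using relation_polys(2)[OF m False] Tn by blast
        have "grad n (poly (G m) (Var m)) y \<in> relation_grads y" using m False by (auto simp: relation_grads_def)
        then show "poly (G m) (Var m) \<in> K"
          using gp poly_eval_I[OF G(2) y(1)] by (intro K(5))
        show "q \<in> polys n" using d(1) Tn by (auto simp: adjoin_polys_in T_Suc)
      qed
      ultimately have "?l ^ N * p \<in> K" unfolding d(4) by (intro K(2))
      moreover have "p \<in> polys n" using Suc.prems(3) Tn by blast
      moreover have "?l ^ N \<in> polys n" using lT Tn by (auto simp: polys_eq intro: polys_in_power)
      ultimately have "p \<in> K"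
        using K(4)[of p "?l ^ N"] poly_eval_I[OF Suc.prems(2) y(1)] ly by simp
      then show ?thesis by (simp add: K_def)
    qed
    then show ?thesis using Hp HI by blast
  qed
qed

text \<open>The coefficients of \<open>G m\<close> do not involve coordinate \<open>m\<close>, so
  the partial derivative in that direction is the univariate one.\<close>

lemma separant:
  assumes m: "m < n" "m \<notin> S" and y: "y \<in> carrier_vec n"
  shows "poly (pderiv (G m)) (Var m) \<notin> I"
    and "poly_eval (partial_deriv m (poly (G m) (Var m))) y = poly_eval (poly (pderiv (G m)) (Var m)) y"
proof -
  interpret minimal_relation "polys_in (T m)" I "Var m" "G m" by (rule G[OF m])
  have ofn: "poly_eval (of_nat k) z = of_nat k" for k z by (induction k) auto
  show "poly (pderiv (G m)) (Var m) \<notin> I"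
  proof (rule separant_not_in)
    fix k :: nat assume "0 < k"
    then show "of_nat k \<notin> I" using nonempty by (auto simp: I_def vanish_def ofn)
  qed
  let ?Q = "map_poly (\<lambda>c. poly_eval c y) (G m)"
  have dy: "dim_vec y = n" using y by simp
  have "map_poly (\<lambda>c. poly_eval c (vec_upd y m s)) (G m) = ?Q" for s
  proof (intro poly_eqI)
    fix i
    have "poly_eval (coeff (G m) i) (vec_upd y m s) = poly_eval (coeff (G m) i) y"
    proof (rule poly_eval_cong)
      show "coeff (G m) i \<in> polys_in (T m)" using G(1) by (simp add: coeffs_in_def)
      fix k assume "k \<in> T m"
      then have "k < n" "k \<noteq> m" using T_subset[of m] m notin_T[OF m(2)] by auto
      then show "vec_upd y m s $ k = y $ k" by (simp add: vec_upd_index dy)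
    qed
    then show "coeff (map_poly (\<lambda>c. poly_eval c (vec_upd y m s)) (G m)) i = coeff ?Q i"
      by (simp add: coeff_map_poly)
  qed
  then have "poly_eval (poly (G m) (Var m)) (vec_upd y m s) = poly ?Q s" for s
    using m dy by (simp add: poly_eval_poly vec_upd_index)
  then have der: "((\<lambda>s. poly_eval (poly (G m) (Var m)) (vec_upd y m s)) has_field_derivative
      poly (pderiv ?Q) (y $ m)) (at (y $ m))"
    by (simp add: poly_DERIV)
  have "poly_eval (partial_deriv m (poly (G m) (Var m))) y = poly (pderiv ?Q) (y $ m)"
    by (rule partial_deriv_eqI[OF _ y m(1) der])
       (use relation_polys(2)[OF m] polys_T[of "Suc m"] m in auto)
  also have "pderiv ?Q = map_poly (\<lambda>c. poly_eval c y) (pderiv (G m))"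
    by (intro poly_eqI) (simp add: coeff_map_poly coeff_pderiv ofn del: of_nat_Suc)
  finally show "poly_eval (partial_deriv m (poly (G m) (Var m))) y = poly_eval (poly (pderiv (G m)) (Var m)) y"
    by (simp add: poly_eval_poly)
qed

end

lemma ideal_generators_member:
  "ideal_generators n V ps \<Longrightarrow> i < length ps \<Longrightarrow> ps ! i \<in> polys n \<and> ps ! i \<in> vanish V"
proof -
  assume h: "ideal_generators n V ps" "i < length ps"
  have "ps ! i = (\<Sum>j<length ps. (if j = i then 1 else 0) * ps ! j)"
  proof -
    have "(\<Sum>j<length ps. (if j = i then 1 else 0) * ps ! j) = (\<Sum>j<length ps. if j = i then ps ! i else 0)"
      by (intro sum.cong) auto
    then show ?thesis using h by simp
  qed
  then have "ps ! i \<in> generated_ideal n ps"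
    unfolding generated_ideal_def by (intro CollectI exI[of _ "\<lambda>j. if j = i then 1 else 0"]) (auto simp: polys_eq)
  then show ?thesis using h by (auto simp: ideal_generators_def vanishing_ideal_eq)
qed

text \<open>A minor of maximal order that is nonzero at \<open>y\<close> is also nonzero at a
  generic point \<open>z\<close>, where every column lies in the span of the
  \<open>n - adim n V\<close> relation gradients. This extends the generic bound to all points,
  singular ones included.\<close>

theorem rank_Dmat_le:
  assumes V: "irreducible_variety n V" and ps: "ideal_generators n V ps" and y: "y \<in> V"
  shows "vec_space.rank n (Dmat n ps y) + adim n V \<le> n"
proof -
  have Vv: "variety n V" "V \<noteq> {}" using V by (auto simp: irreducible_variety_def)
  obtain S where Sw: "S \<subseteq> {..<n}" "indep V S" "card S = adim n V" by (rule adim_witness[OF Vv(2)])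
  interpret coordinate_basis n V S
    using V Sw by (intro coordinate_basis_witness) auto
  let ?k = "vec_space.rank n (Dmat n ps y)"
  obtain f g where fg: "\<And>i. i < ?k \<Longrightarrow> f i < n" "\<And>j. j < ?k \<Longrightarrow> g j < length ps"
    "det (mat ?k ?k (\<lambda>(i, j). Dmat n ps y $$ (f i, g j))) \<noteq> 0"
    using nonzero_minor_of_rank[OF Dmat_carrier order_refl] by metis
  have "polyfun n (\<lambda>z. det (mat ?k ?k (\<lambda>(i, j). Dmat n ps z $$ (f i, g j))))"
    by (rule polyfun_det[where k = ?k]) (use fg in \<open>auto intro!: polyfun_Dmat\<close>)
  then obtain \<mu> where \<mu>: "\<mu> \<in> polys n"
    "\<And>z. z \<in> carrier_vec n \<Longrightarrow> det (mat ?k ?k (\<lambda>(i, j). Dmat n ps z $$ (f i, g j))) = poly_eval \<mu> z"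
    unfolding polyfun_def by blast
  have "\<exists>h. h \<in> polys n \<and> h \<notin> I \<and> (\<forall>y\<in>V. poly_eval h y \<noteq> 0 \<longrightarrow>
      grad n (ps ! i) y \<in> cspan n (relation_grads y))"
    if "i < length ps" for i
    using generic_gradient_span[of n "ps ! i"] ideal_generators_member[OF ps that]
    by (auto simp: I_def T_n polys_eq)
  then obtain h where h: "\<And>i. i < length ps \<Longrightarrow> h i \<notin> I"
    "\<And>i y. i < length ps \<Longrightarrow> y \<in> V \<Longrightarrow> poly_eval (h i) y \<noteq> 0 \<Longrightarrow>
      grad n (ps ! i) y \<in> cspan n (relation_grads y)"
    by metis
  have "poly_eval \<mu> y \<noteq> 0" using \<mu>(2)[of y] fg(3) y carrier by auto
  then have \<mu>I: "\<mu> \<notin> I" using y by (auto simp: I_def vanish_def)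
  obtain z where z: "z \<in> V" "\<And>p. p \<in> insert \<mu> (h ` {..<length ps}) \<Longrightarrow> poly_eval p z \<noteq> 0"
    by (rule irreducible_common_point[OF V, of "insert \<mu> (h ` {..<length ps})"])
       (use h(1) \<mu>I in \<open>auto simp: I_def\<close>)
  have zc: "z \<in> carrier_vec n" using z carrier by auto
  have "?k \<le> vec_space.rank n (Dmat n ps z)"
    by (rule vec_space.rank_ge_minor[OF Dmat_carrier fg(1,2)]) (use z(2) \<mu>(2)[OF zc] in auto)
  also have "\<dots> \<le> card (relation_grads z)"
  proof (rule vec_space.rank_le_card_span[OF Dmat_carrier])
    show "finite (relation_grads z)" "relation_grads z \<subseteq> carrier_vec n" by (auto simp: relation_grads_def)
    show "set (cols (Dmat n ps z)) \<subseteq> cspan n (relation_grads z)"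
    proof
      fix u assume "u \<in> set (cols (Dmat n ps z))"
      then obtain i where "i < length ps" "u = col (Dmat n ps z) i"
        using Dmat_carrier[of n ps z] by (metis carrier_matD(2) cols_length cols_nth in_set_conv_nth)
      then show "u \<in> cspan n (relation_grads z)"
        using h(2)[OF _ z(1)] z(2) by (simp add: col_Dmat)
    qed
  qed
  also have "\<dots> \<le> card ({..<n} - S)" unfolding relation_grads_def by (intro card_image_le) simp
  also have "\<dots> = n - adim n V" using Sw(3) fin_S S by (simp add: card_Diff_subset)
  finally have "?k \<le> n - adim n V" .
  moreover have "adim n V \<le> n" using card_mono[OF _ Sw(1)] Sw(3) by simp
  ultimately show ?thesis by linarith
qed

text \<open>By the product rule, only gradients of generators contribute at a point of
  \<open>V\<close>. Tangency can therefore be exploited with any convenient member of the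
  ideal.\<close>

lemma tangent_generators:
  assumes ps: "ideal_generators n V ps" and y: "y \<in> V" "y \<in> carrier_vec n" and v: "v \<in> carrier_vec n"
    and t: "\<And>j. j < length ps \<Longrightarrow> v \<bullet> col (Dmat n ps y) j = 0"
    and p: "p \<in> polys n" "p \<in> vanish V"
  shows "v \<bullet> grad n p y = 0"
proof -
  have "p \<in> generated_ideal n ps" using ps p by (simp add: ideal_generators_def vanishing_ideal_eq)
  then obtain q where q: "p = (\<Sum>i<length ps. q i * ps ! i)" "\<forall>i<length ps. q i \<in> polys n"
    unfolding generated_ideal_def by blast
  have "k \<le> length ps \<Longrightarrow> (\<Sum>i<k. q i * ps ! i) \<in> polys n \<and> v \<bullet> grad n (\<Sum>i<k. q i * ps ! i) y = 0" for k
  proof (induction k)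
    case 0
    then show ?case using v by (simp add: polys_eq)
  next
    case (Suc k)
    then have k: "k < length ps" by simp
    have pk: "ps ! k \<in> polys n" "poly_eval (ps ! k) y = 0"
      using ideal_generators_member[OF ps k] y by (auto simp: vanish_def)
    have qk: "q k \<in> polys n" using q(2) k by simp
    have qp: "q k * ps ! k \<in> polys n" using pk qk by (auto simp: polys_eq intro: polys_in_mult)
    have "v \<bullet> grad n (ps ! k) y = 0" using t[OF k] k by (simp add: col_Dmat)
    moreover have "grad n (q k * ps ! k) y = 0 \<cdot>\<^sub>v grad n (q k) y + poly_eval (q k) y \<cdot>\<^sub>v grad n (ps ! k) y"
      using grad_mult[OF qk pk(1) y(2)] pk(2) by simp
    ultimately have "v \<bullet> grad n (q k * ps ! k) y = 0"
      using v by (simp add: scalar_prod_add_distrib[OF v])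
    then have "v \<bullet> grad n ((\<Sum>i<k. q i * ps ! i) + q k * ps ! k) y = 0"
      using Suc qp v y by (simp add: grad_add scalar_prod_add_distrib[OF v])
    moreover have "(\<Sum>i<k. q i * ps ! i) + q k * ps ! k \<in> polys n"
      using Suc qp by (auto simp: polys_eq intro: polys_in_add)
    ultimately show ?case by simp
  qed
  from this[of "length ps"] show ?thesis using q(1) by simp
qed

text \<open>The gradients of the relations form a triangular system outside \<open>S\<close> with
  the separants on the diagonal. Where these are nonzero, a tangent vector is determined by its
  entries in \<open>S\<close>.\<close>

theorem generic_rank_Dmat_ge:
  assumes V: "irreducible_variety n V" and ps: "ideal_generators n V ps"
  obtains y where "y \<in> V" "n \<le> vec_space.rank n (Dmat n ps y) + adim n V"
proof -
  have Vv: "variety n V" "V \<noteq> {}" using V by (auto simp: irreducible_variety_def)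
  obtain S where Sw: "S \<subseteq> {..<n}" "indep V S" "card S = adim n V" by (rule adim_witness[OF Vv(2)])
  interpret coordinate_basis n V S
    using V Sw by (intro coordinate_basis_witness) auto
  let ?sep = "\<lambda>m. poly (pderiv (G m)) (Var m)"
  obtain y where y: "y \<in> V" "\<And>p. p \<in> ?sep ` ({..<n} - S) \<Longrightarrow> poly_eval p y \<noteq> 0"
  proof (rule irreducible_common_point[OF V, of "?sep ` ({..<n} - S)"])
    show "p \<notin> vanish V" if "p \<in> ?sep ` ({..<n} - S)" for p
      using that separant(1)[OF _ _ zero_carrier_vec] by (auto simp: I_def)
  qed auto
  have yc: "y \<in> carrier_vec n" using y carrier by auto
  have "n \<le> vec_space.rank n (Dmat n ps y) + card S"
  proof (rule vec_space.trivial_left_kernel_rank[OF Dmat_carrier Sw(1)])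
    fix v :: "complex vec"
    assume v: "v \<in> carrier_vec n" and t: "\<And>j. j < length ps \<Longrightarrow> v \<bullet> col (Dmat n ps y) j = 0"
      and vS: "\<And>i. i \<in> S \<Longrightarrow> v $ i = 0"
    have "m < n \<Longrightarrow> v $ m = 0" for m
    proof (induction m rule: less_induct)
      case (less m)
      show ?case
      proof (cases "m \<in> S")
        case False
        let ?g = "poly (G m) (Var m)"
        have g: "?g \<in> I" "?g \<in> polys_in (T (Suc m))" using relation_polys[OF less.prems False] by auto
        have "?g \<in> polys n" using g(2) polys_T[of "Suc m"] less.prems by auto
        then have "0 = v \<bullet> grad n ?g y"
          using tangent_generators[OF ps y(1) yc v t, of ?g] g(1) by (simp add: I_def)
        also have "\<dots> = (\<Sum>i<n. v $ i * poly_eval (partial_deriv i ?g) y)"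
          by (simp add: scalar_prod_def grad_def lessThan_atLeast0)
        \<comment> \<open>Entries with \<open>i < m\<close> vanish by induction and those in
          \<open>S\<close> by assumption; the relation does not involve any other coordinate beyond
          \<open>m\<close>.\<close>
        also have "\<dots> = (\<Sum>i<n. if i = m then v $ m * poly_eval (partial_deriv m ?g) y else 0)"
        proof (intro sum.cong refl)
          fix i assume i: "i \<in> {..<n}"
          show "v $ i * poly_eval (partial_deriv i ?g) y = (if i = m then v $ m * poly_eval (partial_deriv m ?g) y else 0)"
          proof (cases "i = m \<or> i < m \<or> i \<in> S")
            case True
            then show ?thesis using less.IH i vS by auto
          next
            case F: False
            then have "i \<notin> T (Suc m)" by (auto simp: T_def)
            then show ?thesis using partial_deriv_Var_not_in[OF g(2)] F by auto
          qed
        qed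
        also have "\<dots> = v $ m * poly_eval (?sep m) y"
          using less.prems separant(2)[OF less.prems False yc] by simp
        finally show ?thesis using y(2) less.prems False by auto
      qed (simp add: vS)
    qed
    then show "v = 0\<^sub>v n" using v by (intro eq_vecI) auto
  qed
  then show thesis using that[OF y(1)] Sw(3) by simp
qed

section \<open>Pairs of points\<close>

definition fstv :: "nat \<Rightarrow> complex vec \<Rightarrow> complex vec" where
  "fstv n w = vec n (\<lambda>i. w $ i)"

definition sndv :: "nat \<Rightarrow> complex vec \<Rightarrow> complex vec" where
  "sndv n w = vec n (\<lambda>i. w $ (n + i))"

lemma fstv_carrier [simp]: "fstv n w \<in> carrier_vec n" and sndv_carrier [simp]: "sndv n w \<in> carrier_vec n"
  by (auto simp: fstv_def sndv_def)

lemma dim_fstv [simp]: "dim_vec (fstv n w) = n" and dim_sndv [simp]: "dim_vec (sndv n w) = n"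
  by (auto simp: fstv_def sndv_def)

lemma fstv_index [simp]: "i < n \<Longrightarrow> fstv n w $ i = w $ i"
  and sndv_index [simp]: "i < n \<Longrightarrow> sndv n w $ i = w $ (n + i)"
  by (auto simp: fstv_def sndv_def)

lemma append_carrier2:
  "x \<in> carrier_vec n \<Longrightarrow> y \<in> carrier_vec n \<Longrightarrow> x @\<^sub>v y \<in> carrier_vec (2 * n)"
  using append_carrier_vec[of x n y n] by (simp add: mult_2)

lemma append_index:
  assumes "x \<in> carrier_vec n" "y \<in> carrier_vec n" "i < n"
  shows "(x @\<^sub>v y) $ i = x $ i" "(x @\<^sub>v y) $ (n + i) = y $ i"
  using assms by auto

lemma fstv_append [simp]: "x \<in> carrier_vec n \<Longrightarrow> y \<in> carrier_vec n \<Longrightarrow> fstv n (x @\<^sub>v y) = x"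
  and sndv_append [simp]: "x \<in> carrier_vec n \<Longrightarrow> y \<in> carrier_vec n \<Longrightarrow> sndv n (x @\<^sub>v y) = y"
  by (auto simp: fstv_def sndv_def)

lemma append_fstv_sndv: "w \<in> carrier_vec (2 * n) \<Longrightarrow> fstv n w @\<^sub>v sndv n w = w"
  by (intro eq_vecI) (auto simp: fstv_def sndv_def)

lemma vec_prod_eq:
  "B \<subseteq> carrier_vec n \<Longrightarrow> vec_prod (carrier_vec n) B = {w \<in> carrier_vec (2 * n). sndv n w \<in> B}"
proof (intro equalityI subsetI)
  assume B: "B \<subseteq> carrier_vec n"
  fix w
  show "w \<in> {w \<in> carrier_vec (2 * n). sndv n w \<in> B}" if "w \<in> vec_prod (carrier_vec n) B"
    using that B by (auto simp: vec_prod_def subset_iff intro: append_carrier2)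
  show "w \<in> vec_prod (carrier_vec n) B" if "w \<in> {w \<in> carrier_vec (2 * n). sndv n w \<in> B}"
    using that append_fstv_sndv[of w n] unfolding vec_prod_def
    by (intro CollectI exI[of _ "fstv n w"] exI[of _ "sndv n w"]) auto
qed

lemma polyfun_append:
  assumes "\<And>z. z \<in> carrier_vec N \<Longrightarrow> f z \<in> carrier_vec n" "\<And>z. z \<in> carrier_vec N \<Longrightarrow> g z \<in> carrier_vec n"
    and "\<And>i. i < n \<Longrightarrow> polyfun N (\<lambda>z. f z $ i)" "\<And>i. i < n \<Longrightarrow> polyfun N (\<lambda>z. g z $ i)"
    and i: "i < 2 * n"
  shows "polyfun N (\<lambda>z. (f z @\<^sub>v g z) $ i)"
proof (cases "i < n")
  case True
  from assms(3)[OF this] show ?thesis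
    by (rule polyfun_cong) (simp add: append_index(1)[OF assms(1,2) True])
next
  case False
  then have j: "i - n < n" "n + (i - n) = i" using i by auto
  from assms(4)[OF j(1)] show ?thesis
    by (rule polyfun_cong) (use append_index(2)[OF assms(1,2) j(1)] j(2) in simp)
qed

lemma polyfun_poly_eval_sndv: "p \<in> polys n \<Longrightarrow> polyfun N (\<lambda>w. poly_eval p (sndv n w))"
  by (rule polyfun_compose) (auto simp: polyfun_index)

lemma variety_cylinder:
  assumes "variety n B"
  shows "variety (2 * n) {w \<in> carrier_vec (2 * n). sndv n w \<in> B}"
proof -
  obtain P where P: "P \<subseteq> polys n" "B = zero_set n P" using assms unfolding variety_iff by blast
  have "variety (2 * n) {w \<in> carrier_vec (2 * n). \<forall>f \<in> (\<lambda>p w. poly_eval p (sndv n w)) ` P. f w = 0}"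
    by (rule variety_polyfun) (use P polyfun_poly_eval_sndv in auto)
  then show ?thesis using P by (simp add: zero_set_def)
qed

lemma variety_minors_vanish:
  assumes V: "variety N V" and M: "\<And>w. M w \<in> carrier_mat n m"
    and pf: "\<And>i j. i < n \<Longrightarrow> j < m \<Longrightarrow> polyfun N (\<lambda>w. M w $$ (i, j))"
  shows "variety N {w \<in> V. minors_vanish k (M w)}"
proof -
  let ?F = "{(\<lambda>w. det (submatrix (M w) I J)) | I J. I \<subseteq> {..<n} \<and> J \<subseteq> {..<m} \<and> card I = k \<and> card J = k}"
  have "variety N {w \<in> V. \<forall>f\<in>?F. f w = 0}"
  proof (rule variety_polyfun_Int[OF V])
    fix f assume "f \<in> ?F"
    then obtain I J where f: "f = (\<lambda>w. det (submatrix (M w) I J))"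
      and IJ: "I \<subseteq> {..<n}" "J \<subseteq> {..<m}" "card I = k" "card J = k" by blast
    have c: "{i. i < n \<and> i \<in> I} = I" "{j. j < m \<and> j \<in> J} = J" using IJ by auto
    have S: "submatrix (M w) I J = mat k k (\<lambda>(i, j). M w $$ (pick I i, pick J j))" for w
      using M[of w] c IJ by (auto simp: submatrix_def)
    show "polyfun N f"
      unfolding f S
    proof (rule polyfun_det[where k = k])
      fix i j assume ij: "i < k" "j < k"
      have "pick I i < n" "pick J j < m" using pick_le[of i n I] pick_le[of j m J] ij c IJ by auto
      then show "polyfun N (\<lambda>w. mat k k (\<lambda>(i, j). M w $$ (pick I i, pick J j)) $$ (i, j))"
        using pf ij by simp
    qed simp
  qed
  moreover have "(\<forall>f\<in>?F. f w = 0) \<longleftrightarrow> minors_vanish k (M w)" for w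
    using M[of w] unfolding minors_vanish_def by auto
  ultimately show ?thesis by simp
qed

lemma variety_empty: "variety n {}"
  using variety_polyfun[of "{\<lambda>_. 1}" n] polyfun_const by auto

section \<open>Images of irreducible families\<close>

text \<open>Pick a point of the variety first, then move along a line of parameters.\<close>

lemma irreducible_family:
  assumes V: "irreducible_variety n V" and Z: "variety n Z" "V - Z \<noteq> {}"
    and \<Phi>: "\<And>t y. t \<in> carrier_vec m \<Longrightarrow> y \<in> V \<Longrightarrow> \<Phi> t y \<in> carrier_vec N"
    and py: "\<And>t i. i < N \<Longrightarrow> t \<in> carrier_vec m \<Longrightarrow> polyfun n (\<lambda>y. \<Phi> t y $ i)"
    and pt: "\<And>y i. i < N \<Longrightarrow> y \<in> V \<Longrightarrow> polyfun m (\<lambda>t. \<Phi> t y $ i)"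
  shows "irreducible_variety N (zariski_closure N {\<Phi> t y | t y. t \<in> carrier_vec m \<and> y \<in> V - Z})"
    (is "irreducible_variety N (zariski_closure N ?S)")
proof (rule irreducible_zariski_closure)
  have Vc: "V \<subseteq> carrier_vec n" using V variety_carrier by (auto simp: irreducible_variety_def)
  show "?S \<subseteq> carrier_vec N" using \<Phi> by auto
  obtain y0 where y0: "y0 \<in> V" "y0 \<notin> Z" using Z(2) by blast
  have "\<Phi> (0\<^sub>v m) y0 \<in> ?S" using y0 zero_carrier_vec by blast
  then show "?S \<noteq> {}" by blast
  fix p q assume p: "p \<in> polys N" and q: "q \<in> polys N" and pq: "p * q \<in> vanish ?S"
  show "p \<in> vanish ?S \<or> q \<in> vanish ?S"
  proof (rule ccontr)
    assume neg: "\<not> (p \<in> vanish ?S \<or> q \<in> vanish ?S)"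
    then obtain t1 y1 where 1: "t1 \<in> carrier_vec m" "y1 \<in> V" "poly_eval p (\<Phi> t1 y1) \<noteq> 0"
      by (auto simp: vanish_def)
    obtain t2 y2 where 2: "t2 \<in> carrier_vec m" "y2 \<in> V" "poly_eval q (\<Phi> t2 y2) \<noteq> 0"
      using neg by (auto simp: vanish_def)
    have "polyfun n (\<lambda>y. poly_eval p (\<Phi> t1 y))" by (rule polyfun_compose[OF p py[OF _ 1(1)]])
    then obtain P where P: "\<And>y. y \<in> carrier_vec n \<Longrightarrow> poly_eval p (\<Phi> t1 y) = poly_eval P y"
      unfolding polyfun_def by blast
    have "polyfun n (\<lambda>y. poly_eval q (\<Phi> t2 y))" by (rule polyfun_compose[OF q py[OF _ 2(1)]])
    then obtain Q where Q: "\<And>y. y \<in> carrier_vec n \<Longrightarrow> poly_eval q (\<Phi> t2 y) = poly_eval Q y"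
      unfolding polyfun_def by blast
    \<comment> \<open>\<open>\<mu>\<close> vanishes on \<open>Z\<close>, so a point where it is
      nonzero is an admissible base point.\<close>
    have "\<exists>\<mu>\<in>polys n. \<mu> \<in> vanish Z \<and> poly_eval \<mu> y0 \<noteq> 0"
      using variety_memI[OF Z(1), of y0] y0 Vc by blast
    then obtain \<mu> where \<mu>: "\<mu> \<in> vanish Z" "poly_eval \<mu> y0 \<noteq> 0" by blast
    have "poly_eval P y1 \<noteq> 0" using 1 P[of y1] Vc by auto
    then have "P \<notin> vanish V" using 1 by (auto simp: vanish_def)
    moreover have "poly_eval Q y2 \<noteq> 0" using 2 Q[of y2] Vc by auto
    then have "Q \<notin> vanish V" using 2 by (auto simp: vanish_def)
    moreover have "\<mu> \<notin> vanish V" using \<mu> y0 by (auto simp: vanish_def)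
    ultimately obtain y where y: "y \<in> V" "\<And>h. h \<in> {P, Q, \<mu>} \<Longrightarrow> poly_eval h y \<noteq> 0"
      by (elim irreducible_common_point[OF V, rotated 2, of "{P, Q, \<mu>}"]) auto
    have yZ: "y \<in> V - Z" using y \<mu>(1) by (auto simp: vanish_def)
    have yc: "y \<in> carrier_vec n" using y Vc by auto
    have "polyfun m (\<lambda>t. poly_eval p (\<Phi> t y))" by (rule polyfun_compose[OF p pt[OF _ y(1)]])
    then obtain P' where P': "P' \<in> polys m" "\<And>t. t \<in> carrier_vec m \<Longrightarrow> poly_eval p (\<Phi> t y) = poly_eval P' t"
      unfolding polyfun_def by blast
    have "polyfun m (\<lambda>t. poly_eval q (\<Phi> t y))" by (rule polyfun_compose[OF q pt[OF _ y(1)]])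
    then obtain Q' where Q': "Q' \<in> polys m" "\<And>t. t \<in> carrier_vec m \<Longrightarrow> poly_eval q (\<Phi> t y) = poly_eval Q' t"
      unfolding polyfun_def by blast
    have "poly_eval P' t1 \<noteq> 0" using y(2)[of P] P[OF yc] P'(2)[OF 1(1)] by simp
    moreover have "poly_eval Q' t2 \<noteq> 0" using y(2)[of Q] Q[OF yc] Q'(2)[OF 2(1)] by simp
    \<comment> \<open>The base point \<open>y\<close> now serves both polynomials; only the
      parameters \<open>t1\<close> and \<open>t2\<close> still differ.\<close>
    ultimately have "\<exists>s. poly_eval P' (vec m (\<lambda>i. t1 $ i + s * (t2 $ i - t1 $ i))) \<noteq> 0 \<and>
        poly_eval Q' (vec m (\<lambda>i. t1 $ i + s * (t2 $ i - t1 $ i))) \<noteq> 0"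
      by (rule common_nonzero_on_line[OF P'(1) Q'(1) 1(1) 2(1)])
    then obtain t where t: "t \<in> carrier_vec m" "poly_eval P' t \<noteq> 0" "poly_eval Q' t \<noteq> 0"
      using vec_carrier by blast
    have "\<Phi> t y \<in> ?S" using t yZ by blast
    then have "poly_eval (p * q) (\<Phi> t y) = 0" using pq unfolding vanish_def by blast
    then show False using t P'(2)[OF t(1)] Q'(2)[OF t(1)] by simp
  qed
qed

text \<open>A component of \<open>\<complex>\<^sup>n \<times> B\<close> is invariant under translation of the first factor.\<close>

lemma adim_cylinder_component:
  assumes B: "variety n B" and W: "W \<in> irreducible_components (2 * n) (vec_prod (carrier_vec n) B)"
  shows "n \<le> adim (2 * n) W"
proof -
  let ?C = "{w \<in> carrier_vec (2 * n). sndv n w \<in> B}"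
  have C: "vec_prod (carrier_vec n) B = ?C" by (rule vec_prod_eq[OF variety_carrier[OF B]])
  have Wirr: "irreducible_variety (2 * n) W" and WC: "W \<subseteq> ?C"
    and Wmax: "\<And>W'. irreducible_variety (2 * n) W' \<Longrightarrow> W \<subseteq> W' \<Longrightarrow> W' \<subseteq> ?C \<Longrightarrow> W' = W"
    using W by (auto simp: irreducible_components_def C)
  define \<Phi> where "\<Phi> = (\<lambda>t w. (t + fstv n w) @\<^sub>v sndv n w)"
  let ?S = "{\<Phi> t w | t w. t \<in> carrier_vec n \<and> w \<in> W - {}}"
  have \<Phi>c: "\<Phi> t w \<in> carrier_vec (2 * n)" if "t \<in> carrier_vec n" for t w
    unfolding \<Phi>_def using that by (intro append_carrier2) auto
  have \<Phi>1: "\<Phi> t w $ i = t $ i + w $ i" if "t \<in> carrier_vec n" "i < n" for t w i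
    using append_index(1)[of "t + fstv n w" n "sndv n w" i] that by (simp add: \<Phi>_def)
  have irr: "irreducible_variety (2 * n) (zariski_closure (2 * n) ?S)"
  \<comment> \<open>Nothing is removed from \<open>W\<close>; the difference with the empty set only
    fits the shape of the family.\<close>
  proof (rule irreducible_family[OF Wirr variety_empty])
    show "W - {} \<noteq> {}" using Wirr by (auto simp: irreducible_variety_def)
    show "\<Phi> t w \<in> carrier_vec (2 * n)" if "t \<in> carrier_vec n" for t w using \<Phi>c that .
    have ix: "(t + fstv n w) $ i = t $ i + w $ i" if "i < n" for t w i
      using that by simp
    show "polyfun (2 * n) (\<lambda>w. \<Phi> t w $ i)" if "i < 2 * n" "t \<in> carrier_vec n" for t i
      unfolding \<Phi>_def using that
      by (intro polyfun_append) (simp_all add: ix polyfun_add polyfun_index polyfun_const)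
    show "polyfun n (\<lambda>t. \<Phi> t w $ i)" if "i < 2 * n" for w i
      unfolding \<Phi>_def using that
      by (intro polyfun_append) (simp_all add: ix polyfun_add polyfun_index polyfun_const)
  qed
  have SC: "?S \<subseteq> ?C"
    using WC by (auto simp: \<Phi>c) (auto simp: \<Phi>_def subset_iff)
  have "W \<subseteq> ?S"
  proof
    fix w assume w: "w \<in> W"
    then have "w \<in> carrier_vec (2 * n)" using WC by auto
    then have "w = \<Phi> (0\<^sub>v n) w" using append_fstv_sndv[of w n] by (simp add: \<Phi>_def)
    then show "w \<in> ?S" using w zero_carrier_vec by blast
  qed
  then have "W \<subseteq> zariski_closure (2 * n) ?S" using zariski_closure_superset[of ?S "2 * n"] by blast
  moreover have "zariski_closure (2 * n) ?S \<subseteq> ?C"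
    by (rule zariski_closure_minimal[OF variety_cylinder[OF B] SC])
  \<comment> \<open>Maximality of the component forces every translate of a point of
    \<open>W\<close> back into \<open>W\<close>, so first components of points of \<open>W\<close>
    can be prescribed freely.\<close>
  ultimately have eq: "zariski_closure (2 * n) ?S = W" using Wmax irr by blast
  obtain w0 where w0: "w0 \<in> W" using Wirr by (auto simp: irreducible_variety_def)
  have "indep W {..<n}"
    unfolding indep_def
  proof (rule ccontr)
    assume "\<not> polys_in {..<n} \<inter> vanish W \<subseteq> {0}"
    then obtain p where p: "p \<in> polys_in {..<n}" "p \<in> vanish W" "p \<noteq> 0" by blast
    obtain a where a: "a \<in> carrier_vec n" "poly_eval p a \<noteq> 0"
      using nonzero_polynomial_nonzero_value[OF _ p(1,3), of n] by blast
    let ?t = "a - fstv n w0"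
    have t: "?t \<in> carrier_vec n" using a by simp
    have "\<Phi> ?t w0 \<in> ?S" using t w0 by blast
    then have "\<Phi> ?t w0 \<in> W" using eq zariski_closure_superset[of ?S "2 * n"] by blast
    then have "poly_eval p (\<Phi> ?t w0) = 0" using p(2) by (simp add: vanish_def)
    moreover have "poly_eval p (\<Phi> ?t w0) = poly_eval p a"
      using p(1) by (rule poly_eval_cong) (use t in \<open>auto simp: \<Phi>1\<close>)
    ultimately show False using a by simp
  qed
  then have "card {..<n} \<le> adim (2 * n) W" by (intro adim_ge) auto
  then show ?thesis by simp
qed

text \<open>Laplace expansion along the last column, whose cofactors do not see \<open>z\<close>. It
  exhibits a bordered minor as linear in the bordering column and identifies the coefficient of the
  last entry.\<close>

lemma det_last_column:
  fixes a :: "nat \<Rightarrow> nat \<Rightarrow> 'a::comm_ring_1"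
  shows "\<exists>c. c r = det (mat r r (\<lambda>(i, j). a i j)) \<and>
    (\<forall>z. det (mat (Suc r) (Suc r) (\<lambda>(i, j). if j < r then a i j else z i)) = (\<Sum>i<Suc r. z i * c i))"
proof -
  let ?M = "\<lambda>z. mat (Suc r) (Suc r) (\<lambda>(i, j). if j < r then a i j else z i)"
  \<comment> \<open>Deleting column \<open>r\<close> removes \<open>z\<close>, so all cofactors can
    be taken at \<open>z = 0\<close>.\<close>
  have del: "mat_delete (?M z) i r = mat_delete (?M (\<lambda>_. 0)) i r" for z i
    by (rule eq_matI) (simp_all add: mat_delete_def)
  have "mat_delete (?M (\<lambda>_. 0)) r r = mat r r (\<lambda>(i, j). a i j)"
    by (rule eq_matI) (simp_all add: mat_delete_def)
  then have "cofactor (?M (\<lambda>_. 0)) r r = det (mat r r (\<lambda>(i, j). a i j))"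
    by (simp add: cofactor_def)
  moreover have "det (?M z) = (\<Sum>i<Suc r. z i * cofactor (?M (\<lambda>_. 0)) i r)" for z
  proof -
    have "det (?M z) = (\<Sum>i<Suc r. ?M z $$ (i, r) * cofactor (?M z) i r)"
      by (rule laplace_expansion_column) auto
    also have "\<dots> = (\<Sum>i<Suc r. z i * cofactor (?M (\<lambda>_. 0)) i r)"
      unfolding cofactor_def del[of z] by simp
    finally show ?thesis .
  qed
  ultimately show ?thesis by (intro exI[of _ "\<lambda>i. cofactor (?M (\<lambda>_. 0)) i r"]) blast
qed

lemma solve_linear_system:
  fixes B :: "'a::field mat"
  assumes B: "B \<in> carrier_mat r r" "det B \<noteq> 0" and b: "b \<in> carrier_vec r"
  shows "\<exists>s\<in>carrier_vec r. B *\<^sub>v s = b"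
proof
  let ?s = "inverse (det B) \<cdot>\<^sub>v (adj_mat B *\<^sub>v b)"
  note adj = adj_mat[OF B(1)]
  show "?s \<in> carrier_vec r" using adj(1) b by simp
  have "B *\<^sub>v ?s = inverse (det B) \<cdot>\<^sub>v (B *\<^sub>v (adj_mat B *\<^sub>v b))"
    using B adj(1) b by (intro mult_mat_vec) auto
  also have "B *\<^sub>v (adj_mat B *\<^sub>v b) = (B * adj_mat B) *\<^sub>v b"
    using assoc_mult_mat_vec[OF B(1) adj(1) b] by simp
  also have "\<dots> = det B \<cdot>\<^sub>v b"
    unfolding adj(2)
  proof (rule eq_vecI)
    fix i assume "i < dim_vec (det B \<cdot>\<^sub>v b)"
    then have i: "i < r" using b by simp
    have "det B * (if j = i then 1 else 0) * b $ j = (if j = i then det B * b $ i else 0)" for j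
      by simp
    then show "((det B \<cdot>\<^sub>m 1\<^sub>m r) *\<^sub>v b) $ i = (det B \<cdot>\<^sub>v b) $ i"
      using i b by (simp add: scalar_prod_def)
  qed (use b in simp)
  also have "inverse (det B) \<cdot>\<^sub>v (det B \<cdot>\<^sub>v b) = b"
    using B(2) b by (intro eq_vecI) auto
  finally show "B *\<^sub>v ?s = b" .
qed

lemma sum_lessThan_add:
  fixes f :: "nat \<Rightarrow> 'a::comm_monoid_add"
  shows "(\<Sum>i<n + m. f i) = (\<Sum>i<n. f i) + (\<Sum>i<m. f (n + i))"
  by (induction m) (auto simp: add.assoc)

section \<open>The correspondences of a variety\<close>

locale generated_variety =
  fixes n d :: nat and V :: "complex vec set" and ps :: "cpoly list"
  assumes irr: "irreducible_variety n V" and gens: "ideal_generators n V ps"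
    and dim: "variety_dim n V = enat d"
begin

abbreviation D where "D y \<equiv> Dmat n ps y"

abbreviation rk where "rk y \<equiv> vec_space.rank n (D y)"

abbreviation Reg where "Reg \<equiv> V - Sing n V ps"

definition r where "r = n - d"

definition bordered where
  "bordered w = mat_of_cols n (cols (D (sndv n w)) @ [fstv n w - sndv n w])"

definition \<Phi> where "\<Phi> t y = (y + D y *\<^sub>v t) @\<^sub>v y"

lemma var: "variety n V" and nonempty: "V \<noteq> {}" and carrier: "y \<in> V \<Longrightarrow> y \<in> carrier_vec n"
  using irr variety_carrier by (auto simp: irreducible_variety_def)

lemma adim_V: "adim n V = d"
  using variety_dim_eq_adim[OF irr] dim by simp

lemma d_le: "d \<le> n"
proof -
  obtain S where "S \<subseteq> {..<n}" "indep V S" "card S = adim n V" by (rule adim_witness[OF nonempty])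
  then show ?thesis using card_mono[of "{..<n}" S] adim_V by simp
qed

lemma rank_le: "y \<in> V \<Longrightarrow> rk y \<le> r"
  using rank_Dmat_le[OF irr gens, of y] d_le by (simp add: adim_V r_def)

lemma Sing_eq: "Sing n V ps = {y \<in> V. rk y < r}"
  by (simp add: Sing_def dim r_def)

lemma rank_regular: "y \<in> Reg \<Longrightarrow> rk y = r"
  using rank_le[of y] by (auto simp: Sing_eq)

lemma regular_exists:
  obtains y where "y \<in> Reg"
proof -
  obtain y where "y \<in> V" "n \<le> rk y + d"
    by (rule generic_rank_Dmat_ge[OF irr gens]) (simp add: adim_V)
  then have "y \<in> Reg" by (auto simp: Sing_eq r_def)
  then show thesis by (rule that)
qed

lemma variety_Sing: "variety n (Sing n V ps)"
proof -
  have "Sing n V ps = {y \<in> V. minors_vanish r (D y)}"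
    by (simp add: Sing_eq minors_vanish_iff_rank[OF Dmat_carrier])
  then show ?thesis
    using variety_minors_vanish[OF var, of D n "length ps" r] polyfun_Dmat by simp
qed

lemma Sing_subset: "Sing n V ps \<subseteq> V"
  by (auto simp: Sing_def)

lemma bordered_carrier: "bordered w \<in> carrier_mat n (Suc (length ps))"
  using rank_append_column(1)[OF Dmat_carrier, of "fstv n w - sndv n w" n ps "sndv n w"]
  by (simp add: bordered_def)

lemma bordered_index:
  assumes "i < n"
  shows "j < length ps \<Longrightarrow> bordered w $$ (i, j) = D (sndv n w) $$ (i, j)"
    and "bordered w $$ (i, length ps) = w $ i - w $ (n + i)"
proof -
  have c: "length (cols (D (sndv n w))) = length ps" by (simp add: Dmat_def)
  show "bordered w $$ (i, j) = D (sndv n w) $$ (i, j)" if "j < length ps"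
    unfolding bordered_def using assms that c Dmat_carrier[of n ps "sndv n w"]
    by (subst mat_of_cols_index) (auto simp: nth_append)
  show "bordered w $$ (i, length ps) = w $ i - w $ (n + i)"
    unfolding bordered_def using assms c
    by (subst mat_of_cols_index) (auto simp: nth_append)
qed

section \<open>Rank descriptions of the correspondences\<close>

lemma Sigma1_eq:
  "Sigma1 n V ps = {w \<in> carrier_vec (2 * n). sndv n w \<in> V \<and> minors_vanish (Suc r) (bordered w)}"
proof (intro equalityI subsetI)
  fix w assume "w \<in> Sigma1 n V ps"
  then obtain x y where h: "w = x @\<^sub>v y" "x \<in> carrier_vec n" "y \<in> V"
    "minors_vanish (Suc r) (mat_of_cols n (cols (D y) @ [x - y]))"
    by (auto simp: Sigma1_def dim r_def)
  then show "w \<in> {w \<in> carrier_vec (2 * n). sndv n w \<in> V \<and> minors_vanish (Suc r) (bordered w)}"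
    using append_carrier2[OF h(2) carrier[OF h(3)]] carrier[OF h(3)] by (simp add: bordered_def)
next
  fix w assume w: "w \<in> {w \<in> carrier_vec (2 * n). sndv n w \<in> V \<and> minors_vanish (Suc r) (bordered w)}"
  then have "w = fstv n w @\<^sub>v sndv n w" using append_fstv_sndv by auto
  then show "w \<in> Sigma1 n V ps"
    unfolding Sigma1_def using w
    by (intro CollectI exI[of _ "fstv n w"] exI[of _ "sndv n w"]) (simp add: bordered_def dim r_def)
qed

lemma Sigma0_eq:
  "Sigma0 n V ps = {w \<in> carrier_vec (2 * n). sndv n w \<in> Reg \<and>
     fstv n w - sndv n w \<in> vec_space.col_space n (D (sndv n w))}"
proof (intro equalityI subsetI)
  fix w assume "w \<in> Sigma0 n V ps"
  then obtain x y u where h: "w = x @\<^sub>v y" "x \<in> carrier_vec n" "y \<in> Reg"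
    "u \<in> vec_space.col_space n (D y)" "x = y + u"
    by (auto simp: Sigma0_def)
  have "y \<in> carrier_vec n" using h carrier by blast
  moreover have "u \<in> carrier_vec n"
    using h(4) vec_space.col_space_eq[OF Dmat_carrier] by (auto simp: Dmat_def)
  then have "x - y = u" unfolding h(5) using \<open>y \<in> carrier_vec n\<close> by (intro eq_vecI) auto
  ultimately show "w \<in> {w \<in> carrier_vec (2 * n). sndv n w \<in> Reg \<and>
     fstv n w - sndv n w \<in> vec_space.col_space n (D (sndv n w))}"
    using h append_carrier2[OF h(2), of y] by simp
next
  fix w assume w: "w \<in> {w \<in> carrier_vec (2 * n). sndv n w \<in> Reg \<and>
     fstv n w - sndv n w \<in> vec_space.col_space n (D (sndv n w))}"
  then have "w = fstv n w @\<^sub>v sndv n w" using append_fstv_sndv by auto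
  moreover have "fstv n w = sndv n w + (fstv n w - sndv n w)" by (intro eq_vecI) auto
  ultimately show "w \<in> Sigma0 n V ps"
    unfolding Sigma0_def using w fstv_carrier by blast
qed

lemma Sigma0_param: "Sigma0 n V ps = {\<Phi> t y | t y. t \<in> carrier_vec (length ps) \<and> y \<in> Reg}"
proof (intro equalityI subsetI)
  fix w assume "w \<in> Sigma0 n V ps"
  then obtain x y u where h: "w = x @\<^sub>v y" "x \<in> carrier_vec n" "y \<in> Reg"
    "u \<in> vec_space.col_space n (D y)" "x = y + u"
    by (auto simp: Sigma0_def)
  then obtain t where "t \<in> carrier_vec (length ps)" "u = D y *\<^sub>v t"
    using vec_space.col_space_eq[OF Dmat_carrier, of n ps y] by (auto simp: Dmat_def)
  then show "w \<in> {\<Phi> t y | t y. t \<in> carrier_vec (length ps) \<and> y \<in> Reg}"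
    using h unfolding \<Phi>_def by blast
next
  fix w assume "w \<in> {\<Phi> t y | t y. t \<in> carrier_vec (length ps) \<and> y \<in> Reg}"
  then obtain t y where h: "w = (y + D y *\<^sub>v t) @\<^sub>v y" "t \<in> carrier_vec (length ps)" "y \<in> Reg"
    unfolding \<Phi>_def by blast
  have c: "D y *\<^sub>v t \<in> carrier_vec n" using h mult_mat_vec_carrier[OF Dmat_carrier] by blast
  moreover have "D y *\<^sub>v t \<in> vec_space.col_space n (D y)"
    unfolding vec_space.col_space_eq[OF Dmat_carrier] dim_Dmat using c h(2) by blast
  moreover have "y \<in> carrier_vec n" using h(3) carrier by blast
  ultimately show "w \<in> Sigma0 n V ps"
    unfolding Sigma0_def using h
    by (intro CollectI exI[of _ "y + D y *\<^sub>v t"] exI[of _ y] conjI bexI[of _ "D y *\<^sub>v t"]) auto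
qed

lemma Sigma0_carrier: "Sigma0 n V ps \<subseteq> carrier_vec (2 * n)"
  by (auto simp: Sigma0_eq)

lemma variety_Sigma1: "variety (2 * n) (Sigma1 n V ps)"
proof -
  have "variety (2 * n) {w \<in> {w \<in> carrier_vec (2 * n). sndv n w \<in> V}. minors_vanish (Suc r) (bordered w)}"
  proof (rule variety_minors_vanish[OF variety_cylinder[OF var] bordered_carrier])
    fix i j assume i: "i < n" and j: "j < Suc (length ps)"
    show "polyfun (2 * n) (\<lambda>w. bordered w $$ (i, j))"
    proof (cases "j < length ps")
      case True
      have "ps ! j \<in> polys n" using ideal_generators_member[OF gens True] by blast
      then have "partial_deriv i (ps ! j) \<in> polys n" by (simp add: polys_eq polys_in_partial_deriv)
      then show ?thesis
        using polyfun_poly_eval_sndv i True by (simp add: bordered_index Dmat_def)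
    next
      case False
      then have "j = length ps" using j by simp
      then show ?thesis
        using i by (simp add: bordered_index polyfun_diff polyfun_index)
    qed
  qed
  moreover have "Sigma1 n V ps = {w \<in> {w \<in> carrier_vec (2 * n). sndv n w \<in> V}. minors_vanish (Suc r) (bordered w)}"
    by (auto simp: Sigma1_eq)
  ultimately show ?thesis by simp
qed

text \<open>The rank of \<open>D\<close> never exceeds \<open>r\<close> on \<open>V\<close>.
  Bordering raises it above \<open>r\<close> exactly when it equals \<open>r\<close> and the new
  column leaves the column space.\<close>

lemma minors_vanish_bordered:
  assumes y: "sndv n w \<in> V"
  shows "minors_vanish (Suc r) (bordered w) \<longleftrightarrow>
    sndv n w \<in> Sing n V ps \<or> fstv n w - sndv n w \<in> vec_space.col_space n (D (sndv n w))"
proof -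
  let ?v = "fstv n w - sndv n w"
  have v: "?v \<in> carrier_vec n" by simp
  note R = rank_append_column[OF Dmat_carrier v, of ps "sndv n w", folded bordered_def]
  have "vec_space.rank n (bordered w) < Suc r \<longleftrightarrow>
    sndv n w \<in> Sing n V ps \<or> ?v \<in> vec_space.col_space n (D (sndv n w))"
    using R(2-4) rank_le[OF y] y by (auto simp: Sing_eq)
  then show ?thesis by (simp add: minors_vanish_iff_rank[OF bordered_carrier])
qed

section \<open>Decomposition of \<open>Sigma1\<close> along the singular locus\<close>

abbreviation cyl where "cyl B \<equiv> vec_prod (carrier_vec n) B"

lemma cyl_V: "cyl V = {w \<in> carrier_vec (2 * n). sndv n w \<in> V}"
  and cyl_Sing: "cyl (Sing n V ps) = {w \<in> carrier_vec (2 * n). sndv n w \<in> Sing n V ps}"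
  using vec_prod_eq[of V n] vec_prod_eq[of "Sing n V ps" n] carrier Sing_subset by blast+

lemma variety_cyl: "variety (2 * n) (cyl V)" "variety (2 * n) (cyl (Sing n V ps))"
  unfolding cyl_V cyl_Sing using variety_cylinder var variety_Sing by auto

text \<open>A difference of two varieties, which is the form needed for quasi-algebraicity.\<close>

lemma Sigma0_eq_diff: "Sigma0 n V ps = Sigma1 n V ps - cyl (Sing n V ps)"
  using minors_vanish_bordered by (auto simp: Sigma0_eq Sigma1_eq cyl_Sing)

lemma Sigma1_Un: "Sigma1 n V ps = Sigma0 n V ps \<union> cyl (Sing n V ps)"
proof -
  have "cyl (Sing n V ps) \<subseteq> Sigma1 n V ps"
    using minors_vanish_bordered Sing_subset by (auto simp: Sigma1_eq cyl_Sing)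
  then show ?thesis using Sigma0_eq_diff by blast
qed

abbreviation \<Sigma> where "\<Sigma> \<equiv> SigmaV n V ps"

lemma Sigma0_subset: "Sigma0 n V ps \<subseteq> \<Sigma>"
  unfolding SigmaV_def by (rule zariski_closure_superset)

lemma SigmaV_subset_Sigma1: "\<Sigma> \<subseteq> Sigma1 n V ps"
  unfolding SigmaV_def by (rule zariski_closure_minimal[OF variety_Sigma1]) (use Sigma1_Un in blast)

lemma SigmaV_subset_cyl: "\<Sigma> \<subseteq> cyl V"
  using SigmaV_subset_Sigma1 by (auto simp: Sigma1_eq cyl_V)

lemma SigmaV_carrier: "w \<in> \<Sigma> \<Longrightarrow> w \<in> carrier_vec (2 * n)"
  using SigmaV_subset_cyl by (auto simp: cyl_V)

lemma variety_SigmaV: "variety (2 * n) \<Sigma>"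
  unfolding SigmaV_def by (rule zariski_closure_variety[OF Sigma0_carrier])

lemma Sigma1_Un_SigmaV: "Sigma1 n V ps = \<Sigma> \<union> cyl (Sing n V ps)"
  using Sigma1_Un Sigma0_subset SigmaV_subset_Sigma1 by blast

lemma Sigma0_nonempty:
  obtains w where "w \<in> Sigma0 n V ps"
proof -
  obtain y where "y \<in> Reg" by (rule regular_exists)
  then have "\<Phi> (0\<^sub>v (length ps)) y \<in> Sigma0 n V ps"
    unfolding Sigma0_param using zero_carrier_vec by blast
  then show thesis by (rule that)
qed

lemma SigmaV_not_subset_cyl_Sing: "\<not> \<Sigma> \<subseteq> cyl (Sing n V ps)"
proof -
  obtain w where "w \<in> Sigma0 n V ps" by (rule Sigma0_nonempty)
  then show ?thesis using Sigma0_subset Sigma0_eq_diff by blast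
qed

lemma irreducible_SigmaV: "irreducible_variety (2 * n) \<Sigma>"
  unfolding SigmaV_def Sigma0_param
proof (rule irreducible_family[OF irr variety_Sing])
  show "Reg \<noteq> {}" using regular_exists by blast
  have c: "y + D y *\<^sub>v t \<in> carrier_vec n" if "t \<in> carrier_vec (length ps)" "y \<in> carrier_vec n" for t y
    using that mult_mat_vec_carrier[OF Dmat_carrier] by (intro add_carrier_vec) auto
  have ix: "(y + D y *\<^sub>v t) $ i = y $ i + (\<Sum>j<length ps. D y $$ (i, j) * t $ j)"
    if "t \<in> carrier_vec (length ps)" "i < n" for t y i
    using that by (simp add: scalar_prod_def lessThan_atLeast0)
  show "\<Phi> t y \<in> carrier_vec (2 * n)" if "t \<in> carrier_vec (length ps)" "y \<in> V" for t y
    unfolding \<Phi>_def using c that carrier by (intro append_carrier2) auto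
  show "polyfun n (\<lambda>y. \<Phi> t y $ i)" if "i < 2 * n" "t \<in> carrier_vec (length ps)" for t i
    unfolding \<Phi>_def
  proof (rule polyfun_append)
    fix i assume "i < n"
    then show "polyfun n (\<lambda>y. (y + D y *\<^sub>v t) $ i)"
      unfolding ix[OF that(2) \<open>i < n\<close>]
      by (intro polyfun_add polyfun_index polyfun_sum polyfun_mult polyfun_const polyfun_Dmat) auto
  qed (use that c in \<open>auto simp: polyfun_index\<close>)
  show "polyfun (length ps) (\<lambda>t. \<Phi> t y $ i)" if "i < 2 * n" "y \<in> V" for y i
    unfolding \<Phi>_def
  proof (rule polyfun_append)
    fix i assume i: "i < n"
    have "polyfun (length ps) (\<lambda>t. y $ i + (\<Sum>j<length ps. D y $$ (i, j) * t $ j))"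
      by (intro polyfun_add polyfun_index polyfun_sum polyfun_mult polyfun_const)
    then show "polyfun (length ps) (\<lambda>t. (y + D y *\<^sub>v t) $ i)"
      by (rule polyfun_cong) (use ix i in simp)
  qed (use that c carrier in \<open>auto simp: polyfun_const\<close>)
qed

text \<open>An irreducible \<open>W\<close> between \<Sigma> and \<open>Sigma1\<close> lies in
  \<Sigma> or in the cylinder over the singular locus. The latter is excluded because
  \<open>Sigma0\<close> is nonempty and disjoint from that cylinder.\<close>

lemma SigmaV_component: "\<Sigma> \<in> irreducible_components (2 * n) (Sigma1 n V ps)"
  unfolding irreducible_components_def
proof (intro CollectI conjI allI impI)
  fix W assume W: "irreducible_variety (2 * n) W \<and> \<Sigma> \<subseteq> W \<and> W \<subseteq> Sigma1 n V ps"
  then have "W \<subseteq> \<Sigma> \<or> W \<subseteq> cyl (Sing n V ps)"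
    using irreducible_Un[of "2 * n" W \<Sigma> "cyl (Sing n V ps)"] Sigma1_Un_SigmaV variety_SigmaV variety_cyl
    by auto
  moreover have "\<not> W \<subseteq> cyl (Sing n V ps)" using SigmaV_not_subset_cyl_Sing W by blast
  ultimately show "W = \<Sigma>" using W by blast
qed (use irreducible_SigmaV SigmaV_subset_Sigma1 in auto)

section \<open>Dimension and smoothness\<close>

lemma regular_minor:
  assumes "y \<in> Reg"
  obtains f g where "inj_on f {..<r}" "inj_on g {..<r}" "\<And>i. i < r \<Longrightarrow> f i < n"
    "\<And>j. j < r \<Longrightarrow> g j < length ps" "det (mat r r (\<lambda>(i, j). D y $$ (f i, g j))) \<noteq> 0"
  using nonzero_minor_of_rank[OF Dmat_carrier, of r n ps y] rank_regular[OF assms] by (metis order_refl)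

text \<open>Over a generic \<open>y\<close>, the \<open>r\<close> entries of \<open>x\<close>
  indexed by the rows of a nonzero minor take arbitrary values as \<open>x\<close> runs through
  \<open>y + range D(y)\<close>. A relation between these entries and the \<open>S\<close>-entries
  of \<open>y\<close> would thus restrict to a relation in \<open>S\<close> on
  \<open>V\<close>.\<close>

lemma adim_SigmaV_ge: "n \<le> adim (2 * n) \<Sigma>"
proof -
  obtain S where S: "S \<subseteq> {..<n}" "indep V S" "card S = adim n V" by (rule adim_witness[OF nonempty])
  have fS: "finite S" using S finite_subset by blast
  obtain y0 where y0: "y0 \<in> Reg" by (rule regular_exists)
  obtain f g where fg: "inj_on f {..<r}" "inj_on g {..<r}" "\<And>i. i < r \<Longrightarrow> f i < n"
    "\<And>j. j < r \<Longrightarrow> g j < length ps" "det (mat r r (\<lambda>(i, j). D y0 $$ (f i, g j))) \<noteq> 0"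
    by (rule regular_minor[OF y0]) blast
  let ?B = "\<lambda>y. mat r r (\<lambda>(i, j). D y $$ (f i, g j))"
  have "polyfun n (\<lambda>y. det (?B y))"
    by (rule polyfun_det[where k = r]) (use fg in \<open>auto intro!: polyfun_Dmat\<close>)
  then obtain \<mu> where \<mu>: "\<And>y. y \<in> carrier_vec n \<Longrightarrow> det (?B y) = poly_eval \<mu> y"
    unfolding polyfun_def by blast
  have "poly_eval \<mu> y0 \<noteq> 0" using \<mu>[of y0] fg(5) y0 carrier by auto
  then have \<mu>V: "\<mu> \<notin> vanish V" using y0 by (auto simp: vanish_def)
  \<comment> \<open>Entries of \<open>x\<close> keep their index in the concatenated vector; those
    of \<open>y\<close> are shifted by \<open>n\<close>.\<close>
  let ?J = "f ` {..<r} \<union> (\<lambda>s. n + s) ` S"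
  have J: "?J \<subseteq> {..<2 * n}" using fg(3) S(1) by force
  have "f ` {..<r} \<inter> (\<lambda>s. n + s) ` S = {}" using fg(3) by fastforce
  then have "card ?J = card (f ` {..<r}) + card ((\<lambda>s. n + s) ` S)"
    using fS by (intro card_Un_disjoint) auto
  also have "\<dots> = r + d" using fg(1) S(3) by (simp add: card_image adim_V)
  also have "\<dots> = n" using d_le by (simp add: r_def)
  finally have cJ: "card ?J = n" .
  have "indep \<Sigma> ?J"
    unfolding indep_def
  proof (rule ccontr)
    assume "\<not> polys_in ?J \<inter> vanish \<Sigma> \<subseteq> {0}"
    then obtain F where F: "F \<in> polys_in ?J" "F \<in> vanish \<Sigma>" "F \<noteq> 0" by blast
    have "finite ?J" using fS by simp
    then obtain u where u: "u \<in> carrier_vec (2 * n)" "poly_eval F u \<noteq> 0"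
      using nonzero_polynomial_nonzero_value[OF _ F(1,3) J] by blast
    let ?b = "fstv n u"
    \<comment> \<open>Freezing the first component at that of \<open>u\<close> leaves a polynomial
      in the \<open>S\<close>-entries of \<open>y\<close>, nonzero because \<open>F\<close> is
      nonzero at \<open>u\<close>.\<close>
    have "\<exists>H\<in>polys_in S. \<forall>y\<in>carrier_vec n. poly_eval H y = poly_eval F (?b @\<^sub>v y)"
      using F(1)
    proof (induction rule: polys_in_induct)
      case (const c)
      then show ?case by (intro bexI[of _ "Const c"]) auto
    next
      case (var i)
      then consider k where "k < r" "i = f k" | s where "s \<in> S" "i = n + s" by blast
      then show ?case
      proof cases
        case 1
        then have "i < n" using fg(3) by simp
        then show ?thesis
          using append_index(1)[OF fstv_carrier] by (intro bexI[of _ "Const (?b $ i)"]) auto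
      next
        case 2
        then have "s < n" using S(1) by auto
        then show ?thesis
          using append_index(2)[OF fstv_carrier] 2 by (intro bexI[of _ "Var s"]) auto
      qed
    next
      case (add p q)
      then obtain P Q where "P \<in> polys_in S" "\<forall>y\<in>carrier_vec n. poly_eval P y = poly_eval p (?b @\<^sub>v y)"
        "Q \<in> polys_in S" "\<forall>y\<in>carrier_vec n. poly_eval Q y = poly_eval q (?b @\<^sub>v y)" by blast
      then show ?case by (intro bexI[of _ "P + Q"]) (auto intro: polys_in_add)
    next
      case (mult p q)
      then obtain P Q where "P \<in> polys_in S" "\<forall>y\<in>carrier_vec n. poly_eval P y = poly_eval p (?b @\<^sub>v y)"
        "Q \<in> polys_in S" "\<forall>y\<in>carrier_vec n. poly_eval Q y = poly_eval q (?b @\<^sub>v y)" by blast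
      then show ?case by (intro bexI[of _ "P * Q"]) (auto intro: polys_in_mult)
    qed
    then obtain H where H: "H \<in> polys_in S" "\<And>y. y \<in> carrier_vec n \<Longrightarrow> poly_eval H y = poly_eval F (?b @\<^sub>v y)"
      by blast
    have "poly_eval H (sndv n u) \<noteq> 0" using H(2)[OF sndv_carrier] u append_fstv_sndv[OF u(1)] by simp
    then have "H \<noteq> 0" by auto
    then have HV: "H \<notin> vanish V" using H(1) S(2) unfolding indep_def by blast
    obtain y where y: "y \<in> V" "\<And>p. p \<in> {H, \<mu>} \<Longrightarrow> poly_eval p y \<noteq> 0"
      by (rule irreducible_common_point[OF irr, of "{H, \<mu>}"]) (use HV \<mu>V in auto)
    have yc: "y \<in> carrier_vec n" using y carrier by blast
    have det: "det (?B y) \<noteq> 0" using \<mu>[OF yc] y(2)[of \<mu>] by simp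
    have "r \<le> rk y" by (rule vec_space.rank_ge_minor[OF Dmat_carrier fg(3,4) det])
    then have yR: "y \<in> Reg" using y(1) by (auto simp: Sing_eq)
    \<comment> \<open>Solves for coefficients that make the entries of \<open>x\<close> in the rows
      \<open>f\<close> agree with those of \<open>?b\<close>.\<close>
    obtain s where s: "s \<in> carrier_vec r" "?B y *\<^sub>v s = vec r (\<lambda>i. ?b $ f i - y $ f i)"
      using solve_linear_system[OF _ det, where b = "vec r (\<lambda>i. ?b $ f i - y $ f i)"] by auto
    \<comment> \<open>The selected columns with all \<open>n\<close> rows: its product with
      \<open>s\<close> lies in the column space of \<open>D y\<close> and extends the solution to a
      full vector.\<close>
    define B' where "B' = mat n r (\<lambda>(i, j). D y $$ (i, g j))"
    have B'c: "B' \<in> carrier_mat n r" by (simp add: B'_def)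
    have colB: "col B' j = col (D y) (g j)" if "j < r" for j
      using that fg(4)[OF that] Dmat_carrier[of n ps y] by (intro eq_vecI) (auto simp: B'_def)
    have "set (cols B') \<subseteq> set (cols (D y))"
    proof
      fix c assume "c \<in> set (cols B')"
      then obtain j where j: "j < r" "c = col B' j"
        using B'c by (metis carrier_matD(2) cols_length cols_nth in_set_conv_nth)
      then show "c \<in> set (cols (D y))"
        using colB fg(4) Dmat_carrier[of n ps y] by (metis carrier_matD(2) cols_length cols_nth nth_mem)
    qed
    then have "vec_space.col_space n B' \<subseteq> vec_space.col_space n (D y)"
    proof -
      interpret vec_space "TYPE(complex)" n .
      show "set (cols B') \<subseteq> set (cols (D y)) \<Longrightarrow> ?thesis"
        unfolding col_space_def by (rule span_is_monotone)
    qed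
    moreover have B's: "B' *\<^sub>v s \<in> carrier_vec n" using s(1) B'c by simp
    then have "B' *\<^sub>v s \<in> vec_space.col_space n B'"
      using vec_space.col_space_eq[OF B'c] s(1) B'c by auto
    ultimately have cs: "B' *\<^sub>v s \<in> vec_space.col_space n (D y)" by blast
    let ?x = "y + B' *\<^sub>v s"
    have xc: "?x \<in> carrier_vec n" using yc B's by simp
    have w: "?x @\<^sub>v y \<in> Sigma0 n V ps"
      unfolding Sigma0_def using xc yR cs by blast
    have xf: "?x $ f i = ?b $ f i" if i: "i < r" for i
    proof -
      have "(B' *\<^sub>v s) $ f i = (?B y *\<^sub>v s) $ i"
        using i fg(3)[OF i] s(1) by (simp add: B'_def scalar_prod_def)
      also have "\<dots> = ?b $ f i - y $ f i" using i by (simp add: s(2))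
      finally show ?thesis using fg(3)[OF i] carrier_vecD[OF B's] by simp
    qed
    have "poly_eval F (?x @\<^sub>v y) = poly_eval F (?b @\<^sub>v y)"
      using F(1)
    proof (rule poly_eval_cong)
      fix i assume "i \<in> ?J"
      then consider k where "k < r" "i = f k" | s where "s \<in> S" "i = n + s" by blast
      then show "(?x @\<^sub>v y) $ i = (?b @\<^sub>v y) $ i"
      proof cases
        case 1
        then have "i < n" using fg(3) by simp
        then show ?thesis
          using append_index(1)[OF xc yc] append_index(1)[OF fstv_carrier yc] xf 1 by simp
      next
        case 2
        then have "s < n" using S(1) by auto
        then show ?thesis
          using append_index(2)[OF xc yc] append_index(2)[OF fstv_carrier yc] 2 by simp
      qed
    qed
    then have "poly_eval F (?x @\<^sub>v y) \<noteq> 0" using H(2)[OF yc] y(2)[of H] by simp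
    then show False using F(2) w Sigma0_subset by (auto simp: vanish_def)
  qed
  then have "card ?J \<le> adim (2 * n) \<Sigma>" by (rule adim_ge[OF J])
  then show ?thesis using cJ by simp
qed

text \<open>A tangent vector of \<open>\<Sigma>\<close> at a point of \<open>\<Sigma>\<^sub>0\<close> is determined by \<open>n\<close> of its coordinates:
  the generators of the ideal of \<open>V\<close> determine the second component, and the bordered minors,
  which are affine in \<open>x\<close>, the first one.\<close>

lemma tangent_SigmaV:
  assumes qs: "ideal_generators (2 * n) \<Sigma> qs" and w: "w \<in> Sigma0 n V ps"
  shows "n \<le> vec_space.rank (2 * n) (Dmat (2 * n) qs w)"
proof -
  define y where "y = sndv n w"
  have wS: "w \<in> \<Sigma>" using w Sigma0_subset by blast
  have wc: "w \<in> carrier_vec (2 * n)" and yR: "y \<in> Reg" using w by (auto simp: Sigma0_eq y_def)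
  have yc: "y \<in> carrier_vec n" using yR carrier by blast
  have dw: "dim_vec w = 2 * n" using wc by simp
  obtain f g where fg: "inj_on f {..<r}" "inj_on g {..<r}" "\<And>i. i < r \<Longrightarrow> f i < n"
    "\<And>j. j < r \<Longrightarrow> g j < length ps" "det (mat r r (\<lambda>(i, j). D y $$ (f i, g j))) \<noteq> 0"
    by (rule regular_minor[OF yR]) blast
  let ?B = "mat r r (\<lambda>(i, j). D y $$ (f i, g j))"
  have Bc: "?B \<in> carrier_mat r r" by simp
  let ?I = "f ` {..<r}"
  \<comment> \<open>The equations of \<open>V\<close> determine the \<open>y\<close>-entries in
    \<open>?I\<close> from the others, and the bordered minors determine the
    \<open>x\<close>-entries outside \<open>?I\<close>. What remains free are these
    \<open>r + (n - r)\<close> coordinates.\<close>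
  let ?C = "?I \<union> (\<lambda>i. n + i) ` ({..<n} - ?I)"
  have I: "?I \<subseteq> {..<n}" using fg(3) by auto
  have C: "?C \<subseteq> {..<2 * n}" using I by force
  have "?I \<inter> (\<lambda>i. n + i) ` ({..<n} - ?I) = {}" using I by fastforce
  then have "card ?C = card ?I + card ((\<lambda>i. n + i) ` ({..<n} - ?I))"
    by (intro card_Un_disjoint) auto
  also have "\<dots> = r + (n - r)" using I fg(1) by (simp add: card_image card_Diff_subset)
  also have "\<dots> = n" by (simp add: r_def)
  finally have cC: "card ?C = n" .
  have "2 * n \<le> vec_space.rank (2 * n) (Dmat (2 * n) qs w) + card ?C"
  proof (rule vec_space.trivial_left_kernel_rank[OF Dmat_carrier C])
    fix v :: "complex vec"
    assume v: "v \<in> carrier_vec (2 * n)"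
      and tan: "\<And>j. j < length qs \<Longrightarrow> v \<bullet> col (Dmat (2 * n) qs w) j = 0"
      and vC: "\<And>i. i \<in> ?C \<Longrightarrow> v $ i = 0"
    have tangent: "(\<Sum>i<n. v $ i * poly_eval (partial_deriv i p) w) +
        (\<Sum>i<n. v $ (n + i) * poly_eval (partial_deriv (n + i) p) w) = 0"
      if p: "p \<in> polys (2 * n)" "p \<in> vanish \<Sigma>" for p
    proof -
      have "0 = v \<bullet> grad (2 * n) p w"
        using tangent_generators[OF qs wS wc v tan p] by simp
      also have "\<dots> = (\<Sum>i<n + n. v $ i * poly_eval (partial_deriv i p) w)"
        by (simp add: scalar_prod_def grad_def lessThan_atLeast0 mult_2)
      also have "\<dots> = (\<Sum>i<n. v $ i * poly_eval (partial_deriv i p) w) +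
        (\<Sum>i<n. v $ (n + i) * poly_eval (partial_deriv (n + i) p) w)"
        by (simp add: sum_lessThan_add)
      finally show ?thesis by simp
    qed
    have vI: "v $ f i = 0" if "i < r" for i using vC that by auto
    have vnI: "v $ (n + i) = 0" if "i < n" "i \<notin> ?I" for i using vC that by auto
    have upd_snd: "sndv n (vec_upd w i s) = y" if "i < n" for i s
      unfolding y_def by (intro eq_vecI) (use that dw in \<open>auto simp: vec_upd_index\<close>)
    have upd_snd2: "sndv n (vec_upd w (n + i) s) = vec_upd y i s" if "i < n" for i s
      unfolding y_def by (intro eq_vecI) (use that dw in \<open>auto simp: vec_upd_index\<close>)
    let ?u = "vec r (\<lambda>i. v $ (n + f i))"
    \<comment> \<open>\<open>?u\<close> collects the only entries of the second component not yet
      known to vanish. Each selected generator of the ideal of \<open>V\<close>, pulled back to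
      pairs, contributes one equation.\<close>
    have "?B\<^sup>T *\<^sub>v ?u = 0\<^sub>v r"
    proof (rule eq_vecI)
      fix j assume "j < dim_vec (0\<^sub>v r)"
      then have j: "j < r" by simp
      let ?q = "ps ! g j"
      have q: "?q \<in> polys n" "?q \<in> vanish V" using ideal_generators_member[OF gens fg(4)[OF j]] by auto
      obtain p where p: "p \<in> polys (2 * n)"
        "\<And>z. z \<in> carrier_vec (2 * n) \<Longrightarrow> poly_eval ?q (sndv n z) = poly_eval p z"
        using polyfun_poly_eval_sndv[OF q(1), of "2 * n"] unfolding polyfun_def by blast
      have "p \<in> vanish \<Sigma>"
        using SigmaV_subset_cyl q(2) p(2) unfolding cyl_V vanish_def by fastforce
      note t = tangent[OF p(1) this]
      have d1: "poly_eval (partial_deriv i p) w = 0" if i: "i < n" for i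
      proof (rule partial_deriv_eqI[OF p(1) wc])
        have "poly_eval p (vec_upd w i s) = poly_eval ?q y" for s
          using p(2)[of "vec_upd w i s"] wc upd_snd[OF i] by simp
        then show "((\<lambda>s. poly_eval p (vec_upd w i s)) has_field_derivative 0) (at (w $ i))"
          by simp
      qed (use i in simp)
      have d2: "poly_eval (partial_deriv (n + i) p) w = D y $$ (i, g j)" if i: "i < n" for i
      proof (rule partial_deriv_eqI[OF p(1) wc])
        have "poly_eval p (vec_upd w (n + i) s) = poly_eval ?q (vec_upd y i s)" for s
          using p(2)[of "vec_upd w (n + i) s"] wc upd_snd2[OF i] by simp
        moreover have "y $ i = w $ (n + i)" using i by (simp add: y_def)
        ultimately show "((\<lambda>s. poly_eval p (vec_upd w (n + i) s)) has_field_derivative D y $$ (i, g j)) (at (w $ (n + i)))"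
          using partial_deriv_has_derivative[OF q(1) yc i] i fg(4)[OF j] by (simp add: Dmat_def)
      qed (use i in simp)
      have "0 = (\<Sum>i<n. v $ (n + i) * D y $$ (i, g j))" using t by (simp add: d1 d2)
      also have "\<dots> = (\<Sum>i\<in>?I. v $ (n + i) * D y $$ (i, g j))"
        by (rule sum.mono_neutral_right) (use I vnI in auto)
      also have "\<dots> = (\<Sum>i<r. v $ (n + f i) * D y $$ (f i, g j))"
        using fg(1) by (simp add: sum.reindex)
      also have "\<dots> = (?B\<^sup>T *\<^sub>v ?u) $ j"
        using j by (simp add: scalar_prod_def lessThan_atLeast0 mult.commute)
      finally show "(?B\<^sup>T *\<^sub>v ?u) $ j = 0\<^sub>v r $ j" using j by simp
    qed simp
    moreover have "det ?B\<^sup>T \<noteq> 0" using fg(5) by (simp add: det_transpose[OF Bc])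
    ultimately have u0: "?u = 0\<^sub>v r"
      using det_0_iff_vec_prod_zero_field[of "?B\<^sup>T" r] vec_carrier[of r] Bc by (metis transpose_carrier_mat)
    have snd0: "v $ (n + i) = 0" if i: "i < n" for i
    proof (cases "i \<in> ?I")
      case True
      then obtain k where "k < r" "i = f k" by auto
      then show ?thesis using arg_cong[OF u0, of "\<lambda>z. z $ k"] by simp
    qed (use vnI i in blast)
    have fst0: "v $ k = 0" if k: "k < n" for k
    proof (cases "k \<in> ?I")
      case False
      \<comment> \<open>The rows of \<open>?B\<close> are extended by row \<open>k\<close>, and
        \<open>h\<close> adds the bordering column of index \<open>length ps\<close>. These minors
        of order \<open>Suc r\<close> vanish on \<open>Sigma1\<close>, hence on \<Sigma>.\<close>
      define F where "F = (\<lambda>i. if i < r then f i else k)"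
      have Fn: "F i < n" for i using fg(3) k by (simp add: F_def)
      define h where "h = (\<lambda>j. if j < r then g j else length ps)"
      let ?N = "\<lambda>z. mat (Suc r) (Suc r) (\<lambda>(i, j). bordered z $$ (F i, h j))"
      have Nz: "?N z = mat (Suc r) (Suc r) (\<lambda>(i, j). if j < r then D (sndv n z) $$ (F i, g j) else z $ F i - z $ (n + F i))" for z
        by (rule eq_matI) (use fg(4) Fn in \<open>auto simp: h_def bordered_index\<close>)
      have "polyfun (2 * n) (\<lambda>z. det (?N z))"
      proof (rule polyfun_det[where k = "Suc r"])
        fix i j assume ij: "i < Suc r" "j < Suc r"
        show "polyfun (2 * n) (\<lambda>z. ?N z $$ (i, j))"
        proof (cases "j < r")
          case True
          have "ps ! g j \<in> polys n" using ideal_generators_member[OF gens fg(4)[OF True]] by blast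
          then have "partial_deriv (F i) (ps ! g j) \<in> polys n" by (simp add: polys_eq polys_in_partial_deriv)
          then show ?thesis unfolding Nz
            using polyfun_poly_eval_sndv ij True Fn fg(4) by (simp add: Dmat_def)
        next
          case False
          then show ?thesis unfolding Nz
            using ij by (simp add: polyfun_diff polyfun_index)
        qed
      qed simp
      then obtain p where p: "p \<in> polys (2 * n)"
        "\<And>z. z \<in> carrier_vec (2 * n) \<Longrightarrow> det (?N z) = poly_eval p z"
        unfolding polyfun_def by blast
      have "poly_eval p z = 0" if z: "z \<in> \<Sigma>" for z
      proof (rule ccontr)
        assume "poly_eval p z \<noteq> 0"
        then have "det (?N z) \<noteq> 0" using p(2)[OF SigmaV_carrier[OF z]] by simp
        then have "Suc r \<le> vec_space.rank n (bordered z)"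
          by (intro vec_space.rank_ge_minor[OF bordered_carrier]) (use Fn fg(4) in \<open>auto simp: h_def less_Suc_eq\<close>)
        moreover have "minors_vanish (Suc r) (bordered z)"
          using z SigmaV_subset_Sigma1 by (auto simp: Sigma1_eq)
        ultimately show False by (simp add: minors_vanish_iff_rank[OF bordered_carrier])
      qed
      then have "p \<in> vanish \<Sigma>" by (simp add: vanish_def)
      note t = tangent[OF p(1) this]
      obtain c where c: "c r = det (mat r r (\<lambda>(i, j). D y $$ (F i, g j)))"
        "\<And>z. det (mat (Suc r) (Suc r) (\<lambda>(i, j). if j < r then D y $$ (F i, g j) else z i)) = (\<Sum>i<Suc r. z i * c i)"
        using det_last_column[of r "\<lambda>i j. D y $$ (F i, g j)"] by blast
      have "mat r r (\<lambda>(i, j). D y $$ (F i, g j)) = ?B" by (rule eq_matI) (auto simp: F_def)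
      then have cr: "c r \<noteq> 0" using fg(5) c(1) by simp
      \<comment> \<open>With the second component held fixed, the minor is affine in the first, with
        the cofactors as coefficients.\<close>
      have der: "poly_eval (partial_deriv l p) w = (\<Sum>i<Suc r. if F i = l then c i else 0)" if l: "l < n" for l
      proof (rule partial_deriv_eqI[OF p(1) wc])
        have "poly_eval p (vec_upd w l s) = (\<Sum>i<Suc r. ((if F i = l then s else w $ F i) - w $ (n + F i)) * c i)" for s
        proof -
          have z: "vec_upd w l s \<in> carrier_vec (2 * n)" using wc by simp
          have "poly_eval p (vec_upd w l s) = (\<Sum>i<Suc r. (vec_upd w l s $ F i - vec_upd w l s $ (n + F i)) * c i)"
            unfolding p(2)[OF z, symmetric] Nz upd_snd[OF l] c(2) ..
          also have "\<dots> = (\<Sum>i<Suc r. ((if F i = l then s else w $ F i) - w $ (n + F i)) * c i)"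
          proof (intro sum.cong refl)
            fix i
            have "F i < 2 * n" "n + F i < 2 * n" "n + F i \<noteq> l" using Fn[of i] l by auto
            then show "(vec_upd w l s $ F i - vec_upd w l s $ (n + F i)) * c i =
                ((if F i = l then s else w $ F i) - w $ (n + F i)) * c i"
              by (simp add: vec_upd_index dw)
          qed
          finally show ?thesis .
        qed
        moreover have "((\<lambda>s. \<Sum>i<Suc r. ((if F i = l then s else w $ F i) - w $ (n + F i)) * c i)
            has_field_derivative (\<Sum>i<Suc r. if F i = l then c i else 0)) (at (w $ l))"
        proof (rule DERIV_sum)
          fix i
          show "((\<lambda>s. ((if F i = l then s else w $ F i) - w $ (n + F i)) * c i)
              has_field_derivative (if F i = l then c i else 0)) (at (w $ l))"
            by (cases "F i = l") (auto intro!: derivative_eq_intros)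
        qed
        ultimately show "((\<lambda>s. poly_eval p (vec_upd w l s)) has_field_derivative
            (\<Sum>i<Suc r. if F i = l then c i else 0)) (at (w $ l))" by simp
      qed (use l in simp)
      \<comment> \<open>The second component of \<open>v\<close> is already zero, and
        \<open>v\<close> vanishes on \<open>?I\<close>. Outside \<open>?I\<close> the minor depends
        on the entry \<open>k\<close> alone, with coefficient \<open>det ?B\<close>.\<close>
      have "0 = (\<Sum>l<n. v $ l * poly_eval (partial_deriv l p) w)" using t snd0 by simp
      also have "\<dots> = (\<Sum>l<n. if l = k then v $ k * c r else 0)"
      proof (intro sum.cong refl)
        fix l assume "l \<in> {..<n}"
        then have l: "l < n" by simp
        show "v $ l * poly_eval (partial_deriv l p) w = (if l = k then v $ k * c r else 0)"
        proof (cases "l \<in> ?I")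
          case True
          then show ?thesis using vI False by auto
        next
          case lI: False
          have "(\<Sum>i<Suc r. if F i = l then c i else 0) = (\<Sum>i<r. if F i = l then c i else 0) + (if k = l then c r else 0)"
            by (simp add: F_def)
          also have "(\<Sum>i<r. if F i = l then c i else 0) = 0"
            by (rule sum.neutral) (use lI in \<open>auto simp: F_def\<close>)
          finally show ?thesis using der[OF l] by auto
        qed
      qed
      also have "\<dots> = v $ k * c r" using k by simp
      finally show ?thesis using cr by simp
    qed (use vI in auto)
    show "v = 0\<^sub>v (2 * n)"
    proof (rule eq_vecI)
      fix i assume "i < dim_vec (0\<^sub>v (2 * n))"
      then have i: "i < 2 * n" by simp
      show "v $ i = 0\<^sub>v (2 * n) $ i"
      proof (cases "i < n")
        case True
        then show ?thesis using fst0 i by simp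
      next
        case False
        then show ?thesis using snd0[of "i - n"] i by simp
      qed
    qed (use v in simp)
  qed
  then show ?thesis using cC by simp
qed

text \<open>Rank and dimension add up to at most \<open>2 * n\<close> at every point of \<Sigma>.
  Rank at least \<open>n\<close> at one point of \<open>Sigma0\<close> thus supplies the missing
  upper bound.\<close>

lemma adim_SigmaV: "adim (2 * n) \<Sigma> = n"
proof -
  obtain w where w: "w \<in> Sigma0 n V ps" by (rule Sigma0_nonempty)
  obtain qs where qs: "ideal_generators (2 * n) \<Sigma> qs"
    using ideal_generators_exist[of \<Sigma> "2 * n"] SigmaV_carrier by blast
  have "vec_space.rank (2 * n) (Dmat (2 * n) qs w) + adim (2 * n) \<Sigma> \<le> 2 * n"
    using rank_Dmat_le[OF irreducible_SigmaV qs] w Sigma0_subset by blast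
  then show ?thesis using tangent_SigmaV[OF qs w] adim_SigmaV_ge by linarith
qed

lemma dim_SigmaV: "variety_dim (2 * n) \<Sigma> = enat n"
  using variety_dim_eq_adim[OF irreducible_SigmaV] adim_SigmaV by simp

lemma Sigma0_smooth:
  assumes "ideal_generators (2 * n) \<Sigma> qs" "w \<in> Sigma0 n V ps"
  shows "w \<in> \<Sigma> - Sing (2 * n) \<Sigma> qs"
  using tangent_SigmaV[OF assms] assms(2) Sigma0_subset by (auto simp: Sing_def dim_SigmaV)

text \<open>An irreducible subvariety of \<open>Sigma1\<close> lies in \<Sigma> or in the cylinder
  over the singular locus. The only danger is that a component of the cylinder is absorbed by
  \<Sigma>, and this is where dimension enters.\<close>

lemma components_Sigma1:
  "irreducible_components (2 * n) (Sigma1 n V ps) - {\<Sigma>} =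
    irreducible_components (2 * n) (cyl (Sing n V ps))"
proof (intro equalityI subsetI)
  let ?CS = "cyl (Sing n V ps)"
  have split: "W \<subseteq> \<Sigma> \<or> W \<subseteq> ?CS" if "irreducible_variety (2 * n) W" "W \<subseteq> Sigma1 n V ps" for W
    using irreducible_Un[of "2 * n" W \<Sigma> ?CS] that Sigma1_Un_SigmaV variety_SigmaV variety_cyl by auto
  show "W \<in> irreducible_components (2 * n) ?CS"
    if W: "W \<in> irreducible_components (2 * n) (Sigma1 n V ps) - {\<Sigma>}" for W
  proof -
    have h: "irreducible_variety (2 * n) W" "W \<subseteq> Sigma1 n V ps" "W \<noteq> \<Sigma>"
      and mx: "\<And>W'. irreducible_variety (2 * n) W' \<Longrightarrow> W \<subseteq> W' \<Longrightarrow> W' \<subseteq> Sigma1 n V ps \<Longrightarrow> W' = W"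
      using W by (auto simp: irreducible_components_def)
    have "\<not> W \<subseteq> \<Sigma>" using mx[OF irreducible_SigmaV _ SigmaV_subset_Sigma1] h(3) by blast
    then have "W \<subseteq> ?CS" using split h by blast
    moreover have "?CS \<subseteq> Sigma1 n V ps" using Sigma1_Un_SigmaV by blast
    ultimately have "\<forall>W'. irreducible_variety (2 * n) W' \<and> W \<subseteq> W' \<and> W' \<subseteq> ?CS \<longrightarrow> W' = W"
      using mx by (meson order_trans)
    with \<open>W \<subseteq> ?CS\<close> h(1) show ?thesis unfolding irreducible_components_def by simp
  qed
  show "W \<in> irreducible_components (2 * n) (Sigma1 n V ps) - {\<Sigma>}"
    if W: "W \<in> irreducible_components (2 * n) ?CS" for W
  proof -
    have h: "irreducible_variety (2 * n) W" "W \<subseteq> ?CS"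
      and mx: "\<And>W'. irreducible_variety (2 * n) W' \<Longrightarrow> W \<subseteq> W' \<Longrightarrow> W' \<subseteq> ?CS \<Longrightarrow> W' = W"
      using W by (auto simp: irreducible_components_def)
    have "W \<noteq> \<Sigma>" using SigmaV_not_subset_cyl_Sing h(2) by blast
    \<comment> \<open>Proper containment would force dimension below \<open>n\<close>, whereas
      translation invariance gives at least \<open>n\<close>.\<close>
    moreover have "\<not> W \<subset> \<Sigma>"
      using adim_strict_mono[OF irreducible_SigmaV h(1)] adim_cylinder_component[OF variety_Sing W]
        adim_SigmaV by linarith
    ultimately have nS: "\<not> W \<subseteq> \<Sigma>" by blast
    have "W' = W" if W': "irreducible_variety (2 * n) W'" "W \<subseteq> W'" "W' \<subseteq> Sigma1 n V ps" for W'
    proof (rule mx[OF W'(1,2)])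
      show "W' \<subseteq> ?CS" using split[OF W'(1,3)] W'(2) nS by blast
    qed
    moreover have "W \<subseteq> Sigma1 n V ps" using h(2) Sigma1_Un_SigmaV by blast
    ultimately show ?thesis
      using h(1) \<open>W \<noteq> \<Sigma>\<close> unfolding irreducible_components_def by simp
  qed
qed

end

theorem lemma4p3:
  fixes n d :: nat and V :: "complex vec set" and ps :: "cpoly list"
  assumes "irreducible_variety n V"
    and "ideal_generators n V ps"
    and "variety_dim n V = enat d"
    and "1 \<le> d" and "d \<le> n - 1"
  shows "variety (2 * n) (Sigma1 n V ps)
    \<and> quasi_algebraic (2 * n) (Sigma0 n V ps)
    \<and> Sigma0 n V ps \<subseteq> SigmaV n V ps
    \<and> SigmaV n V ps \<subseteq> vec_prod (carrier_vec n) V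
    \<and> irreducible_variety (2 * n) (SigmaV n V ps)
    \<and> variety_dim (2 * n) (SigmaV n V ps) = enat n
    \<and> SigmaV n V ps \<in> irreducible_components (2 * n) (Sigma1 n V ps)
    \<and> (\<forall>qs. ideal_generators (2 * n) (SigmaV n V ps) qs \<longrightarrow>
         (\<forall>w \<in> Sigma0 n V ps. w \<in> SigmaV n V ps - Sing (2 * n) (SigmaV n V ps) qs))
    \<and> (Sing n V ps \<noteq> {} \<longrightarrow>
         irreducible_components (2 * n) (Sigma1 n V ps) - {SigmaV n V ps}
         = irreducible_components (2 * n) (vec_prod (carrier_vec n) (Sing n V ps)))"
proof -
  interpret generated_variety n d V ps
    using assms by unfold_locales
  have "quasi_algebraic (2 * n) (Sigma0 n V ps)"
    unfolding quasi_algebraic_def using variety_Sigma1 variety_cyl(2) Sigma0_eq_diff by blast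
  then show ?thesis
    using variety_Sigma1 Sigma0_subset SigmaV_subset_cyl irreducible_SigmaV dim_SigmaV
      SigmaV_component Sigma0_smooth components_Sigma1 by blast
qed

end
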